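(* Let $\mathcal L$ be a unital Lie--Jordan Banach algebra, $\mathcal F=\mathcal L\oplus i\mathcal L$ the associated $C^*$-algebra, and $\mathcal J$ a closed Jordan ideal of $\mathcal L$. Let $\mathcal N_{\mathcal J}=\{a\in\mathcal L : [a,\mathcal J]\subset\mathcal J\}$, let $\widetilde{\mathcal L}=\mathcal N_{\mathcal J}/(\mathcal N_{\mathcal J}\cap\mathcal J)$ be the reduced Lie--Jordan Banach algebra, and put $\mathcal O=\mathcal N_{\mathcal J}\oplus i\mathcal N_{\mathcal J}$ and $\mathcal D=\mathcal J\oplus i\mathcal J$ (subspaces of $\mathcal F$). Then $\widetilde{\mathcal L}$ defines a $C^*$-algebra $\widetilde{\mathcal F}=\widetilde{\mathcal L}\oplus i\widetilde{\mathcal L}$, obtained from $\mathcal F$ as $$\widetilde{\mathcal F}=\widetilde{\mathcal L}\oplus i\widetilde{\mathcal L}=\frac{\mathcal N_{\mathcal J}\oplus i\,\mathcal N_{\mathcal J}}{(\mathcal N_{\mathcal J}\cap\mathcal J)\oplus i\,(\mathcal N_{\mathcal J}\cap\mathcal J)}=\frac{\mathcal O}{\mathcal D\cap\mathcal O}$$ (equality under the natural identifications).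
   Context: A Lie--Jordan algebra is a real vector space $\mathcal L$ with a commutative bilinear product $\circ$ satisfying $(a^2\circ b)\circ a=a^2\circ(b\circ a)$, where $a^2=a\circ a$, and a skew-symmetric bilinear bracket $[\cdot,\cdot]$ satisfying the Jacobi identity, the Leibniz identity $[a,b\circ c]=[a,b]\circ c+b\circ[a,c]$, and $(a\circ b)\circ c-a\circ(b\circ c)=k\,[b,[c,a]]$ for some fixed real $k>0$. It is unital if $\circ$ has a unit. A Lie--Jordan Banach algebra (LJB-algebra) is a Lie--Jordan algebra with a complete norm such that $\|a\circ b\|\le\|a\|\,\|b\|$, $\|a\circ a\|=\|a\|^2$, $\|a\circ a\|\le\|a\circ a+b\circ b\|$ for all $a,b$, and such that the bracket is continuous. For a unital LJB-algebra $\mathcal L$, the space $\mathcal L\oplus i\mathcal L$ is a $C^*$-algebra with the complex-bilinear product extending $ab=a\circ b-i\sqrt{k}\,[a,b]$ ($a,b\in\mathcal L$), involution $(a+ib)^*=a-ib$, and the $C^*$-norm extending the norm of $\mathcal L$; its self-adjoint part is $\mathcal L$. A Jordan ideal of $\mathcal L$ is a linear subspace $\mathcal J$ with $\mathcal L\circ\mathcal J\subset\mathcal J$. The quotient $\widetilde{\mathcal L}$ carries the induced operations and the quotient norm, for which it is a unital LJB-algebra. *)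

theory Defs
  imports "HOL-Analysis.Abstract_Metric_Spaces" "HOL-Algebra.QuotRing" "HOL-Algebra.Module"
begin

text \<open>
  All structures are carrier-based records extending the module record of HOL-Algebra, because
  the reduced algebra is a set of cosets and has to be an object of the same kind as the given
  algebra. For a Lie--Jordan algebra the ring multiplication \<open>\<otimes>\<close> is the Jordan product and
  \<open>\<one>\<close> is its unit; for a C*-algebra \<open>\<otimes>\<close> is the associative product.
\<close>

definition scalars :: "'k::real_normed_field ring" where
  "scalars = \<lparr>carrier = UNIV, mult = (*), one = 1, zero = 0, add = (+)\<rparr>"

record ('k, 'a) normed_alg = "('k, 'a) module" +
  nrm :: "'a \<Rightarrow> real"

record 'a lie_jordan = "(real, 'a) normed_alg" +
  bracket :: "'a \<Rightarrow> 'a \<Rightarrow> 'a"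

record 'a star_alg = "(complex, 'a) normed_alg" +
  star :: "'a \<Rightarrow> 'a"

(* The value 0 off the carrier is there because the library locale Metric_space asks for
   nonnegativity and symmetry at all arguments. *)
definition norm_dist :: "('k, 'a, 'm) normed_alg_scheme \<Rightarrow> 'a \<Rightarrow> 'a \<Rightarrow> real" where
  "norm_dist V x y =
     (if x \<in> carrier V \<and> y \<in> carrier V then nrm V (x \<ominus>\<^bsub>V\<^esub> y) else 0)"

abbreviation norm_topology :: "('k, 'a, 'm) normed_alg_scheme \<Rightarrow> 'a topology" where
  "norm_topology V \<equiv> Metric_space.mtopology (carrier V) (norm_dist V)"

locale banach_space =
  Module.module "scalars :: 'k::real_normed_field ring" V
  for V :: "('k::real_normed_field, 'a, 'm) normed_alg_scheme" (structure) +
  assumes norm_nonneg: "x \<in> carrier V \<Longrightarrow> 0 \<le> nrm V x"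
    and norm_eq_0: "x \<in> carrier V \<Longrightarrow> nrm V x = 0 \<longleftrightarrow> x = \<zero>"
    and norm_smult: "x \<in> carrier V \<Longrightarrow> nrm V (c \<odot> x) = norm c * nrm V x"
    and norm_triangle:
      "x \<in> carrier V \<Longrightarrow> y \<in> carrier V \<Longrightarrow> nrm V (x \<oplus> y) \<le> nrm V x + nrm V y"
    and complete: "Metric_space.mcomplete (carrier V) (norm_dist V)"

locale lie_jordan_algebra =
  Module.module "scalars :: real ring" L
  for k :: real and L :: "('a, 'm) lie_jordan_scheme" (structure) +
  assumes k_pos: "0 < k"
    and jordan_closed: "a \<in> carrier L \<Longrightarrow> b \<in> carrier L \<Longrightarrow> a \<otimes> b \<in> carrier L"
    and jordan_comm: "a \<in> carrier L \<Longrightarrow> b \<in> carrier L \<Longrightarrow> a \<otimes> b = b \<otimes> a"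
    and jordan_add: "a \<in> carrier L \<Longrightarrow> b \<in> carrier L \<Longrightarrow> c \<in> carrier L \<Longrightarrow>
      (a \<oplus> b) \<otimes> c = a \<otimes> c \<oplus> b \<otimes> c"
    and jordan_smult: "a \<in> carrier L \<Longrightarrow> b \<in> carrier L \<Longrightarrow> (t \<odot> a) \<otimes> b = t \<odot> (a \<otimes> b)"
    and jordan_identity: "a \<in> carrier L \<Longrightarrow> b \<in> carrier L \<Longrightarrow>
      ((a \<otimes> a) \<otimes> b) \<otimes> a = (a \<otimes> a) \<otimes> (b \<otimes> a)"
    and bracket_closed: "a \<in> carrier L \<Longrightarrow> b \<in> carrier L \<Longrightarrow> bracket L a b \<in> carrier L"
    and bracket_skew: "a \<in> carrier L \<Longrightarrow> b \<in> carrier L \<Longrightarrow> bracket L a b = \<ominus> bracket L b a"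
    and bracket_add: "a \<in> carrier L \<Longrightarrow> b \<in> carrier L \<Longrightarrow> c \<in> carrier L \<Longrightarrow>
      bracket L (a \<oplus> b) c = bracket L a c \<oplus> bracket L b c"
    and bracket_smult: "a \<in> carrier L \<Longrightarrow> b \<in> carrier L \<Longrightarrow>
      bracket L (t \<odot> a) b = t \<odot> bracket L a b"
    and jacobi: "a \<in> carrier L \<Longrightarrow> b \<in> carrier L \<Longrightarrow> c \<in> carrier L \<Longrightarrow>
      bracket L a (bracket L b c) \<oplus> bracket L b (bracket L c a) \<oplus> bracket L c (bracket L a b)
      = \<zero>"
    and leibniz: "a \<in> carrier L \<Longrightarrow> b \<in> carrier L \<Longrightarrow> c \<in> carrier L \<Longrightarrow>
      bracket L a (b \<otimes> c) = bracket L a b \<otimes> c \<oplus> b \<otimes> bracket L a c"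
    and associator: "a \<in> carrier L \<Longrightarrow> b \<in> carrier L \<Longrightarrow> c \<in> carrier L \<Longrightarrow>
      (a \<otimes> b) \<otimes> c \<ominus> a \<otimes> (b \<otimes> c) = k \<odot> bracket L b (bracket L c a)"

locale unital_LJB_algebra =
  lie_jordan_algebra k L + banach_space L
  for k :: real and L :: "('a, 'm) lie_jordan_scheme" (structure) +
  assumes one_closed: "\<one> \<in> carrier L"
    and unit: "a \<in> carrier L \<Longrightarrow> \<one> \<otimes> a = a"
    and norm_jordan_le:
      "a \<in> carrier L \<Longrightarrow> b \<in> carrier L \<Longrightarrow> nrm L (a \<otimes> b) \<le> nrm L a * nrm L b"
    and norm_square: "a \<in> carrier L \<Longrightarrow> nrm L (a \<otimes> a) = (nrm L a)\<^sup>2"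
    and norm_square_mono: "a \<in> carrier L \<Longrightarrow> b \<in> carrier L \<Longrightarrow>
      nrm L (a \<otimes> a) \<le> nrm L (a \<otimes> a \<oplus> b \<otimes> b)"
    and bracket_continuous:
      "continuous_map (prod_topology (norm_topology L) (norm_topology L)) (norm_topology L)
         (\<lambda>(a, b). bracket L a b)"

locale unital_cstar_algebra =
  ring A + banach_space A
  for A :: "('a, 'm) star_alg_scheme" (structure) +
  assumes smult_mult_left: "x \<in> carrier A \<Longrightarrow> y \<in> carrier A \<Longrightarrow>
      (c \<odot> x) \<otimes> y = c \<odot> (x \<otimes> y)"
    and smult_mult_right: "x \<in> carrier A \<Longrightarrow> y \<in> carrier A \<Longrightarrow>
      x \<otimes> (c \<odot> y) = c \<odot> (x \<otimes> y)"
    and star_closed: "x \<in> carrier A \<Longrightarrow> star A x \<in> carrier A"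
    and star_star: "x \<in> carrier A \<Longrightarrow> star A (star A x) = x"
    and star_add: "x \<in> carrier A \<Longrightarrow> y \<in> carrier A \<Longrightarrow> star A (x \<oplus> y) = star A x \<oplus> star A y"
    and star_smult: "x \<in> carrier A \<Longrightarrow> star A (c \<odot> x) = cnj c \<odot> star A x"
    and star_mult: "x \<in> carrier A \<Longrightarrow> y \<in> carrier A \<Longrightarrow> star A (x \<otimes> y) = star A y \<otimes> star A x"
    and norm_mult_le: "x \<in> carrier A \<Longrightarrow> y \<in> carrier A \<Longrightarrow> nrm A (x \<otimes> y) \<le> nrm A x * nrm A y"
    and cstar_identity: "x \<in> carrier A \<Longrightarrow> nrm A (star A x \<otimes> x) = (nrm A x)\<^sup>2"

(* S \<oplus> iS, where the pair (a, b) stands for a + ib *)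
definition plus_i :: "'a set \<Rightarrow> ('a \<times> 'a) set" where
  "plus_i S = S \<times> S"

(* The product is the complex-bilinear extension of a b = a \<otimes> b - i sqrt k [a, b]:
   (a + ib)(c + id) = (ac - bd) + i(ad + bc), sorted into real and imaginary parts. *)
definition complexification ::
  "real \<Rightarrow> ('a, 'm) lie_jordan_scheme \<Rightarrow> ('a \<times> 'a \<Rightarrow> real) \<Rightarrow> ('a \<times> 'a) star_alg" where
  "complexification k L n =
    \<lparr>carrier = plus_i (carrier L),
     mult = (\<lambda>(a, b) (c, d).
       ((a \<otimes>\<^bsub>L\<^esub> c \<ominus>\<^bsub>L\<^esub> b \<otimes>\<^bsub>L\<^esub> d) \<oplus>\<^bsub>L\<^esub> sqrt k \<odot>\<^bsub>L\<^esub> (bracket L a d \<oplus>\<^bsub>L\<^esub> bracket L b c),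
        (a \<otimes>\<^bsub>L\<^esub> d \<oplus>\<^bsub>L\<^esub> b \<otimes>\<^bsub>L\<^esub> c) \<ominus>\<^bsub>L\<^esub> sqrt k \<odot>\<^bsub>L\<^esub> (bracket L a c \<ominus>\<^bsub>L\<^esub> bracket L b d))),
     one = (\<one>\<^bsub>L\<^esub>, \<zero>\<^bsub>L\<^esub>),
     zero = (\<zero>\<^bsub>L\<^esub>, \<zero>\<^bsub>L\<^esub>),
     add = (\<lambda>(a, b) (c, d). (a \<oplus>\<^bsub>L\<^esub> c, b \<oplus>\<^bsub>L\<^esub> d)),
     smult = (\<lambda>z (a, b). (Re z \<odot>\<^bsub>L\<^esub> a \<ominus>\<^bsub>L\<^esub> Im z \<odot>\<^bsub>L\<^esub> b, Re z \<odot>\<^bsub>L\<^esub> b \<oplus>\<^bsub>L\<^esub> Im z \<odot>\<^bsub>L\<^esub> a)),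
     nrm = n,
     star = (\<lambda>(a, b). (a, \<ominus>\<^bsub>L\<^esub> b))\<rparr>"

(* n is the C*-norm on L \<oplus> iL extending the norm of L. There is at most one such n on the carrier,
   because n x ^ 2 = n (x* x) and x* x lies in L. *)
definition associated_cstar_norm ::
  "real \<Rightarrow> ('a, 'm) lie_jordan_scheme \<Rightarrow> ('a \<times> 'a \<Rightarrow> real) \<Rightarrow> bool" where
  "associated_cstar_norm k L n \<longleftrightarrow>
     unital_cstar_algebra (complexification k L n) \<and>
     (\<forall>a\<in>carrier L. n (a, \<zero>\<^bsub>L\<^esub>) = nrm L a)"

definition jordan_ideal :: "('a, 'm) lie_jordan_scheme \<Rightarrow> 'a set \<Rightarrow> bool" where
  "jordan_ideal L J \<longleftrightarrow>
     submodule J (scalars :: real ring) L \<and> (\<forall>a\<in>carrier L. \<forall>j\<in>J. a \<otimes>\<^bsub>L\<^esub> j \<in> J)"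

definition normalizer_of :: "('a, 'm) lie_jordan_scheme \<Rightarrow> 'a set \<Rightarrow> 'a set" where
  "normalizer_of L J = {a \<in> carrier L. \<forall>j\<in>J. bracket L a j \<in> J}"

text \<open>
  Quotients extend the factor ring \<open>Quot\<close> of HOL-Algebra: operations are induced on cosets
  through representatives, and the norm of a coset is the infimum of the norms of its elements.
\<close>

definition coset_smult :: "('k, 'a, 'm) module_scheme \<Rightarrow> 'a set \<Rightarrow> 'k \<Rightarrow> 'a set \<Rightarrow> 'a set" where
  "coset_smult R I c A = (\<Union>a\<in>A. I +>\<^bsub>R\<^esub> (c \<odot>\<^bsub>R\<^esub> a))"

definition coset_norm :: "('k, 'a, 'm) normed_alg_scheme \<Rightarrow> 'a set \<Rightarrow> real" where
  "coset_norm R A = (INF a\<in>A. nrm R a)"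

definition lie_jordan_quotient ::
  "('a, 'm) lie_jordan_scheme \<Rightarrow> 'a set \<Rightarrow> 'a set lie_jordan" where
  "lie_jordan_quotient L I =
    \<lparr>carrier = carrier (L Quot I), mult = mult (L Quot I), one = one (L Quot I),
     zero = zero (L Quot I), add = add (L Quot I),
     smult = coset_smult L I,
     nrm = coset_norm L,
     bracket = (\<lambda>A B. \<Union>a\<in>A. \<Union>b\<in>B. I +>\<^bsub>L\<^esub> bracket L a b)\<rparr>"

definition star_quotient :: "('a, 'm) star_alg_scheme \<Rightarrow> 'a set \<Rightarrow> 'a set star_alg" where
  "star_quotient A I =
    \<lparr>carrier = carrier (A Quot I), mult = mult (A Quot I), one = one (A Quot I),
     zero = zero (A Quot I), add = add (A Quot I),
     smult = coset_smult A I,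
     nrm = coset_norm A,
     star = (\<lambda>X. \<Union>x\<in>X. I +>\<^bsub>A\<^esub> star A x)\<rparr>"

definition reduced_algebra :: "('a, 'm) lie_jordan_scheme \<Rightarrow> 'a set \<Rightarrow> 'a set lie_jordan" where
  "reduced_algebra L J =
     lie_jordan_quotient (L\<lparr>carrier := normalizer_of L J\<rparr>) (normalizer_of L J \<inter> J)"

definition isometric_star_iso ::
  "('a, 'm) star_alg_scheme \<Rightarrow> ('b, 'n) star_alg_scheme \<Rightarrow> ('a \<Rightarrow> 'b) \<Rightarrow> bool" where
  "isometric_star_iso A B h \<longleftrightarrow>
     h \<in> ring_iso A B \<and>
     (\<forall>x\<in>carrier A. (\<forall>c. h (c \<odot>\<^bsub>A\<^esub> x) = c \<odot>\<^bsub>B\<^esub> h x) \<and>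
        h (star A x) = star B (h x) \<and> nrm B (h x) = nrm A x)"

end

theory Submission
  imports Defs "HOL-Analysis.Urysohn"
begin

text \<open>
  The normalizer \<open>N\<close> of a closed Jordan ideal is closed and stable under both products, so
  \<open>N \<oplus> iN\<close> is a unital C*-algebra in which \<open>(N \<inter> J) \<oplus> i(N \<inter> J)\<close> is a closed two-sided star ideal.
  The C*-identity of the quotient norm follows without positivity theory: for self-adjoint \<open>y\<close> in the
  ideal the resolvents \<open>w = it (y + it)\<^sup>-\<^sup>1\<close> are contractions, equal to \<open>1\<close> modulo the ideal, and
  \<open>\<parallel>yw\<parallel> \<le> 2t\<close>, so that \<open>\<parallel>xw\<parallel>\<^sup>2 = \<parallel>w\<^sup>* x\<^sup>* x w\<parallel> \<le> \<parallel>x\<^sup>* x + y\<parallel> + 2t\<close>. Resolvents and square roots come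
  from Banach's fixed-point theorem. Finally, the norm axioms of the reduced Lie--Jordan algebra are
  read off its complexification; the inequality \<open>\<parallel>a\<^sup>2\<parallel> \<le> \<parallel>a\<^sup>2 + b\<^sup>2\<parallel>\<close> holds in every C*-algebra.
\<close>

section \<open>Normed spaces on carrier sets\<close>

text \<open>The obstacle is the quotient norm: it is an infimum over all representatives, and
  representatives of \<open>a^2 + b^2\<close> need not be sums of squares. Neither the LJB
  inequality nor the C*-identity therefore passes to cosets by itself. The contraction
  \<open>w\<close> that repairs the C*-identity is \<open>(1 - u)/2\<close> for the Cayley transform
  \<open>u\<close> of \<open>y\<close>, and \<open>|u| \<le> 1\<close> because
  \<open>star u u = 1\<close>. The same device carries the other norm bounds: exhibit an element
  with \<open>star x x = q^2\<close> and read off \<open>|x| \<le> q\<close>. An order relation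
  \<open>-m \<le> h \<le> m\<close> is expressed by bounding the norms of \<open>s + h\<close> and
  \<open>s - h\<close> by \<open>s + m\<close>. Since the LJB axioms of the reduced algebra come
  from its C*-norm, that norm has to be built before the reduced algebra is known to be LJB.
  Quotients are handled as surjections \<open>p\<close> with kernel \<open>I\<close> rather than as
  sets of cosets, so that pairs of cosets can serve as target as well as single ones.\<close>

lemma scalars_simps [simp]:
  "carrier (scalars :: 'k::real_normed_field ring) = UNIV"
  "a \<oplus>\<^bsub>scalars\<^esub> b = a + (b :: 'k)"
  "a \<otimes>\<^bsub>scalars\<^esub> b = a * (b :: 'k)"
  "\<zero>\<^bsub>scalars\<^esub> = (0 :: 'k)"
  "\<one>\<^bsub>scalars\<^esub> = (1 :: 'k)"
  by (simp_all add: scalars_def)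

lemma cring_scalars: "cring (scalars :: 'k::real_normed_field ring)"
proof (rule cringI)
  show "abelian_group (scalars :: 'k ring)"
  proof (rule abelian_groupI)
    fix x :: 'k
    show "\<exists>y\<in>carrier scalars. y \<oplus>\<^bsub>scalars\<^esub> x = \<zero>\<^bsub>scalars\<^esub>"
      by (rule bexI[of _ "- x"]) simp_all
  qed (simp_all add: algebra_simps)
  show "comm_monoid (scalars :: 'k ring)"
    by (rule comm_monoidI) (simp_all add: algebra_simps)
qed (simp_all add: algebra_simps)

lemma scalars_minus [simp]: "\<ominus>\<^bsub>scalars\<^esub> a = - (a :: 'k::real_normed_field)"
proof -
  interpret cring "scalars :: 'k ring"
    by (rule cring_scalars)
  show ?thesis
    by (rule minus_equality) simp_all
qed

text \<open>\<open>banach_space\<close> with completeness left out. Subspaces and quotients first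
  become normed spaces, which makes their metric and topology available;
  \<open>banach_spaceI\<close> then adds completeness.\<close>

locale normed_space =
  Module.module "scalars :: 'k::real_normed_field ring" V
  for V :: "('k::real_normed_field, 'a, 'm) normed_alg_scheme" (structure) +
  assumes norm_nonneg: "x \<in> carrier V \<Longrightarrow> 0 \<le> nrm V x"
    and norm_eq_0: "x \<in> carrier V \<Longrightarrow> nrm V x = 0 \<longleftrightarrow> x = \<zero>"
    and norm_smult: "x \<in> carrier V \<Longrightarrow> nrm V (c \<odot> x) = norm c * nrm V x"
    and norm_triangle:
      "x \<in> carrier V \<Longrightarrow> y \<in> carrier V \<Longrightarrow> nrm V (x \<oplus> y) \<le> nrm V x + nrm V y"
begin

lemma smult_mem [simp, intro]: "x \<in> carrier V \<Longrightarrow> c \<odot> x \<in> carrier V"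
  using smult_closed[of c x] by simp

lemma smult_add_left: "x \<in> carrier V \<Longrightarrow> (a + b) \<odot> x = a \<odot> x \<oplus> b \<odot> x"
  using smult_l_distr[of a b x] by simp

lemma smult_add_right:
  "x \<in> carrier V \<Longrightarrow> y \<in> carrier V \<Longrightarrow> a \<odot> (x \<oplus> y) = a \<odot> x \<oplus> a \<odot> y"
  using smult_r_distr[of a x y] by simp

lemma smult_smult [simp]: "x \<in> carrier V \<Longrightarrow> a \<odot> (b \<odot> x) = (a * b) \<odot> x"
  using smult_assoc1[of a b x] by simp

lemma smult_1 [simp]: "x \<in> carrier V \<Longrightarrow> 1 \<odot> x = x"
  using smult_one[of x] by simp

lemma smult_0 [simp]: "x \<in> carrier V \<Longrightarrow> 0 \<odot> x = \<zero>"
  using smult_l_null[of x] by simp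

lemma smult_zero [simp]: "c \<odot> \<zero> = \<zero>"
  using smult_r_null[of c] by simp

lemma minus_eq_smult: "x \<in> carrier V \<Longrightarrow> \<ominus> x = (- 1) \<odot> x"
  using smult_l_minus[of 1 x] by simp

lemma diff_eq_smult: "x \<in> carrier V \<Longrightarrow> y \<in> carrier V \<Longrightarrow> x \<ominus> y = x \<oplus> (- 1) \<odot> y"
  by (simp add: a_minus_def minus_eq_smult)

lemma smult_diff_right:
  "x \<in> carrier V \<Longrightarrow> y \<in> carrier V \<Longrightarrow> a \<odot> (x \<ominus> y) = a \<odot> x \<ominus> a \<odot> y"
  by (simp add: diff_eq_smult smult_add_right)

lemma smult_half_double: "x \<in> carrier V \<Longrightarrow> (1/2) \<odot> (x \<oplus> x) = x"
  using smult_add_left[of x "1/2" "1/2"] by (simp add: smult_add_right)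

lemma norm_zero [simp]: "nrm V \<zero> = 0"
  by (simp add: norm_eq_0)

lemma norm_diff_commute:
  assumes "x \<in> carrier V" "y \<in> carrier V"
  shows "nrm V (x \<ominus> y) = nrm V (y \<ominus> x)"
proof -
  have "y \<ominus> x = (- 1) \<odot> (x \<ominus> y)"
    using assms by (simp add: diff_eq_smult smult_add_right M.a_comm)
  then show ?thesis
    using assms by (simp add: norm_smult)
qed

lemma norm_triangle_diff:
  "x \<in> carrier V \<Longrightarrow> y \<in> carrier V \<Longrightarrow> nrm V (x \<ominus> y) \<le> nrm V x + nrm V y"
  using norm_triangle[of x "(- 1) \<odot> y"] by (simp add: diff_eq_smult norm_smult)

lemma diff_add_diff:
  "x \<in> carrier V \<Longrightarrow> y \<in> carrier V \<Longrightarrow> z \<in> carrier V \<Longrightarrow> (x \<ominus> y) \<oplus> (y \<ominus> z) = x \<ominus> z"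
  by (simp add: a_minus_def M.a_assoc M.r_neg1)

lemma norm_diff_triangle:
  "x \<in> carrier V \<Longrightarrow> y \<in> carrier V \<Longrightarrow> z \<in> carrier V \<Longrightarrow>
    nrm V (x \<ominus> z) \<le> nrm V (x \<ominus> y) + nrm V (y \<ominus> z)"
  using norm_triangle[of "x \<ominus> y" "y \<ominus> z"] by (simp add: diff_add_diff)

lemma diff_eq_zero_iff: "x \<in> carrier V \<Longrightarrow> y \<in> carrier V \<Longrightarrow> x \<ominus> y = \<zero> \<longleftrightarrow> x = y"
  by (metis M.l_zero M.minus_equality M.minus_minus M.add.inv_closed M.r_neg M.minus_eq)

lemma diff_self [simp]: "x \<in> carrier V \<Longrightarrow> x \<ominus> x = \<zero>"
  by (simp add: a_minus_def M.r_neg)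

lemma diff_add_cancel: "x \<in> carrier V \<Longrightarrow> y \<in> carrier V \<Longrightarrow> (x \<ominus> y) \<oplus> y = x"
  unfolding a_minus_def by (simp add: M.a_assoc M.l_neg)

lemma norm_diff_eq_0: "x \<in> carrier V \<Longrightarrow> y \<in> carrier V \<Longrightarrow> nrm V (x \<ominus> y) = 0 \<longleftrightarrow> x = y"
  by (simp add: norm_eq_0 diff_eq_zero_iff)

lemma norm_le_diff: "x \<in> carrier V \<Longrightarrow> y \<in> carrier V \<Longrightarrow> nrm V x \<le> nrm V (x \<ominus> y) + nrm V y"
  using norm_triangle[of "x \<ominus> y" y] by (simp add: diff_add_cancel)

sublocale metric: Metric_space "carrier V" "norm_dist V"
  by unfold_locales
    (auto simp: norm_dist_def norm_nonneg norm_diff_eq_0 norm_diff_commute norm_diff_triangle)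

lemma norm_dist_eq [simp]:
  "x \<in> carrier V \<Longrightarrow> y \<in> carrier V \<Longrightarrow> norm_dist V x y = nrm V (x \<ominus> y)"
  by (simp add: norm_dist_def)

lemma closedin_norm_iff:
  "closedin (norm_topology V) S \<longleftrightarrow>
    S \<subseteq> carrier V \<and> (\<forall>x\<in>carrier V. (\<forall>e>0. \<exists>s\<in>S. nrm V (x \<ominus> s) < e) \<longrightarrow> x \<in> S)"
proof -
  have "disjnt S (metric.mball x r) \<longleftrightarrow> \<not> (\<exists>s\<in>S. nrm V (x \<ominus> s) < r)"
    if "S \<subseteq> carrier V" "x \<in> carrier V" for x r
    using that by (force simp: disjnt_iff subset_iff)
  then show ?thesis
    unfolding metric.closedin_metric by (intro conj_cong refl) (auto, meson)
qed

lemma banach_spaceI: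
  assumes "\<And>s. (\<And>n :: nat. s n \<in> carrier V) \<Longrightarrow>
      (\<And>e. 0 < e \<Longrightarrow> \<exists>N. \<forall>m\<ge>N. \<forall>n\<ge>N. nrm V (s m \<ominus> s n) < e) \<Longrightarrow>
      \<exists>l\<in>carrier V. \<forall>e>0. \<exists>N. \<forall>n\<ge>N. nrm V (s n \<ominus> l) < e"
  shows "banach_space V"
proof
  show "metric.mcomplete"
    unfolding metric.mcomplete_def
  proof (intro allI impI)
    fix s assume s: "metric.MCauchy s"
    then have mem: "s n \<in> carrier V" for n
      by (auto simp: metric.MCauchy_def)
    have "\<exists>N. \<forall>m\<ge>N. \<forall>n\<ge>N. nrm V (s m \<ominus> s n) < e" if "0 < e" for e
      using s that mem by (simp add: metric.MCauchy_def)
    then obtain l where "l \<in> carrier V" "\<And>e. 0 < e \<Longrightarrow> \<exists>N. \<forall>n\<ge>N. nrm V (s n \<ominus> l) < e"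
      using assms[of s] mem by blast
    then have "limitin (norm_topology V) s l sequentially"
      using mem by (simp add: metric.limit_metric_sequentially)
    then show "\<exists>l. limitin (norm_topology V) s l sequentially"
      by blast
  qed
qed (simp_all add: norm_nonneg norm_eq_0 norm_smult norm_triangle)

end

context banach_space
begin

sublocale normed_space V
  by unfold_locales (simp_all add: norm_nonneg norm_eq_0 norm_smult norm_triangle)

lemma Cauchy_imp_convergent:
  assumes mem: "\<And>n :: nat. s n \<in> carrier V"
    and Cauchy: "\<And>e. 0 < e \<Longrightarrow> \<exists>N. \<forall>m\<ge>N. \<forall>n\<ge>N. nrm V (s m \<ominus> s n) < e"
  obtains l where "l \<in> carrier V" "\<And>e. 0 < e \<Longrightarrow> \<exists>N. \<forall>n\<ge>N. nrm V (s n \<ominus> l) < e"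
proof -
  have "metric.MCauchy s"
    using assms by (simp add: metric.MCauchy_def image_subset_iff)
  then obtain l where "limitin (norm_topology V) s l sequentially"
    using complete by (auto simp: metric.mcomplete_def)
  then have "l \<in> carrier V" "\<And>e. 0 < e \<Longrightarrow> \<exists>N. \<forall>n\<ge>N. nrm V (s n \<ominus> l) < e"
    using mem by (auto simp: metric.limit_metric_sequentially)
  then show thesis
    by (rule that)
qed

text \<open>A closed set \<open>S\<close> in place of the whole space lets the fixed point carry
  extra properties: every closed condition built into \<open>S\<close> and preserved by
  \<open>f\<close> is inherited. Square roots obtain self-adjointness and commutation relations in
  this way.\<close>

lemma contraction_fixpoint:
  assumes S: "closedin (norm_topology V) S" "S \<noteq> {}" and f: "f \<in> S \<rightarrow> S" and q: "q < 1"
    and contr: "\<And>x y. x \<in> S \<Longrightarrow> y \<in> S \<Longrightarrow> nrm V (f x \<ominus> f y) \<le> q * nrm V (x \<ominus> y)"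
  obtains x where "x \<in> S" "f x = x"
proof -
  have sub: "S \<subseteq> carrier V"
    using S by (simp add: closedin_norm_iff)
  then interpret Submetric "carrier V" "norm_dist V" S
    by unfold_locales
  have "norm_dist V (f x) (f y) \<le> q * norm_dist V x y" if "x \<in> S" "y \<in> S" for x y
    using that contr[OF that] f sub by (simp add: Pi_iff subset_iff)
  moreover have "sub.mcomplete"
    using S complete closedin_mcomplete_imp_mcomplete by blast
  ultimately show thesis
    using sub.Banach_fixedpoint_thm[OF _ S(2) f q] that by blast
qed

end

lemma normed_spaceI:
  fixes W :: "('k::real_normed_field, 'a, 'm) normed_alg_scheme" (structure)
  assumes "abelian_group W"
    and smult: "\<And>c x. x \<in> carrier W \<Longrightarrow> c \<odot> x \<in> carrier W"
      "\<And>a b x. x \<in> carrier W \<Longrightarrow> (a + b) \<odot> x = a \<odot> x \<oplus> b \<odot> x"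
      "\<And>a x y. x \<in> carrier W \<Longrightarrow> y \<in> carrier W \<Longrightarrow> a \<odot> (x \<oplus> y) = a \<odot> x \<oplus> a \<odot> y"
      "\<And>a b x. x \<in> carrier W \<Longrightarrow> (a * b) \<odot> x = a \<odot> (b \<odot> x)"
      "\<And>x. x \<in> carrier W \<Longrightarrow> 1 \<odot> x = x"
    and norm: "\<And>x. x \<in> carrier W \<Longrightarrow> 0 \<le> nrm W x"
      "\<And>x. x \<in> carrier W \<Longrightarrow> nrm W x = 0 \<longleftrightarrow> x = \<zero>"
      "\<And>c x. x \<in> carrier W \<Longrightarrow> nrm W (c \<odot> x) = norm c * nrm W x"
      "\<And>x y. x \<in> carrier W \<Longrightarrow> y \<in> carrier W \<Longrightarrow> nrm W (x \<oplus> y) \<le> nrm W x + nrm W y"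
  shows "normed_space W"
proof (intro normed_space.intro normed_space_axioms.intro)
  show "Module.module (scalars :: 'k ring) W"
    by (rule moduleI[OF cring_scalars assms(1)]) (simp_all add: smult)
qed (use norm in auto)

section \<open>Resolvents of self-adjoint elements\<close>

context unital_cstar_algebra
begin

lemma mult_assoc:
  "x \<in> carrier A \<Longrightarrow> y \<in> carrier A \<Longrightarrow> z \<in> carrier A \<Longrightarrow> (x \<otimes> y) \<otimes> z = x \<otimes> (y \<otimes> z)"
  by algebra

lemma distrib_right:
  "x \<in> carrier A \<Longrightarrow> y \<in> carrier A \<Longrightarrow> z \<in> carrier A \<Longrightarrow> (x \<oplus> y) \<otimes> z = x \<otimes> z \<oplus> y \<otimes> z"
  by algebra

lemma distrib_left:
  "x \<in> carrier A \<Longrightarrow> y \<in> carrier A \<Longrightarrow> z \<in> carrier A \<Longrightarrow> x \<otimes> (y \<oplus> z) = x \<otimes> y \<oplus> x \<otimes> z"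
  by algebra

lemma add_assoc:
  "x \<in> carrier A \<Longrightarrow> y \<in> carrier A \<Longrightarrow> z \<in> carrier A \<Longrightarrow> (x \<oplus> y) \<oplus> z = x \<oplus> (y \<oplus> z)"
  by algebra

lemma add_commute: "x \<in> carrier A \<Longrightarrow> y \<in> carrier A \<Longrightarrow> x \<oplus> y = y \<oplus> x"
  by algebra

lemma add_left_commute:
  "x \<in> carrier A \<Longrightarrow> y \<in> carrier A \<Longrightarrow> z \<in> carrier A \<Longrightarrow> x \<oplus> (y \<oplus> z) = y \<oplus> (x \<oplus> z)"
  by algebra

lemmas add_ac = add_assoc add_commute add_left_commute

lemma star_diff:
  "x \<in> carrier A \<Longrightarrow> y \<in> carrier A \<Longrightarrow> star A (x \<ominus> y) = star A x \<ominus> star A y"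
  by (simp add: diff_eq_smult star_add star_smult star_closed)

text \<open>The element \<open>star 1 \<otimes> 1\<close> is self-adjoint, like every
  \<open>star x \<otimes> x\<close>, and it equals \<open>star 1\<close>. So \<open>star 1\<close>
  is fixed by the involution, which also sends it to \<open>1\<close>.\<close>

lemma star_one [simp]: "star A \<one> = \<one>"
proof -
  have "star A (star A \<one> \<otimes> \<one>) = star A \<one> \<otimes> \<one>"
    by (subst star_mult) (simp_all add: star_closed star_star)
  then show ?thesis
    by (simp add: star_closed star_star)
qed

text \<open>The C*-identity and submultiplicativity give \<open>|z|^2 \<le> |star z| |z|\<close>;
  cancel \<open>|z|\<close>, then apply the result to \<open>star z\<close> as well.\<close>

lemma norm_star:
  assumes "x \<in> carrier A"
  shows "nrm A (star A x) = nrm A x"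
proof -
  have "nrm A z \<le> nrm A (star A z)" if z: "z \<in> carrier A" for z
  proof -
    have "nrm A z * nrm A z \<le> nrm A (star A z) * nrm A z"
      using cstar_identity[OF z] norm_mult_le[of "star A z" z] z
      by (simp add: star_closed power2_eq_square)
    then show ?thesis
      using norm_nonneg[OF z] norm_nonneg[OF star_closed[OF z]]
      by (cases "nrm A z = 0") (auto simp: mult_le_cancel_right)
  qed
  then show ?thesis
    using assms star_star star_closed by (metis order_antisym)
qed

lemma norm_one_le: "nrm A \<one> \<le> 1"
proof -
  have "(nrm A \<one>)\<^sup>2 = nrm A \<one>"
    using cstar_identity[of \<one>] by simp
  then show ?thesis
    by (auto simp: power2_eq_square)
qed

lemma norm_smult_one_le: "nrm A (c \<odot> \<one>) \<le> norm c"
  using norm_one_le by (simp add: norm_smult mult_left_le)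

text \<open>For \<open>q > 0\<close> the element \<open>x / q\<close> is an isometry. This is the
  gate from algebraic identities to norm bounds, in the place usually taken by the spectral
  radius.\<close>

lemma norm_le_of_star_mult_eq:
  assumes "x \<in> carrier A" "star A x \<otimes> x = complex_of_real (q\<^sup>2) \<odot> \<one>" "0 \<le> q"
  shows "nrm A x \<le> q"
proof -
  have "(nrm A x)\<^sup>2 \<le> q\<^sup>2"
    using assms cstar_identity[of x] norm_smult_one_le[of "complex_of_real (q\<^sup>2)"]
    by (simp add: norm_power)
  then show ?thesis
    using assms(3) by (rule power2_le_imp_le)
qed

lemma diff_distr_right:
  "x \<in> carrier A \<Longrightarrow> y \<in> carrier A \<Longrightarrow> z \<in> carrier A \<Longrightarrow> x \<otimes> (y \<ominus> z) = x \<otimes> y \<ominus> x \<otimes> z"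
  by algebra

lemma diff_distr_left:
  "x \<in> carrier A \<Longrightarrow> y \<in> carrier A \<Longrightarrow> z \<in> carrier A \<Longrightarrow> (y \<ominus> z) \<otimes> x = y \<otimes> x \<ominus> z \<otimes> x"
  by algebra

text \<open>The limit of the geometric series is the fixed point of
  \<open>z \<mapsto> 1 + x z\<close>, a contraction with constant \<open>|x|\<close>. That fixed
  point is a right inverse; the mirror map \<open>z \<mapsto> 1 + z x\<close> gives a left inverse,
  and associativity makes the two equal.\<close>

lemma Neumann_inverse:
  assumes x: "x \<in> carrier A" "nrm A x < 1"
  obtains z where "z \<in> carrier A" "(\<one> \<ominus> x) \<otimes> z = \<one>" "z \<otimes> (\<one> \<ominus> x) = \<one>"
proof -
  have closed: "closedin (norm_topology A) (carrier A)"
    by (simp add: closedin_norm_iff)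
  have ne: "carrier A \<noteq> {}"
    using x by blast
  have "nrm A ((\<one> \<oplus> x \<otimes> z) \<ominus> (\<one> \<oplus> x \<otimes> z')) \<le> nrm A x * nrm A (z \<ominus> z')"
    if "z \<in> carrier A" "z' \<in> carrier A" for z z'
  proof -
    have "(\<one> \<oplus> x \<otimes> z) \<ominus> (\<one> \<oplus> x \<otimes> z') = x \<otimes> (z \<ominus> z')"
      using that x by algebra
    then show ?thesis
      using that x norm_mult_le by simp
  qed
  then obtain z where z: "z \<in> carrier A" "\<one> \<oplus> x \<otimes> z = z"
    using contraction_fixpoint[OF closed ne, of "\<lambda>z. \<one> \<oplus> x \<otimes> z" "nrm A x"] x by auto
  have "nrm A ((\<one> \<oplus> z \<otimes> x) \<ominus> (\<one> \<oplus> z' \<otimes> x)) \<le> nrm A x * nrm A (z \<ominus> z')"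
    if "z \<in> carrier A" "z' \<in> carrier A" for z z'
  proof -
    have "(\<one> \<oplus> z \<otimes> x) \<ominus> (\<one> \<oplus> z' \<otimes> x) = (z \<ominus> z') \<otimes> x"
      using that x by algebra
    then show ?thesis
      using that x norm_mult_le[of "z \<ominus> z'" x] by (simp add: mult.commute)
  qed
  then obtain z' where z': "z' \<in> carrier A" "\<one> \<oplus> z' \<otimes> x = z'"
    using contraction_fixpoint[OF closed ne, of "\<lambda>z. \<one> \<oplus> z \<otimes> x" "nrm A x"] x by auto
  have "(\<one> \<ominus> x) \<otimes> z = z \<ominus> x \<otimes> z"
    using x z(1) by algebra
  also have "\<dots> = (\<one> \<oplus> x \<otimes> z) \<ominus> x \<otimes> z"
    by (simp only: z(2))
  also have "\<dots> = \<one>"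
    using x z(1) by algebra
  finally have right: "(\<one> \<ominus> x) \<otimes> z = \<one>" .
  have "z' \<otimes> (\<one> \<ominus> x) = z' \<ominus> z' \<otimes> x"
    using x z'(1) by (simp add: diff_distr_right)
  also have "\<dots> = (\<one> \<oplus> z' \<otimes> x) \<ominus> z' \<otimes> x"
    by (simp only: z'(2))
  also have "\<dots> = \<one>"
    using x z'(1) by algebra
  finally have left: "z' \<otimes> (\<one> \<ominus> x) = \<one>" .
  have "z' = z' \<otimes> ((\<one> \<ominus> x) \<otimes> z)"
    using z' right by simp
  also have "\<dots> = (z' \<otimes> (\<one> \<ominus> x)) \<otimes> z"
    using x z(1) z'(1) by (simp add: mult_assoc)
  also have "\<dots> = z"
    using left z by simp
  finally show thesis
    using that z(1) left right by blast
qed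

text \<open>A relation instead of an inverse function: invertibility of \<open>y + it\<close> is
  itself something to be propagated from one \<open>t\<close> to the next.\<close>

definition resolvent_at :: "'a \<Rightarrow> real \<Rightarrow> 'a \<Rightarrow> bool" where
  "resolvent_at y t r \<longleftrightarrow> r \<in> carrier A \<and>
     (y \<oplus> (\<i> * t) \<odot> \<one>) \<otimes> r = \<one> \<and> r \<otimes> (y \<oplus> (\<i> * t) \<odot> \<one>) = \<one>"

text \<open>The Cayley transform \<open>(y - it) (y + it)\<^sup>-\<^sup>1 = 1 - 2it (y + it)\<^sup>-\<^sup>1\<close> is an isometry.\<close>

lemma resolvent_norm_le:
  assumes y: "y \<in> carrier A" "star A y = y" and t: "0 < t" and r: "resolvent_at y t r"
  shows "t * nrm A r \<le> 1"
proof -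
  define b where "b = y \<oplus> (\<i> * t) \<odot> \<one>"
  have b: "b \<in> carrier A"
    using y by (simp add: b_def)
  have r': "r \<in> carrier A" "b \<otimes> r = \<one>" "r \<otimes> b = \<one>"
    using r by (auto simp: resolvent_at_def b_def)
  have sb: "star A b = y \<oplus> (- (\<i> * t)) \<odot> \<one>"
    using y by (simp add: b_def star_add star_smult)
  \<comment> \<open>Normality of \<open>b\<close> allows the two inner factors of
    \<open>star u \<otimes> u\<close> to be exchanged, after which it collapses to
    \<open>star (b r) \<otimes> (b r) = 1\<close>.\<close>
  have "star A b \<otimes> b = b \<otimes> star A b"
    unfolding sb using y by (simp add: b_def distrib_right distrib_left smult_mult_left smult_mult_right
        smult_add_right add_ac mult.commute)
  define u where "u = star A b \<otimes> r"
  have u: "u \<in> carrier A"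
    using b r' by (simp add: u_def star_closed)
  have "star A u \<otimes> u = (star A r \<otimes> b) \<otimes> (star A b \<otimes> r)"
    using b r' by (simp add: u_def star_mult star_star star_closed)
  also have "\<dots> = star A r \<otimes> (b \<otimes> star A b) \<otimes> r"
    using b r' by (simp add: star_closed mult_assoc)
  also have "\<dots> = star A r \<otimes> (star A b \<otimes> b) \<otimes> r"
    by (simp add: \<open>star A b \<otimes> b = b \<otimes> star A b\<close>)
  also have "\<dots> = (star A r \<otimes> star A b) \<otimes> (b \<otimes> r)"
    using b r' by (simp add: star_closed mult_assoc)
  also have "\<dots> = star A (b \<otimes> r) \<otimes> (b \<otimes> r)"
    by (simp only: star_mult b r'(1))
  also have "\<dots> = complex_of_real (1\<^sup>2) \<odot> \<one>"
    using r' by simp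
  finally have nu: "nrm A u \<le> 1"
    using norm_le_of_star_mult_eq[OF u] by simp
  have "star A b = b \<oplus> (- (2 * \<i> * t)) \<odot> \<one>"
  proof -
    have "b \<oplus> (- (2 * \<i> * t)) \<odot> \<one> = y \<oplus> ((\<i> * t) \<odot> \<one> \<oplus> (- (2 * \<i> * t)) \<odot> \<one>)"
      using y by (simp add: b_def add_assoc)
    also have "(\<i> * t) \<odot> \<one> \<oplus> (- (2 * \<i> * t)) \<odot> \<one> = (- (\<i> * t)) \<odot> \<one>"
      using smult_add_left[of \<one> "\<i> * t" "- (2 * \<i> * t)"] by simp
    finally show ?thesis
      by (simp add: sb)
  qed
  then have "u = \<one> \<oplus> (- (2 * \<i> * t)) \<odot> r"
    using b r' by (simp add: u_def distrib_right smult_mult_left)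
  then have "\<one> \<ominus> u = \<one> \<ominus> (\<one> \<oplus> (- (2 * \<i> * t)) \<odot> r)"
    by simp
  also have "\<dots> = \<ominus> ((- (2 * \<i> * t)) \<odot> r)"
  proof -
    have "x \<ominus> (x \<oplus> y) = \<ominus> y" if "x \<in> carrier A" "y \<in> carrier A" for x y
      using that by algebra
    then show ?thesis
      using r' by simp
  qed
  also have "\<dots> = (2 * \<i> * t) \<odot> r"
    using r' by (simp add: minus_eq_smult)
  finally have "nrm A (\<one> \<ominus> u) = 2 * t * nrm A r"
    using t r' by (simp add: norm_smult norm_mult)
  moreover have "nrm A (\<one> \<ominus> u) \<le> 2"
    using norm_triangle_diff[of \<one> u] u nu norm_one_le by simp
  ultimately show ?thesis
    by simp
qed

text \<open>Write \<open>y + is = (y + it) (1 - x)\<close> with \<open>x = -i (s - t) r\<close>. The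
  bound \<open>t |r| \<le> 1\<close> gives \<open>|x| \<le> |s - t| / t < 1\<close>, so a Neumann
  inverse exists. The reach of the step is the whole interval from \<open>0\<close> to
  \<open>2t\<close>, enough to halve \<open>t\<close>.\<close>

lemma resolvent_step:
  assumes y: "y \<in> carrier A" "star A y = y" and t: "0 < t" and r: "resolvent_at y t r"
    and st: "\<bar>s - t\<bar> < t"
  obtains r' where "resolvent_at y s r'"
proof -
  define b where "b = y \<oplus> (\<i> * t) \<odot> \<one>"
  define x where "x = (- (\<i> * (s - t))) \<odot> r"
  have b: "b \<in> carrier A"
    using y by (simp add: b_def)
  have r': "r \<in> carrier A" "b \<otimes> r = \<one>" "r \<otimes> b = \<one>"
    using r by (auto simp: resolvent_at_def b_def)
  have x: "x \<in> carrier A"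
    using r' by (simp add: x_def)
  have "nrm A x = \<bar>s - t\<bar> * nrm A r"
    using r' by (simp add: x_def norm_smult norm_mult del: of_real_diff flip: of_real_diff)
  also have "\<dots> < 1"
  \<comment> \<open>The strict inequality can be multiplied only by a positive factor. An invertible
    \<open>r\<close> of norm \<open>0\<close> occurs just in the zero algebra.\<close>
  proof (cases "nrm A r = 0")
    case False
    then have "\<bar>s - t\<bar> * nrm A r < t * nrm A r"
      using st norm_nonneg[OF r'(1)] by (intro mult_strict_right_mono) auto
    then show ?thesis
      using resolvent_norm_le[OF y t r] by simp
  qed simp
  finally obtain z where z: "z \<in> carrier A" "(\<one> \<ominus> x) \<otimes> z = \<one>" "z \<otimes> (\<one> \<ominus> x) = \<one>"
    using Neumann_inverse[OF x] by blast
  have bs: "y \<oplus> (\<i> * s) \<odot> \<one> = b \<oplus> (\<i> * (s - t)) \<odot> \<one>"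
  proof -
    have "b \<oplus> (\<i> * (s - t)) \<odot> \<one> = y \<oplus> ((\<i> * t) \<odot> \<one> \<oplus> (\<i> * (s - t)) \<odot> \<one>)"
      using y by (simp add: b_def add_assoc)
    also have "(\<i> * t) \<odot> \<one> \<oplus> (\<i> * (s - t)) \<odot> \<one> = (\<i> * s) \<odot> \<one>"
      using smult_add_left[of \<one> "\<i> * t" "\<i> * (s - t)"] by (simp add: algebra_simps)
    finally show ?thesis
      by simp
  qed
  have bs1: "y \<oplus> (\<i> * s) \<odot> \<one> = b \<otimes> (\<one> \<ominus> x)"
    unfolding bs using b r'
    by (simp add: diff_eq_smult x_def distrib_left smult_mult_right)
  have "(y \<oplus> (\<i> * s) \<odot> \<one>) \<otimes> (z \<otimes> r) = b \<otimes> ((\<one> \<ominus> x) \<otimes> z) \<otimes> r"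
    unfolding bs1 using b x z(1) r'(1) by (simp add: mult_assoc)
  then have "(y \<oplus> (\<i> * s) \<odot> \<one>) \<otimes> (z \<otimes> r) = \<one>"
    using z b r' by simp
  moreover have "(z \<otimes> r) \<otimes> (y \<oplus> (\<i> * s) \<odot> \<one>) = z \<otimes> (r \<otimes> b) \<otimes> (\<one> \<ominus> x)"
    unfolding bs1 using b x z(1) r'(1) by (simp add: mult_assoc)
  then have "(z \<otimes> r) \<otimes> (y \<oplus> (\<i> * s) \<odot> \<one>) = \<one>"
    using z b r' by simp
  ultimately show thesis
    using that[of "z \<otimes> r"] z r' by (simp add: resolvent_at_def)
qed

text \<open>Start at some \<open>T > |y|\<close>, where a Neumann series is available, and halve the
  parameter until it is below \<open>t\<close>. Only small parameters matter later, so hitting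
  \<open>t\<close> exactly is not attempted.\<close>

lemma resolvent_exists:
  assumes y: "y \<in> carrier A" "star A y = y" and t: "0 < t"
  obtains s r where "0 < s" "s \<le> t" "resolvent_at y s r"
proof -
  define T where "T = nrm A y + 1"
  have T: "T > 0" "nrm A y < T"
    using norm_nonneg[OF y(1)] by (simp_all add: T_def)
  have ex: "\<exists>r. resolvent_at y (T / 2 ^ m) r" for m
  proof (induction m)
    case 0
    define x where "x = (\<i> / T) \<odot> y"
    have x: "x \<in> carrier A"
      using y by (simp add: x_def)
    have "nrm A x < 1"
      using y T by (simp add: x_def norm_smult norm_divide)
    then obtain z where z: "z \<in> carrier A" "(\<one> \<ominus> x) \<otimes> z = \<one>" "z \<otimes> (\<one> \<ominus> x) = \<one>"
      using Neumann_inverse[OF x] by blast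
    \<comment> \<open>The factor in \<open>x = (i/T) y\<close> is chosen for this: \<open>iT\<close>
      times \<open>-(i/T)\<close> is \<open>1\<close>.\<close>
    have "y \<oplus> (\<i> * T) \<odot> \<one> = (\<i> * T) \<odot> (\<one> \<ominus> x)"
      using y T by (simp add: x_def diff_eq_smult smult_add_right add_commute)
    then have "resolvent_at y T ((1 / (\<i> * T)) \<odot> z)"
      using z x T by (simp add: resolvent_at_def smult_mult_left smult_mult_right)
    then show ?case
      by auto
  next
    case (Suc m)
    then obtain r where r: "resolvent_at y (T / 2 ^ m) r"
      by blast
    have "0 < T / 2 ^ m"
      using T by simp
    moreover have "\<bar>T / 2 ^ Suc m - T / 2 ^ m\<bar> < T / 2 ^ m"
      using T by (simp add: field_simps)
    ultimately show ?case
      using resolvent_step[OF y _ r] by metis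
  qed
  obtain m where "T / t < 2 ^ m"
    using real_arch_pow[of 2 "T / t"] by auto
  then have "0 < T / 2 ^ m" "T / 2 ^ m \<le> t"
    using T t by (simp_all add: field_simps)
  then show thesis
    using that ex by blast
qed

text \<open>A contraction \<open>w\<close> that is \<open>1\<close> modulo the ideal generated by \<open>y\<close> and almost annihilates \<open>y\<close>:
  it replaces the approximate unit in the usual construction of the quotient norm.\<close>

lemma almost_annihilator:
  assumes y: "y \<in> carrier A" "star A y = y" and e: "0 < e"
  obtains w r where "w \<in> carrier A" "r \<in> carrier A" "nrm A w \<le> 1" "nrm A (y \<otimes> w) \<le> e"
    "\<one> \<ominus> w = y \<otimes> r"
proof -
  obtain t r where t: "0 < t" "t \<le> e / 2" and r: "resolvent_at y t r"
    using resolvent_exists[OF y, of "e / 2"] e by auto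
  define w where "w = (\<i> * t) \<odot> r"
  have r': "r \<in> carrier A" "(y \<oplus> (\<i> * t) \<odot> \<one>) \<otimes> r = \<one>"
    using r by (auto simp: resolvent_at_def)
  have w: "w \<in> carrier A" "nrm A w \<le> 1"
    using r' t resolvent_norm_le[OF y t(1) r] by (simp_all add: w_def norm_smult norm_mult)
  have "\<one> \<ominus> w = (y \<otimes> r \<oplus> w) \<ominus> w"
    using r' y by (simp add: w_def distrib_right smult_mult_left)
  also have "\<dots> = y \<otimes> r"
    using r'(1) y(1) w(1) by algebra
  finally have yr: "\<one> \<ominus> w = y \<otimes> r" .
  \<comment> \<open>Indeed \<open>y w = it (y r) = it (1 - w)\<close>, and
    \<open>|1 - w| \<le> 2\<close> because \<open>w\<close> is a contraction; hence the choice
    \<open>t \<le> e / 2\<close>.\<close>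
  have "nrm A (y \<otimes> w) = t * nrm A (\<one> \<ominus> w)"
    unfolding yr using y r' t by (simp add: w_def smult_mult_right norm_smult norm_mult)
  also have "\<dots> \<le> t * 2"
    using t norm_triangle_diff[of \<one> w] w norm_one_le by (intro mult_left_mono) auto
  also have "\<dots> \<le> e"
    using t by simp
  finally show thesis
    using that w r' yr by blast
qed

end

section \<open>Square roots and sums of squares\<close>

context unital_cstar_algebra
begin

lemma eqI_norm_small:
  assumes "x \<in> carrier A" "y \<in> carrier A" "0 \<le> C" "\<And>e. 0 < e \<Longrightarrow> nrm A (x \<ominus> y) \<le> C * e"
  shows "x = y"
proof (rule ccontr)
  assume "x \<noteq> y"
  then have pos: "0 < nrm A (x \<ominus> y)"
    using assms norm_nonneg[of "x \<ominus> y"] norm_diff_eq_0[of x y] by simp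
  \<comment> \<open>The tolerance is a fraction of the distance itself; \<open>C + 1\<close> keeps
    the denominator positive when \<open>C = 0\<close>.\<close>
  have "nrm A (x \<ominus> y) \<le> C * (nrm A (x \<ominus> y) / (2 * (C + 1)))"
    by (rule assms(4)) (use assms(3) pos in \<open>simp add: divide_simps\<close>)
  also have "\<dots> = nrm A (x \<ominus> y) * (C / (2 * (C + 1)))"
    by simp
  also have "\<dots> < nrm A (x \<ominus> y) * 1"
    using assms pos by (intro mult_strict_left_mono) (simp_all add: divide_simps)
  finally show False
    by simp
qed

text \<open>With \<open>c = 1 - r\<close> the equation \<open>c^2 = 1 - u\<close> becomes
  \<open>r = (u + r^2) / 2\<close>, a fixed-point equation on the ball of radius
  \<open>|u| < 1\<close>. The last conclusion puts \<open>c\<close> in the bicommutant of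
  \<open>u\<close>; it makes roots of commuting elements commute later on.\<close>

lemma sqrt_one_minus:
  assumes u: "u \<in> carrier A" "star A u = u" "nrm A u < 1"
  obtains c where "c \<in> carrier A" "star A c = c" "c \<otimes> c = \<one> \<ominus> u"
    "\<And>d. d \<in> carrier A \<Longrightarrow> d \<otimes> u = u \<otimes> d \<Longrightarrow> d \<otimes> c = c \<otimes> d"
proof -
  define q where "q = nrm A u"
  have q: "0 \<le> q" "q < 1"
    using u norm_nonneg by (simp_all add: q_def)
  \<comment> \<open>All properties wanted of the root are conditions that survive norm limits and
    the map \<open>f\<close>, so they are built into the set on which the contraction acts.\<close>
  define S where "S = {r \<in> carrier A. star A r = r \<and> nrm A r \<le> q \<and>
    (\<forall>d\<in>carrier A. d \<otimes> u = u \<otimes> d \<longrightarrow> d \<otimes> r = r \<otimes> d)}"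
  have S: "r \<in> carrier A" "star A r = r" "nrm A r \<le> q" if "r \<in> S" for r
    using that by (auto simp: S_def)
  have S_comm: "d \<otimes> r = r \<otimes> d" if "r \<in> S" "d \<in> carrier A" "d \<otimes> u = u \<otimes> d" for r d
    using that by (auto simp: S_def)
  have "r \<in> S" if r: "r \<in> carrier A" and lim: "\<And>e. 0 < e \<Longrightarrow> \<exists>s\<in>S. nrm A (r \<ominus> s) < e" for r
  proof -
    have "star A r = r"
    proof (rule eqI_norm_small[where C = 2])
      fix e :: real assume "0 < e"
      then obtain s where s: "s \<in> S" "nrm A (r \<ominus> s) < e"
        using lim by blast
      have "nrm A (star A r \<ominus> r) \<le> nrm A (star A r \<ominus> s) + nrm A (s \<ominus> r)"
        using norm_diff_triangle[of "star A r" s r] r S[OF s(1)] by (simp add: star_closed)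
      also have "nrm A (star A r \<ominus> s) = nrm A (r \<ominus> s)"
        using norm_star[of "r \<ominus> s"] r S[OF s(1)] by (simp add: star_diff)
      also have "nrm A (s \<ominus> r) = nrm A (r \<ominus> s)"
        using norm_diff_commute r S[OF s(1)] by blast
      finally show "nrm A (star A r \<ominus> r) \<le> 2 * e"
        using s by simp
    qed (use r star_closed in auto)
    moreover have "nrm A r \<le> q"
    proof (rule field_le_epsilon)
      fix e :: real assume "0 < e"
      then obtain s where s: "s \<in> S" "nrm A (r \<ominus> s) < e"
        using lim by blast
      show "nrm A r \<le> q + e"
        using norm_le_diff[of r s] r s S[OF s(1)] by simp
    qed
    moreover have "d \<otimes> r = r \<otimes> d" if d: "d \<in> carrier A" "d \<otimes> u = u \<otimes> d" for d
    proof (rule eqI_norm_small[where C = "2 * nrm A d"])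
      fix e :: real assume "0 < e"
      then obtain s where s: "s \<in> S" "nrm A (r \<ominus> s) < e"
        using lim by blast
      note s' = S[OF s(1)]
      have "nrm A (d \<otimes> r \<ominus> r \<otimes> d) \<le> nrm A (d \<otimes> r \<ominus> d \<otimes> s) + nrm A (s \<otimes> d \<ominus> r \<otimes> d)"
        using norm_diff_triangle[of "d \<otimes> r" "d \<otimes> s" "r \<otimes> d"] r s' d S_comm[OF s(1) d] by simp
      also have "\<dots> = nrm A (d \<otimes> (r \<ominus> s)) + nrm A ((s \<ominus> r) \<otimes> d)"
        using r s' d by (simp add: diff_distr_left diff_distr_right)
      also have "\<dots> \<le> nrm A d * nrm A (r \<ominus> s) + nrm A (s \<ominus> r) * nrm A d"
        using r s' d by (intro add_mono norm_mult_le) auto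
      also have "\<dots> = 2 * nrm A d * nrm A (r \<ominus> s)"
        using norm_diff_commute[of r s] r s' by simp
      also have "\<dots> \<le> 2 * nrm A d * e"
        using s norm_nonneg[OF d(1)] by (intro mult_left_mono) auto
      finally show "nrm A (d \<otimes> r \<ominus> r \<otimes> d) \<le> 2 * nrm A d * e" .
    qed (use r d norm_nonneg in auto)
    ultimately show ?thesis
      using r by (simp add: S_def)
  qed
  then have closed: "closedin (norm_topology A) S"
    by (auto simp: closedin_norm_iff S_def)
  define f where "f r = (1/2) \<odot> (u \<oplus> r \<otimes> r)" for r
  have fS: "f r \<in> S" if "r \<in> S" for r
  proof -
    note r = S[OF that]
    \<comment> \<open>The ball of radius \<open>q = |u|\<close> is preserved because
      \<open>(q + q^2) / 2 \<le> q\<close> for \<open>q < 1\<close>.\<close>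
    have "nrm A (r \<otimes> r) \<le> q * q"
      using norm_mult_le[of r r] mult_mono[OF r(3) r(3)] norm_nonneg r q by force
    also have "\<dots> \<le> q"
      using q by (simp add: mult_left_le)
    finally have "nrm A (u \<oplus> r \<otimes> r) \<le> q + q"
      using norm_triangle[of u "r \<otimes> r"] u r by (simp add: q_def)
    moreover have "d \<otimes> f r = f r \<otimes> d" if "d \<in> carrier A" "d \<otimes> u = u \<otimes> d" for d
    proof -
      have dr: "d \<otimes> r = r \<otimes> d"
        using S_comm[OF \<open>r \<in> S\<close> that] .
      have "d \<otimes> (r \<otimes> r) = (d \<otimes> r) \<otimes> r"
        using that r by (simp add: mult_assoc)
      also have "\<dots> = r \<otimes> (d \<otimes> r)"
        using that r by (simp add: dr mult_assoc)
      also have "\<dots> = (r \<otimes> r) \<otimes> d"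
        using that r by (simp add: dr mult_assoc)
      finally show ?thesis
        using that u r by (simp add: f_def smult_mult_left smult_mult_right distrib_left distrib_right)
    qed
    ultimately show ?thesis
      using r u by (simp add: S_def f_def star_smult star_add star_mult norm_smult)
  qed
  have contr: "nrm A (f r \<ominus> f s) \<le> q * nrm A (r \<ominus> s)" if "r \<in> S" "s \<in> S" for r s
  proof -
    note r = S[OF that(1)] and s = S[OF that(2)]
    \<comment> \<open>A factorization of \<open>r^2 - s^2\<close> that does not appeal to
      commutation of \<open>r\<close> and \<open>s\<close>. Each summand contributes
      \<open>q |r - s|\<close>, and the factor \<open>1/2\<close> in \<open>f\<close> leaves the
      constant \<open>q\<close>.\<close>
    have "(u \<oplus> r \<otimes> r) \<ominus> (u \<oplus> s \<otimes> s) = r \<otimes> (r \<ominus> s) \<oplus> (r \<ominus> s) \<otimes> s"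
      using r(1) s(1) u(1) by algebra
    then have "f r \<ominus> f s = (1/2) \<odot> (r \<otimes> (r \<ominus> s) \<oplus> (r \<ominus> s) \<otimes> s)"
      using r s u by (simp add: f_def flip: smult_diff_right)
    then have "nrm A (f r \<ominus> f s) = nrm A (r \<otimes> (r \<ominus> s) \<oplus> (r \<ominus> s) \<otimes> s) / 2"
      using r s by (simp add: norm_smult)
    also have "\<dots> \<le> (nrm A r * nrm A (r \<ominus> s) + nrm A (r \<ominus> s) * nrm A s) / 2"
      using r s norm_triangle[of "r \<otimes> (r \<ominus> s)" "(r \<ominus> s) \<otimes> s"] norm_mult_le[of r "r \<ominus> s"]
        norm_mult_le[of "r \<ominus> s" s] by simp
    also have "\<dots> \<le> (q * nrm A (r \<ominus> s) + nrm A (r \<ominus> s) * q) / 2"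
      using r s norm_nonneg[of "r \<ominus> s"]
      by (intro divide_right_mono add_mono mult_left_mono mult_right_mono) auto
    finally show ?thesis
      by simp
  qed
  have "\<zero> \<in> S"
  proof -
    have "star A \<zero> = \<zero>"
      using star_smult[of \<one> 0] by simp
    then show ?thesis
      using q by (simp add: S_def)
  qed
  then obtain r where r: "r \<in> S" "f r = r"
    using contraction_fixpoint[OF closed _ _ q(2) contr] fS by blast
  note r' = S[OF r(1)]
  have "u \<oplus> r \<otimes> r = 2 \<odot> f r"
    using u r' by (simp add: f_def)
  then have rr: "u \<oplus> r \<otimes> r = r \<oplus> r"
    using r r' smult_add_left[of r 1 1] by simp
  have "(\<one> \<ominus> r) \<otimes> (\<one> \<ominus> r) = \<one> \<ominus> (r \<oplus> r) \<oplus> r \<otimes> r"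
    using r'(1) by (simp add: diff_distr_left diff_distr_right) algebra
  also have "\<dots> = \<one> \<ominus> u"
    using r'(1) u(1) unfolding rr[symmetric] by algebra
  finally have "(\<one> \<ominus> r) \<otimes> (\<one> \<ominus> r) = \<one> \<ominus> u" .
  moreover have "d \<otimes> (\<one> \<ominus> r) = (\<one> \<ominus> r) \<otimes> d" if "d \<in> carrier A" "d \<otimes> u = u \<otimes> d" for d
    using that r' S_comm[OF r(1) that] by (simp add: diff_distr_left diff_distr_right)
  ultimately show thesis
    using that[of "\<one> \<ominus> r"] r' by (simp add: star_diff)
qed

text \<open>For commuting self-adjoint \<open>a\<close> and \<open>c\<close> the element
  \<open>w = a + ic\<close> satisfies \<open>star w w = a^2 + c^2\<close>, so
  \<open>|w| \<le> q\<close>; and \<open>a\<close> is the mean of \<open>w\<close> and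
  \<open>star w\<close>, which have equal norms.\<close>

lemma norm_le_of_sum_squares:
  assumes a: "a \<in> carrier A" "star A a = a" and c: "c \<in> carrier A" "star A c = c"
    and comm: "a \<otimes> c = c \<otimes> a" and q: "0 \<le> q"
    and sum: "a \<otimes> a \<oplus> c \<otimes> c = complex_of_real (q\<^sup>2) \<odot> \<one>"
  shows "nrm A a \<le> q"
proof -
  define w where "w = a \<oplus> \<i> \<odot> c"
  have w: "w \<in> carrier A"
    using a c by (simp add: w_def)
  have sw: "star A w = a \<oplus> (- \<i>) \<odot> c"
    using a c by (simp add: w_def star_add star_smult)
  have "star A w \<otimes> w = (a \<otimes> a \<oplus> (- \<i>) \<odot> (c \<otimes> a)) \<oplus> (\<i> \<odot> (c \<otimes> a) \<oplus> c \<otimes> c)"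
    unfolding sw unfolding w_def using a c
    by (simp add: distrib_left distrib_right smult_mult_left smult_mult_right smult_add_right comm)
  also have "\<dots> = a \<otimes> a \<oplus> (((- \<i>) \<odot> (c \<otimes> a) \<oplus> \<i> \<odot> (c \<otimes> a)) \<oplus> c \<otimes> c)"
    using a c by (simp add: add_assoc)
  also have "(- \<i>) \<odot> (c \<otimes> a) \<oplus> \<i> \<odot> (c \<otimes> a) = \<zero>"
    using smult_add_left[of "c \<otimes> a" "- \<i>" \<i>] a c by simp
  finally have "star A w \<otimes> w = complex_of_real (q\<^sup>2) \<odot> \<one>"
    using a c sum by simp
  then have nw: "nrm A w \<le> q"
    using norm_le_of_star_mult_eq w q by blast
  have "w \<oplus> star A w = (a \<oplus> a) \<oplus> (\<i> \<odot> c \<oplus> (- \<i>) \<odot> c)"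
    unfolding sw unfolding w_def using a c by (simp add: add_ac)
  also have "\<i> \<odot> c \<oplus> (- \<i>) \<odot> c = \<zero>"
    using smult_add_left[of c \<i> "- \<i>"] c by simp
  finally have "(1/2) \<odot> (w \<oplus> star A w) = a"
    using a by (simp add: smult_half_double)
  then have "nrm A a = nrm A (w \<oplus> star A w) / 2"
    using w norm_smult[of "w \<oplus> star A w" "1/2"] by (simp add: star_closed)
  also have "\<dots> \<le> q"
    using nw norm_triangle[of w "star A w"] norm_star[OF w] w by (simp add: star_closed)
  finally show ?thesis .
qed

text \<open>Stands for \<open>0 \<le> r^2 - a^2 \<le> r^2\<close>. With \<open>b = a / r\<close> the
  element \<open>1 - b^2\<close> has a root \<open>c\<close>, and \<open>c^2 + b^2 = 1\<close>
  forces \<open>|c| \<le> 1\<close>; then \<open>r^2 - a^2 = r^2 c^2\<close>. Strictness of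
  \<open>|a| < r\<close> is what gives the root.\<close>

lemma norm_diff_square_le:
  assumes a: "a \<in> carrier A" "star A a = a" and r: "nrm A a < r"
  shows "nrm A (complex_of_real (r\<^sup>2) \<odot> \<one> \<ominus> a \<otimes> a) \<le> r\<^sup>2"
proof -
  have r0: "0 < r"
    using r norm_nonneg[OF a(1)] by linarith
  define b where "b = complex_of_real (1/r) \<odot> a"
  have b: "b \<in> carrier A" "star A b = b" "nrm A b < 1"
    using a r r0 by (simp_all add: b_def star_smult norm_smult norm_divide)
  have "nrm A (b \<otimes> b) \<le> nrm A b * nrm A b"
    using b norm_mult_le by simp
  also have "\<dots> \<le> nrm A b * 1"
    using b norm_nonneg[OF b(1)] by (intro mult_left_mono) auto
  finally have "nrm A (b \<otimes> b) < 1"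
    using b by simp
  moreover have "b \<otimes> b \<in> carrier A" "star A (b \<otimes> b) = b \<otimes> b"
    using b by (simp_all add: star_mult)
  ultimately obtain c where c: "c \<in> carrier A" "star A c = c" "c \<otimes> c = \<one> \<ominus> b \<otimes> b"
    "\<And>d. d \<in> carrier A \<Longrightarrow> d \<otimes> (b \<otimes> b) = (b \<otimes> b) \<otimes> d \<Longrightarrow> d \<otimes> c = c \<otimes> d"
    using sqrt_one_minus by blast
  have "c \<otimes> b = b \<otimes> c"
    using c(4)[of b] b by (simp add: mult_assoc)
  moreover have "c \<otimes> c \<oplus> b \<otimes> b = complex_of_real (1\<^sup>2) \<odot> \<one>"
    using b by (simp add: c(3) diff_add_cancel)
  ultimately have "nrm A c \<le> 1"
    using norm_le_of_sum_squares[OF c(1,2) b(1,2)] by simp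
  then have "nrm A (c \<otimes> c) \<le> 1"
    using norm_mult_le[of c c] mult_mono[of "nrm A c" 1 "nrm A c" 1] norm_nonneg[of c] c by force
  moreover have "complex_of_real (r\<^sup>2) \<odot> \<one> \<ominus> a \<otimes> a = complex_of_real (r\<^sup>2) \<odot> (c \<otimes> c)"
  proof -
    have "complex_of_real (r\<^sup>2) \<odot> (b \<otimes> b) = a \<otimes> a"
      using a r0 by (simp add: b_def smult_mult_left smult_mult_right power2_eq_square)
    then show ?thesis
      using b by (simp add: c(3) smult_diff_right)
  qed
  ultimately show ?thesis
    using c(1) r0 mult_left_mono[of "nrm A (c \<otimes> c)" 1 "r\<^sup>2"] by (simp add: norm_smult norm_power)
qed

text \<open>If \<open>-m \<le> h \<le> m\<close> then \<open>(m + h) (m - h)\<close> is a square \<open>v\<^sup>2\<close> and \<open>h\<^sup>2 + v\<^sup>2 = m\<^sup>2\<close>.\<close>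

lemma norm_le_of_numerical_bounds:
  assumes h: "h \<in> carrier A" "star A h = h" and s: "0 \<le> s" and m: "0 \<le> m"
    and le: "nrm A (complex_of_real s \<odot> \<one> \<oplus> h) \<le> s + m"
    and ge: "nrm A (complex_of_real s \<odot> \<one> \<ominus> h) \<le> s + m"
  shows "nrm A h \<le> m"
proof (rule field_le_epsilon)
  fix e :: real assume e: "0 < e"
  \<comment> \<open>The root needs an element of norm strictly below \<open>1\<close>. With
    \<open>t = s + M\<close> one has \<open>M + g = t (1 - u)\<close> for
    \<open>u = (s - g) / t\<close>, and \<open>|u| \<le> (s + m) / t < 1\<close>; the
    \<open>e\<close> supplies the strictness.\<close>
  define M where "M = m + e"
  define t where "t = s + M"
  have t: "0 < t" "s + m < t" "0 < M"
    using s m e by (simp_all add: t_def M_def)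
  have ex: "\<exists>c\<in>carrier A. star A c = c \<and> complex_of_real t \<odot> (c \<otimes> c) = complex_of_real M \<odot> \<one> \<oplus> g \<and>
      (\<forall>d\<in>carrier A. d \<otimes> g = g \<otimes> d \<longrightarrow> d \<otimes> c = c \<otimes> d)"
    if g: "g \<in> carrier A" "star A g = g" and gle: "nrm A (complex_of_real s \<odot> \<one> \<ominus> g) \<le> s + m" for g
  proof -
    define u where "u = complex_of_real (1/t) \<odot> (complex_of_real s \<odot> \<one> \<ominus> g)"
    have u: "u \<in> carrier A" "star A u = u"
      using g by (simp_all add: u_def star_smult star_diff)
    have "nrm A u < 1"
      using g t gle by (simp add: u_def norm_smult norm_divide)
    then obtain c where c: "c \<in> carrier A" "star A c = c" "c \<otimes> c = \<one> \<ominus> u"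
      "\<And>d. d \<in> carrier A \<Longrightarrow> d \<otimes> u = u \<otimes> d \<Longrightarrow> d \<otimes> c = c \<otimes> d"
      using sqrt_one_minus[OF u] by blast
    have "complex_of_real t \<odot> u = complex_of_real s \<odot> \<one> \<ominus> g"
      using g t by (simp add: u_def)
    then have "complex_of_real t \<odot> (c \<otimes> c) = complex_of_real t \<odot> \<one> \<ominus> (complex_of_real s \<odot> \<one> \<ominus> g)"
      using u by (simp add: c(3) smult_diff_right)
    also have "complex_of_real t \<odot> \<one> = complex_of_real M \<odot> \<one> \<oplus> complex_of_real s \<odot> \<one>"
      using smult_add_left[of \<one> "complex_of_real M" "complex_of_real s"]
      by (simp add: t_def add.commute)
    also have "\<dots> \<ominus> (complex_of_real s \<odot> \<one> \<ominus> g) = complex_of_real M \<odot> \<one> \<oplus> g"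
    proof -
      have "(x \<oplus> y) \<ominus> (y \<ominus> g) = x \<oplus> g" if "x \<in> carrier A" "y \<in> carrier A" for x y
        using that g(1) by algebra
      then show ?thesis
        by simp
    qed
    finally have "complex_of_real t \<odot> (c \<otimes> c) = complex_of_real M \<odot> \<one> \<oplus> g" .
    moreover have "d \<otimes> c = c \<otimes> d" if "d \<in> carrier A" "d \<otimes> g = g \<otimes> d" for d
      using that c(4)[of d] g
      by (simp add: u_def smult_mult_left smult_mult_right diff_distr_left diff_distr_right)
    ultimately show ?thesis
      using c by blast
  qed
  obtain c where c: "c \<in> carrier A" "star A c = c"
    "complex_of_real t \<odot> (c \<otimes> c) = complex_of_real M \<odot> \<one> \<oplus> h"
    "\<And>d. d \<in> carrier A \<Longrightarrow> d \<otimes> h = h \<otimes> d \<Longrightarrow> d \<otimes> c = c \<otimes> d"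
    using ex[OF h ge] by blast
  have h': "(- 1) \<odot> h \<in> carrier A" "star A ((- 1) \<odot> h) = (- 1) \<odot> h"
    "complex_of_real s \<odot> \<one> \<ominus> (- 1) \<odot> h = complex_of_real s \<odot> \<one> \<oplus> h"
    using h by (simp_all add: star_smult diff_eq_smult)
  obtain c' where c': "c' \<in> carrier A" "star A c' = c'"
    "complex_of_real t \<odot> (c' \<otimes> c') = complex_of_real M \<odot> \<one> \<oplus> (- 1) \<odot> h"
    "\<And>d. d \<in> carrier A \<Longrightarrow> d \<otimes> ((- 1) \<odot> h) = ((- 1) \<odot> h) \<otimes> d \<Longrightarrow> d \<otimes> c' = c' \<otimes> d"
    using ex[OF h'(1,2)] le h'(3) by auto
  have hc: "h \<otimes> c = c \<otimes> h" and hc': "h \<otimes> c' = c' \<otimes> h"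
    using c(4)[of h] c'(4)[of h] h by (simp_all add: smult_mult_left smult_mult_right)
  \<comment> \<open>\<open>c\<close> commutes with \<open>h\<close>, hence with \<open>-h\<close>,
    and \<open>c'\<close> commutes with everything that commutes with \<open>-h\<close>. So the two
    roots commute, and their product is self-adjoint and again commutes with
    \<open>h\<close>.\<close>
  have "c \<otimes> ((- 1) \<odot> h) = ((- 1) \<odot> h) \<otimes> c"
    using c(1) h(1) by (simp add: smult_mult_left smult_mult_right hc)
  then have cc': "c \<otimes> c' = c' \<otimes> c"
    using c'(4) c(1) by blast
  define v where "v = complex_of_real t \<odot> (c \<otimes> c')"
  have v: "v \<in> carrier A" "star A v = v"
    using c(1,2) c'(1,2) by (simp_all add: v_def star_smult star_mult cc')
  have hv: "h \<otimes> v = v \<otimes> h"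
  proof -
    have "h \<otimes> (c \<otimes> c') = (h \<otimes> c) \<otimes> c'"
      using h(1) c(1) c'(1) by (simp add: mult_assoc)
    also have "\<dots> = c \<otimes> (h \<otimes> c')"
      using h(1) c(1) c'(1) by (simp add: hc mult_assoc)
    also have "\<dots> = (c \<otimes> c') \<otimes> h"
      using h(1) c(1) c'(1) by (simp add: hc' mult_assoc)
    finally show ?thesis
      using h(1) c(1) c'(1) by (simp add: v_def smult_mult_left smult_mult_right)
  qed
  have "(c \<otimes> c') \<otimes> (c \<otimes> c') = c \<otimes> (c' \<otimes> c) \<otimes> c'"
    using c(1) c'(1) by (simp add: mult_assoc)
  also have "\<dots> = c \<otimes> (c \<otimes> c') \<otimes> c'"
    by (simp add: cc')
  also have "\<dots> = (c \<otimes> c) \<otimes> (c' \<otimes> c')"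
    using c(1) c'(1) by (simp add: mult_assoc)
  finally have "v \<otimes> v = (complex_of_real t \<odot> (c \<otimes> c)) \<otimes> (complex_of_real t \<odot> (c' \<otimes> c'))"
    using c(1) c'(1) by (simp add: v_def smult_mult_left smult_mult_right)
  also have "\<dots> = complex_of_real (M\<^sup>2) \<odot> \<one> \<oplus> (- 1) \<odot> (h \<otimes> h)"
  proof -
    have "(complex_of_real M \<odot> \<one> \<oplus> h) \<otimes> (complex_of_real M \<odot> \<one> \<oplus> (- 1) \<odot> h) =
      complex_of_real (M\<^sup>2) \<odot> \<one> \<oplus> ((complex_of_real M \<odot> h \<oplus> (- complex_of_real M) \<odot> h) \<oplus> (- 1) \<odot> (h \<otimes> h))"
      using h by (simp add: distrib_left distrib_right smult_mult_left smult_mult_right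
          smult_add_right add_ac power2_eq_square)
    also have "complex_of_real M \<odot> h \<oplus> (- complex_of_real M) \<odot> h = \<zero>"
      using smult_add_left[of h "complex_of_real M" "- complex_of_real M"] h by simp
    finally show ?thesis
      using h by (simp add: c(3) c'(3))
  qed
  finally have "h \<otimes> h \<oplus> v \<otimes> v = complex_of_real (M\<^sup>2) \<odot> \<one>"
  proof -
    assume vv: "v \<otimes> v = complex_of_real (M\<^sup>2) \<odot> \<one> \<oplus> (- 1) \<odot> (h \<otimes> h)"
    have "x \<oplus> (y \<ominus> x) = y" if "x \<in> carrier A" "y \<in> carrier A" for x y
      using that by algebra
    then show ?thesis
      using h by (simp add: vv flip: diff_eq_smult)
  qed
  then show "nrm A h \<le> m + e"
    using norm_le_of_sum_squares[OF h v hv, of M] t by (simp add: M_def)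
qed

text \<open>The numerical criterion for \<open>h = a^2\<close>, \<open>s = r^2\<close> and
  \<open>m = |a^2 + b^2|\<close>. One bound comes from
  \<open>r^2 + a^2 = (r^2 - b^2) + (a^2 + b^2)\<close>, the other from
  \<open>|r^2 - a^2| \<le> r^2\<close>; so \<open>r\<close> has to exceed both norms.\<close>

lemma norm_square_le_sum_squares:
  assumes a: "a \<in> carrier A" "star A a = a" and b: "b \<in> carrier A" "star A b = b"
  shows "nrm A (a \<otimes> a) \<le> nrm A (a \<otimes> a \<oplus> b \<otimes> b)"
proof -
  define r where "r = max (nrm A a) (nrm A b) + 1"
  have r: "nrm A a < r" "nrm A b < r"
    by (simp_all add: r_def)
  define m where "m = nrm A (a \<otimes> a \<oplus> b \<otimes> b)"
  have m: "0 \<le> m"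
    using a b norm_nonneg by (simp add: m_def)
  have "complex_of_real (r\<^sup>2) \<odot> \<one> \<oplus> a \<otimes> a =
      (complex_of_real (r\<^sup>2) \<odot> \<one> \<ominus> b \<otimes> b) \<oplus> (a \<otimes> a \<oplus> b \<otimes> b)"
  proof -
    have shift: "x \<oplus> y = (x \<ominus> z) \<oplus> (y \<oplus> z)" if "x \<in> carrier A" "y \<in> carrier A" "z \<in> carrier A" for x y z
      using that by algebra
    show ?thesis
      by (rule shift) (use a(1) b(1) in simp_all)
  qed
  then have "nrm A (complex_of_real (r\<^sup>2) \<odot> \<one> \<oplus> a \<otimes> a) \<le> r\<^sup>2 + m"
    using norm_triangle[of "complex_of_real (r\<^sup>2) \<odot> \<one> \<ominus> b \<otimes> b" "a \<otimes> a \<oplus> b \<otimes> b"]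
      norm_diff_square_le[OF b r(2)] a b by (simp add: m_def)
  moreover have "nrm A (complex_of_real (r\<^sup>2) \<odot> \<one> \<ominus> a \<otimes> a) \<le> r\<^sup>2 + m"
    using norm_diff_square_le[OF a r(1)] m by simp
  ultimately show ?thesis
    using norm_le_of_numerical_bounds[of "a \<otimes> a" "r\<^sup>2" m] a m by (simp add: star_mult m_def)
qed

end

section \<open>Quotients of Banach spaces and of C*-algebras\<close>

context normed_space
begin

lemma normed_space_submodule:
  assumes B: "submodule B (scalars :: 'k ring) V"
  shows "normed_space (V\<lparr>carrier := B\<rparr>)"
proof -
  have sub: "B \<subseteq> carrier V"
    using submoduleE(1)[OF B] .
  interpret S: Module.module "scalars :: 'k ring" "V\<lparr>carrier := B\<rparr>"
    using submodule.submodule_is_module[OF B] module_axioms by blast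
  show ?thesis
    using sub by unfold_locales (auto simp: subset_iff norm_nonneg norm_eq_0 norm_smult norm_triangle)
qed

text \<open>The additive inverse of a structure is selected within its carrier, so restricting the
  carrier might change it. Multiplication by \<open>-1\<close> does not refer to the carrier and
  mediates between the two.\<close>

lemma diff_submodule:
  assumes B: "submodule B (scalars :: 'k ring) V" and "x \<in> B" "y \<in> B"
  shows "x \<ominus>\<^bsub>V\<lparr>carrier := B\<rparr>\<^esub> y = x \<ominus> y"
  using normed_space.diff_eq_smult[OF normed_space_submodule[OF B], of x y] diff_eq_smult[of x y]
    assms submoduleE(1)[OF B] by (auto simp: subset_iff)

lemma minus_submodule:
  assumes B: "submodule B (scalars :: 'k ring) V" and "x \<in> B"
  shows "\<ominus>\<^bsub>V\<lparr>carrier := B\<rparr>\<^esub> x = \<ominus> x"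
  using normed_space.minus_eq_smult[OF normed_space_submodule[OF B], of x] minus_eq_smult[of x]
    assms submoduleE(1)[OF B] by (auto simp: subset_iff)

lemma submoduleI_smult:
  assumes "S \<subseteq> carrier V" "\<zero> \<in> S" "\<And>x y. x \<in> S \<Longrightarrow> y \<in> S \<Longrightarrow> x \<oplus> y \<in> S"
    and smult: "\<And>c x. x \<in> S \<Longrightarrow> c \<odot> x \<in> S"
  shows "submodule S (scalars :: 'k ring) V"
proof (rule submoduleI)
  show "\<ominus> x \<in> S" if "x \<in> S" for x
    using that smult[of x "- 1"] assms(1) by (auto simp: minus_eq_smult)
qed (use assms in auto)

end

lemma (in banach_space) banach_space_closed_submodule:
  assumes B: "submodule B (scalars :: 'k ring) V" and closed: "closedin (norm_topology V) B"
  shows "banach_space (V\<lparr>carrier := B\<rparr>)"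
proof -
  have sub: "B \<subseteq> carrier V"
    using closed by (simp add: closedin_norm_iff)
  interpret N: normed_space "V\<lparr>carrier := B\<rparr>"
    by (rule normed_space_submodule[OF B])
  note diff = diff_submodule[OF B]
  show ?thesis
  proof (rule N.banach_spaceI)
    fix s :: "nat \<Rightarrow> 'a"
    assume mem: "\<And>n. s n \<in> carrier (V\<lparr>carrier := B\<rparr>)"
      and Cauchy: "\<And>e. 0 < e \<Longrightarrow>
        \<exists>N. \<forall>m\<ge>N. \<forall>n\<ge>N. nrm (V\<lparr>carrier := B\<rparr>) (s m \<ominus>\<^bsub>V\<lparr>carrier := B\<rparr>\<^esub> s n) < e"
    have "s n \<in> carrier V" for n
      using mem sub by auto
    moreover have "\<exists>N. \<forall>m\<ge>N. \<forall>n\<ge>N. nrm V (s m \<ominus> s n) < e" if "0 < e" for e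
      using Cauchy[OF that] mem by (simp add: diff)
    ultimately obtain l where l: "l \<in> carrier V" "\<And>e. 0 < e \<Longrightarrow> \<exists>N. \<forall>n\<ge>N. nrm V (s n \<ominus> l) < e"
      using Cauchy_imp_convergent[of s] by blast
    have "\<exists>b\<in>B. nrm V (l \<ominus> b) < e" if e: "0 < e" for e
    proof -
      obtain N where "nrm V (s N \<ominus> l) < e"
        using l(2)[OF e] by blast
      moreover have "s N \<in> B"
        using mem by simp
      ultimately show ?thesis
        using norm_diff_commute[of l "s N"] l(1) sub by (intro bexI[of _ "s N"]) auto
    qed
    then have "l \<in> B"
      using closed l(1) unfolding closedin_norm_iff by blast
    then show "\<exists>l\<in>carrier (V\<lparr>carrier := B\<rparr>). \<forall>e>0. \<exists>N. \<forall>n\<ge>N.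
        nrm (V\<lparr>carrier := B\<rparr>) (s n \<ominus>\<^bsub>V\<lparr>carrier := B\<rparr>\<^esub> l) < e"
      using l(2) mem by (intro bexI[of _ l]) (simp_all add: diff)
  qed
qed

lemma (in unital_cstar_algebra) unital_cstar_algebra_closed_subalgebra:
  assumes B: "submodule B (scalars :: complex ring) A" and closed: "closedin (norm_topology A) B"
    and one: "\<one> \<in> B" and mult: "\<And>x y. x \<in> B \<Longrightarrow> y \<in> B \<Longrightarrow> x \<otimes> y \<in> B"
    and star: "\<And>x. x \<in> B \<Longrightarrow> star A x \<in> B"
  shows "unital_cstar_algebra (A\<lparr>carrier := B\<rparr>)"
proof -
  have sub: "x \<in> carrier A" if "x \<in> B" for x
    using closed that by (auto simp: closedin_norm_iff)
  interpret S: banach_space "A\<lparr>carrier := B\<rparr>"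
    by (rule banach_space_closed_submodule[OF B closed])
  have "ring (A\<lparr>carrier := B\<rparr>)"
  proof (rule ringI)
    show "abelian_group (A\<lparr>carrier := B\<rparr>)"
      by unfold_locales
    show "monoid (A\<lparr>carrier := B\<rparr>)"
      by (rule monoidI) (simp_all add: one mult sub mult_assoc)
  qed (simp_all add: sub distrib_left distrib_right)
  then show ?thesis
    by (intro unital_cstar_algebra.intro unital_cstar_algebra_axioms.intro)
      (simp_all add: S.banach_space_axioms sub star smult_mult_left smult_mult_right star_star
        star_add star_smult star_mult norm_mult_le cstar_identity)
qed

text \<open>A quotient is given by any structure \<open>W\<close> with a surjection \<open>p\<close>
  that has the fibres and the norm of \<open>V / I\<close>. Cosets of \<open>K\<close> and pairs of
  such cosets are both instances. That \<open>I\<close> is the kernel of \<open>p\<close> is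
  contained in \<open>p_eq_iff\<close> with \<open>y = 0\<close>.\<close>

locale banach_quotient =
  banach_space V
  for V :: "('k::real_normed_field, 'a, 'm) normed_alg_scheme" (structure)
    and I :: "'a set" and W :: "('k, 'b, 'n) normed_alg_scheme" and p :: "'a \<Rightarrow> 'b" +
  assumes closed_I: "closedin (norm_topology V) I"
    and p_surj: "p ` carrier V = carrier W"
    and p_add: "x \<in> carrier V \<Longrightarrow> y \<in> carrier V \<Longrightarrow> p (x \<oplus> y) = p x \<oplus>\<^bsub>W\<^esub> p y"
    and p_smult: "x \<in> carrier V \<Longrightarrow> p (c \<odot> x) = c \<odot>\<^bsub>W\<^esub> p x"
    and p_zero: "p \<zero> = \<zero>\<^bsub>W\<^esub>"
    and p_eq_iff: "x \<in> carrier V \<Longrightarrow> y \<in> carrier V \<Longrightarrow> p x = p y \<longleftrightarrow> x \<ominus> y \<in> I"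
    and p_norm: "x \<in> carrier V \<Longrightarrow> nrm W (p x) = (INF i\<in>I. nrm V (x \<oplus> i))"
begin

lemma I_mem: "i \<in> I \<Longrightarrow> i \<in> carrier V"
  using closed_I by (auto simp: closedin_norm_iff)

lemma zero_in_I: "\<zero> \<in> I"
  using p_eq_iff[of \<zero> \<zero>] by simp


lemma p_closed: "x \<in> carrier V \<Longrightarrow> p x \<in> carrier W"
  using p_surj by blast

lemma W_cases:
  assumes "X \<in> carrier W"
  obtains x where "x \<in> carrier V" "X = p x"
  using assms p_surj by blast

lemma p_add_I: "x \<in> carrier V \<Longrightarrow> i \<in> I \<Longrightarrow> p (x \<oplus> i) = p x"
  using I_mem p_eq_iff[of "x \<oplus> i" x] by (simp add: a_minus_def M.a_ac M.r_neg M.r_neg2)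

lemma norm_p_le:
  assumes "x \<in> carrier V"
  shows "nrm W (p x) \<le> nrm V x"
proof -
  have "nrm W (p x) \<le> nrm V (x \<oplus> \<zero>)"
    unfolding p_norm[OF assms]
    by (rule cINF_lower[OF bdd_belowI2[where m = 0] zero_in_I]) (simp add: assms I_mem norm_nonneg)
  then show ?thesis
    using assms by simp
qed

text \<open>The working form of the infimum: estimates for the quotient norm are made on almost
  optimal representatives.\<close>

lemma norm_p_approx:
  assumes x: "x \<in> carrier V" and e: "nrm W (p x) < e"
  obtains y where "y \<in> carrier V" "p y = p x" "nrm V y < e"
proof -
  have "\<exists>i\<in>I. nrm V (x \<oplus> i) < e"
  proof (rule ccontr)
    assume "\<not> ?thesis"
    then have "e \<le> (INF i\<in>I. nrm V (x \<oplus> i))"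
      using zero_in_I by (intro cINF_greatest) (auto simp: not_less)
    then show False
      using e p_norm[OF x] by simp
  qed
  then show thesis
    using that x I_mem p_add_I by (metis M.add.m_closed)
qed

lemma norm_p_nonneg: "x \<in> carrier V \<Longrightarrow> 0 \<le> nrm W (p x)"
  unfolding p_norm using zero_in_I I_mem norm_nonneg by (intro cINF_greatest) auto

lemma norm_p_eq_0:
  assumes x: "x \<in> carrier V"
  shows "nrm W (p x) = 0 \<longleftrightarrow> p x = \<zero>\<^bsub>W\<^esub>"
proof
  assume 0: "nrm W (p x) = 0"
  \<comment> \<open>If \<open>y\<close> is a representative of norm below \<open>e\<close>, then
    \<open>x - y\<close> lies in \<open>I\<close> at distance \<open>|y|\<close> from
    \<open>x\<close>. Closedness of \<open>I\<close> then puts \<open>x\<close> into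
    \<open>I\<close>.\<close>
  have "\<exists>s\<in>I. nrm V (x \<ominus> s) < e" if e: "0 < e" for e
  proof -
    obtain y where y: "y \<in> carrier V" "p y = p x" "nrm V y < e"
      using norm_p_approx[OF x, of e] 0 e by auto
    have "x \<ominus> (x \<ominus> y) = y"
      using x y(1) by (simp add: diff_eq_smult smult_add_right)
        (simp add: x M.r_neg2 flip: minus_eq_smult)
    then show ?thesis
      using y p_eq_iff[OF x y(1)] by (intro bexI[of _ "x \<ominus> y"]) auto
  qed
  then have "x \<in> I"
    using closed_I x unfolding closedin_norm_iff by blast
  then have "p x = p \<zero>"
    using x p_eq_iff[of x \<zero>] by (simp add: diff_eq_smult)
  then show "p x = \<zero>\<^bsub>W\<^esub>"
    by (simp add: p_zero)
next
  assume "p x = \<zero>\<^bsub>W\<^esub>"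
  then have "nrm W (p x) = nrm W (p \<zero>)"
    by (simp add: p_zero)
  then show "nrm W (p x) = 0"
    using norm_p_le[of \<zero>] norm_p_nonneg[of \<zero>] by simp
qed

lemma abelian_group_W: "abelian_group W"
proof (rule abelian_groupI)
  fix X assume "X \<in> carrier W"
  then obtain x where x: "x \<in> carrier V" "X = p x"
    by (rule W_cases)
  have "p (\<ominus> x) \<oplus>\<^bsub>W\<^esub> X = \<zero>\<^bsub>W\<^esub>"
    using x by (simp add: M.l_neg p_zero flip: p_add)
  then show "\<exists>Y\<in>carrier W. Y \<oplus>\<^bsub>W\<^esub> X = \<zero>\<^bsub>W\<^esub>"
    using x p_closed by blast
  show "\<zero>\<^bsub>W\<^esub> \<oplus>\<^bsub>W\<^esub> X = X"
    using x by (simp flip: p_add p_zero)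
next
  fix X Y assume "X \<in> carrier W" "Y \<in> carrier W"
  then obtain x y where xy: "x \<in> carrier V" "X = p x" "y \<in> carrier V" "Y = p y"
    by (meson W_cases)
  then show "X \<oplus>\<^bsub>W\<^esub> Y \<in> carrier W" "X \<oplus>\<^bsub>W\<^esub> Y = Y \<oplus>\<^bsub>W\<^esub> X"
    by (simp_all add: p_closed M.a_comm flip: p_add)
  fix Z assume "Z \<in> carrier W"
  then obtain z where "z \<in> carrier V" "Z = p z"
    by (rule W_cases)
  then show "X \<oplus>\<^bsub>W\<^esub> Y \<oplus>\<^bsub>W\<^esub> Z = X \<oplus>\<^bsub>W\<^esub> (Y \<oplus>\<^bsub>W\<^esub> Z)"
    using xy by (simp add: M.a_assoc flip: p_add)
qed (simp add: p_closed flip: p_zero)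

lemma norm_p_smult_le:
  assumes x: "x \<in> carrier V"
  shows "nrm W (p (c \<odot> x)) \<le> norm c * nrm W (p x)"
proof (rule field_le_epsilon)
  fix e :: real assume e: "0 < e"
  \<comment> \<open>The summand \<open>1\<close> covers \<open>c = 0\<close>; all that matters is
    \<open>norm c * d \<le> e\<close>.\<close>
  define d where "d = e / (norm c + 1)"
  have d: "0 < d" "norm c * d \<le> e"
    using e by (simp_all add: d_def field_simps add_pos_nonneg)
  obtain y where y: "y \<in> carrier V" "p y = p x" "nrm V y < nrm W (p x) + d"
    using norm_p_approx[OF x, of "nrm W (p x) + d"] d by auto
  have "nrm W (p (c \<odot> x)) = nrm W (p (c \<odot> y))"
    using x y by (simp add: p_smult)
  also have "\<dots> \<le> norm c * nrm V y"
    using norm_p_le[of "c \<odot> y"] y by (simp add: norm_smult)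
  also have "\<dots> \<le> norm c * (nrm W (p x) + d)"
    using y by (intro mult_left_mono) auto
  also have "\<dots> \<le> norm c * nrm W (p x) + e"
    using d by (simp add: distrib_left)
  finally show "nrm W (p (c \<odot> x)) \<le> norm c * nrm W (p x) + e" .
qed

text \<open>The reverse inequality is the same inequality for the scalar \<open>inverse c\<close>
  and the vector \<open>c x\<close>.\<close>

lemma norm_p_smult:
  assumes x: "x \<in> carrier V"
  shows "nrm W (p (c \<odot> x)) = norm c * nrm W (p x)"
proof (cases "c = 0")
  case True
  then show ?thesis
    using x norm_p_eq_0[of \<zero>] by (simp add: p_zero)
next
  case False
  have "norm c * nrm W (p x) = norm c * nrm W (p (inverse c \<odot> (c \<odot> x)))"
    using False x by simp
  also have "\<dots> \<le> norm c * (norm (inverse c) * nrm W (p (c \<odot> x)))"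
    using x by (intro mult_left_mono norm_p_smult_le) auto
  also have "\<dots> = nrm W (p (c \<odot> x))"
    using False by (simp add: norm_inverse)
  finally show ?thesis
    using norm_p_smult_le[OF x, of c] by simp
qed

lemma norm_p_triangle:
  assumes x: "x \<in> carrier V" and y: "y \<in> carrier V"
  shows "nrm W (p (x \<oplus> y)) \<le> nrm W (p x) + nrm W (p y)"
proof (rule field_le_epsilon)
  fix e :: real assume e: "0 < e"
  obtain x' where x': "x' \<in> carrier V" "p x' = p x" "nrm V x' < nrm W (p x) + e / 2"
    using norm_p_approx[OF x, of "nrm W (p x) + e / 2"] e by auto
  obtain y' where y': "y' \<in> carrier V" "p y' = p y" "nrm V y' < nrm W (p y) + e / 2"
    using norm_p_approx[OF y, of "nrm W (p y) + e / 2"] e by auto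
  have "nrm W (p (x \<oplus> y)) = nrm W (p (x' \<oplus> y'))"
    using x y x' y' by (simp add: p_add)
  also have "\<dots> \<le> nrm V x' + nrm V y'"
    using norm_p_le[of "x' \<oplus> y'"] norm_triangle[of x' y'] x' y' by simp
  finally show "nrm W (p (x \<oplus> y)) \<le> nrm W (p x) + nrm W (p y) + e"
    using x' y' by simp
qed

lemma normed_space_W: "normed_space W"
proof (rule normed_spaceI[OF abelian_group_W])
  fix X assume "X \<in> carrier W"
  then obtain x where x: "x \<in> carrier V" "X = p x"
    by (rule W_cases)
  show "c \<odot>\<^bsub>W\<^esub> X \<in> carrier W" "1 \<odot>\<^bsub>W\<^esub> X = X" "0 \<le> nrm W X" "nrm W X = 0 \<longleftrightarrow> X = \<zero>\<^bsub>W\<^esub>"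
    "nrm W (c \<odot>\<^bsub>W\<^esub> X) = norm c * nrm W X" for c
    using x norm_p_smult[OF x(1)]
    by (simp_all add: norm_p_eq_0 norm_p_nonneg p_closed flip: p_smult)
  show "(a + b) \<odot>\<^bsub>W\<^esub> X = a \<odot>\<^bsub>W\<^esub> X \<oplus>\<^bsub>W\<^esub> b \<odot>\<^bsub>W\<^esub> X" "(a * b) \<odot>\<^bsub>W\<^esub> X = a \<odot>\<^bsub>W\<^esub> (b \<odot>\<^bsub>W\<^esub> X)" for a b
    using x by (simp_all add: smult_add_left flip: p_smult p_add)
  fix Y assume "Y \<in> carrier W"
  then obtain y where y: "y \<in> carrier V" "Y = p y"
    by (rule W_cases)
  show "nrm W (X \<oplus>\<^bsub>W\<^esub> Y) \<le> nrm W X + nrm W Y"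
    using x y norm_p_triangle by (simp flip: p_add)
  show "a \<odot>\<^bsub>W\<^esub> (X \<oplus>\<^bsub>W\<^esub> Y) = a \<odot>\<^bsub>W\<^esub> X \<oplus>\<^bsub>W\<^esub> a \<odot>\<^bsub>W\<^esub> Y" for a
    using x y by (simp add: smult_add_right flip: p_smult p_add)
qed

section \<open>Completeness of the quotient space\<close>

interpretation W: normed_space W
  by (rule normed_space_W)

lemma p_diff: "x \<in> carrier V \<Longrightarrow> y \<in> carrier V \<Longrightarrow> p (x \<ominus> y) = p x \<ominus>\<^bsub>W\<^esub> p y"
  by (simp add: diff_eq_smult W.diff_eq_smult p_closed p_add p_smult)

text \<open>If \<open>x\<close> lifts \<open>t k\<close> and \<open>y\<close> is a small
  representative of the increment, then \<open>y + x\<close> lifts the next term. The strict bound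
  on the quotient norm leaves room for a representative with the same bound.\<close>

lemma lift_fast_sequence:
  assumes mem: "\<And>k. t k \<in> carrier W"
    and fast: "\<And>k. nrm W (t (Suc k) \<ominus>\<^bsub>W\<^esub> t k) < (1/2) ^ k"
  obtains x where "\<And>k. x k \<in> carrier V" "\<And>k. p (x k) = t k"
    "\<And>k. nrm V (x (Suc k) \<ominus> x k) < (1/2) ^ k"
proof -
  have "\<exists>x. \<forall>k. (x k \<in> carrier V \<and> p (x k) = t k) \<and> nrm V (x (Suc k) \<ominus> x k) < (1/2) ^ k"
  proof (rule dependent_nat_choice)
    show "\<exists>x. x \<in> carrier V \<and> p x = t 0"
      using W_cases[OF mem[of 0]] by metis
  next
    fix x k assume x: "x \<in> carrier V \<and> p x = t k"
    obtain z where z: "z \<in> carrier V" "p z = t (Suc k)"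
      using W_cases[OF mem[of "Suc k"]] by metis
    have "nrm W (p (z \<ominus> x)) < (1/2) ^ k"
      using x z fast[of k] by (simp add: p_diff)
    then obtain y where y: "y \<in> carrier V" "p y = p (z \<ominus> x)" "nrm V y < (1/2) ^ k"
      using norm_p_approx[of "z \<ominus> x" "(1/2) ^ k"] x z by auto
    have "p (y \<oplus> x) = p ((z \<ominus> x) \<oplus> x)"
      using x y z by (simp only: p_add minus_closed)
    then have "p (y \<oplus> x) = t (Suc k)"
      using x z by (simp add: diff_add_cancel)
    moreover have "(y \<oplus> x) \<ominus> x = y"
      using x y by (simp add: a_minus_def M.a_assoc M.r_neg)
    ultimately show "\<exists>x'. (x' \<in> carrier V \<and> p x' = t (Suc k)) \<and> nrm V (x' \<ominus> x) < (1/2) ^ k"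
      using x y by (intro exI[of _ "y \<oplus> x"]) auto
  qed
  then show thesis
    using that by blast
qed

lemma fast_sequence_convergent:
  assumes mem: "\<And>k. x k \<in> carrier V" and fast: "\<And>k. nrm V (x (Suc k) \<ominus> x k) < (1/2) ^ k"
  obtains l where "l \<in> carrier V" "\<And>e. 0 < e \<Longrightarrow> \<exists>N. \<forall>n\<ge>N. nrm V (x n \<ominus> l) < e"
proof -
  \<comment> \<open>The right side is the exact partial sum of the geometric series from
    \<open>k\<close> to \<open>k + j - 1\<close>, so the induction on \<open>j\<close> closes
    without loss.\<close>
  have tail: "nrm V (x (k + j) \<ominus> x k) \<le> 2 * (1/2) ^ k - 2 * (1/2) ^ (k + j)" for k j
  proof (induction j)
    case 0
    then show ?case
      using mem by simp
  next
    case (Suc j)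
    then show ?case
      using norm_diff_triangle[of "x (k + Suc j)" "x (k + j)" "x k"] fast[of "k + j"] mem by simp
  qed
  have tail': "nrm V (x m \<ominus> x k) < 2 * (1/2) ^ k" if "k \<le> m" for m k
  proof -
    have "nrm V (x m \<ominus> x k) \<le> 2 * (1/2) ^ k - 2 * (1/2) ^ m"
      using tail[of k "m - k"] that by simp
    then show ?thesis
      by (smt (verit) zero_less_power half_gt_zero_iff)
  qed
  have "\<exists>N. \<forall>m\<ge>N. \<forall>n\<ge>N. nrm V (x m \<ominus> x n) < e" if "0 < e" for e
  proof -
    obtain N where N: "(1/2) ^ N < e / 4"
      using real_arch_pow_inv[of "e / 4" "1/2"] \<open>0 < e\<close> by auto
    have "nrm V (x m \<ominus> x n) < e" if "N \<le> m" "N \<le> n" for m n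
      using norm_diff_triangle[of "x m" "x N" "x n"] norm_diff_commute[of "x N" "x n"]
        tail'[OF that(1)] tail'[OF that(2)] mem N by simp
    then show ?thesis
      by blast
  qed
  then show thesis
    using Cauchy_imp_convergent[of x] mem that by blast
qed

text \<open>A Cauchy sequence need not lift to a Cauchy sequence, but a subsequence with geometric
  increments does. The limit of the lift projects to the limit of the subsequence, and hence of the
  sequence.\<close>

lemma banach_space_W: "banach_space W"
proof (rule W.banach_spaceI)
  fix s :: "nat \<Rightarrow> 'b"
  assume mem: "\<And>n. s n \<in> carrier W"
    and Cauchy: "\<And>e. 0 < e \<Longrightarrow> \<exists>N. \<forall>m\<ge>N. \<forall>n\<ge>N. nrm W (s m \<ominus>\<^bsub>W\<^esub> s n) < e"
  have "\<exists>N. \<forall>m\<ge>N. \<forall>n\<ge>N. nrm W (s m \<ominus>\<^bsub>W\<^esub> s n) < (1/2) ^ k" for k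
    by (rule Cauchy) simp
  then obtain N where N: "\<And>k m n. N k \<le> m \<Longrightarrow> N k \<le> n \<Longrightarrow> nrm W (s m \<ominus>\<^bsub>W\<^esub> s n) < (1/2) ^ k"
    by metis
  \<comment> \<open>\<open>N\<close> need not be monotone; the sum makes both \<open>M k\<close> and
    \<open>M (Suc k)\<close> at least \<open>N k\<close>, as needed for the increment with bound
    \<open>(1/2)^k\<close>.\<close>
  define M where "M k = (\<Sum>j\<le>k. N j)" for k
  have M: "N k \<le> M k" "N k \<le> M (Suc k)" for k
    by (cases k; simp add: M_def)+
  have "nrm W (s (M (Suc k)) \<ominus>\<^bsub>W\<^esub> s (M k)) < (1/2) ^ k" for k
    by (intro N M)
  then obtain x where x: "\<And>k. x k \<in> carrier V" "\<And>k. p (x k) = s (M k)"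
    "\<And>k. nrm V (x (Suc k) \<ominus> x k) < (1/2) ^ k"
    using lift_fast_sequence[of "\<lambda>k. s (M k)"] mem by blast
  obtain l where l: "l \<in> carrier V" "\<And>e. 0 < e \<Longrightarrow> \<exists>N. \<forall>n\<ge>N. nrm V (x n \<ominus> l) < e"
    using fast_sequence_convergent[OF x(1,3)] by blast
  have "\<exists>N. \<forall>n\<ge>N. nrm W (s n \<ominus>\<^bsub>W\<^esub> p l) < e" if e: "0 < e" for e
  proof -
    obtain K where K: "\<And>k. K \<le> k \<Longrightarrow> nrm V (x k \<ominus> l) < e / 2"
      using l(2)[of "e / 2"] e by auto
    obtain K' where K': "(1/2) ^ K' < e / 2"
      using real_arch_pow_inv[of "e / 2" "1/2"] e by auto
    define k where "k = max K K'"
    have "(1/2::real) ^ k \<le> (1/2) ^ K'"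
      by (rule power_decreasing) (simp_all add: k_def)
    then have k: "(1/2) ^ k < e / 2"
      using K' by linarith
    have xk: "nrm V (x k \<ominus> l) < e / 2"
      by (rule K) (simp add: k_def)
    have "nrm W (s n \<ominus>\<^bsub>W\<^esub> p l) < e" if "N k \<le> n" for n
    proof -
      have "nrm W (s (M k) \<ominus>\<^bsub>W\<^esub> p l) \<le> nrm V (x k \<ominus> l)"
        using norm_p_le[of "x k \<ominus> l"] x(1) l(1) by (simp add: p_diff x(2))
      then show ?thesis
        using W.norm_diff_triangle[of "s n" "s (M k)" "p l"] mem p_closed[OF l(1)]
          N[OF that M(1)] k xk by simp
    qed
    then show ?thesis
      by blast
  qed
  then show "\<exists>l\<in>carrier W. \<forall>e>0. \<exists>N. \<forall>n\<ge>N. nrm W (s n \<ominus>\<^bsub>W\<^esub> l) < e"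
    using p_closed[OF l(1)] by blast
qed

end

section \<open>The C*-identity of the quotient norm\<close>

locale cstar_quotient =
  unital_cstar_algebra A + banach_quotient A I W p
  for A :: "('a, 'm) star_alg_scheme" (structure)
    and I :: "'a set" and W :: "('b, 'n) star_alg_scheme" and p :: "'a \<Rightarrow> 'b" +
  assumes I_mult: "x \<in> carrier A \<Longrightarrow> i \<in> I \<Longrightarrow> x \<otimes> i \<in> I" "x \<in> carrier A \<Longrightarrow> i \<in> I \<Longrightarrow> i \<otimes> x \<in> I"
    and p_mult: "x \<in> carrier A \<Longrightarrow> y \<in> carrier A \<Longrightarrow> p (x \<otimes> y) = p x \<otimes>\<^bsub>W\<^esub> p y"
    and p_one: "p \<one> = \<one>\<^bsub>W\<^esub>"
    and p_star: "x \<in> carrier A \<Longrightarrow> p (star A x) = star W (p x)"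
begin

lemma norm_p_star_le:
  assumes x: "x \<in> carrier A"
  shows "nrm W (p (star A x)) \<le> nrm W (p x)"
proof (rule field_le_epsilon)
  fix e :: real assume e: "0 < e"
  then obtain y where y: "y \<in> carrier A" "p y = p x" "nrm A y < nrm W (p x) + e"
    using norm_p_approx[OF x, of "nrm W (p x) + e"] by auto
  have "nrm W (p (star A x)) = nrm W (p (star A y))"
    using x y by (simp add: p_star)
  also have "\<dots> \<le> nrm A y"
    using norm_p_le[of "star A y"] y by (simp add: norm_star star_closed)
  finally show "nrm W (p (star A x)) \<le> nrm W (p x) + e"
    using y by simp
qed

lemma norm_p_mult_le:
  assumes x: "x \<in> carrier A" and y: "y \<in> carrier A"
  shows "nrm W (p (x \<otimes> y)) \<le> nrm W (p x) * nrm W (p y)"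
proof -
  have "nrm W (p (x \<otimes> y)) \<le> r * s" if r: "nrm W (p x) < r" and s: "nrm W (p y) < s" for r s
  proof -
    obtain x' where x': "x' \<in> carrier A" "p x' = p x" "nrm A x' < r"
      using norm_p_approx[OF x r] by blast
    obtain y' where y': "y' \<in> carrier A" "p y' = p y" "nrm A y' < s"
      using norm_p_approx[OF y s] by blast
    have "nrm W (p (x \<otimes> y)) = nrm W (p (x' \<otimes> y'))"
      using x y x' y' by (simp add: p_mult)
    also have "\<dots> \<le> nrm A x' * nrm A y'"
      using norm_p_le[of "x' \<otimes> y'"] norm_mult_le[of x' y'] x' y' by simp
    also have "\<dots> \<le> r * s"
      using x' y' norm_nonneg[of x'] norm_nonneg[of y'] by (intro mult_mono) auto
    finally show ?thesis .
  qed
  note * = this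
  \<comment> \<open>The error enters both factors, so it is removed by a limit from the right
    instead of by an additive epsilon.\<close>
  have "\<forall>\<^sub>F e in at_right 0. nrm W (p (x \<otimes> y)) \<le> (nrm W (p x) + e) * (nrm W (p y) + e)"
    using eventually_at_right_less[of "0 :: real"] by (rule eventually_mono) (rule *, auto)
  moreover have "((\<lambda>e. (nrm W (p x) + e) * (nrm W (p y) + e)) \<longlongrightarrow>
      (nrm W (p x) + 0) * (nrm W (p y) + 0)) (at_right 0)"
    by (intro tendsto_intros)
  ultimately show ?thesis
    using tendsto_lowerbound[of _ _ "at_right (0 :: real)"] by force
qed

text \<open>The hard half of the C*-identity; the other half is submultiplicativity together with
  \<open>norm_p_star_le\<close>.\<close>

lemma norm_p_square_le:
  assumes x: "x \<in> carrier A"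
  shows "(nrm W (p x))\<^sup>2 \<le> nrm W (p (star A x \<otimes> x))"
proof (rule field_le_epsilon)
  fix e :: real assume e: "0 < e"
  define q where "q = star A x \<otimes> x"
  have q: "q \<in> carrier A" "star A q = q"
    using x by (simp_all add: q_def star_closed star_mult star_star)
  obtain y where y: "y \<in> carrier A" "p y = p q" "nrm A y < nrm W (p q) + e / 2"
    using norm_p_approx[OF q(1), of "nrm W (p q) + e / 2"] e by auto
  \<comment> \<open>The almost optimal representative of \<open>q\<close> is made self-adjoint. Its
    class does not change because \<open>q\<close> is self-adjoint, and its norm does not exceed
    that of \<open>y\<close>. So \<open>d = z - q\<close> is a self-adjoint element of the ideal, to
    which \<open>almost_annihilator\<close> applies.\<close>
  define z where "z = (1/2) \<odot> (y \<oplus> star A y)"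
  have z: "z \<in> carrier A"
    using y by (simp add: z_def star_closed)
  have sz: "star A z = z"
    using y by (simp add: z_def star_closed star_smult star_add star_star add_commute)
  have "p z = (1/2) \<odot>\<^bsub>W\<^esub> (p y \<oplus>\<^bsub>W\<^esub> star W (p y))"
    using y by (simp add: z_def p_smult p_add p_star star_closed)
  also have "\<dots> = p ((1/2) \<odot> (q \<oplus> star A q))"
    unfolding y(2) using q(1) by (simp add: p_smult p_add star_closed flip: p_star)
  also have "\<dots> = p q"
    unfolding q(2) using q(1) by (simp add: smult_half_double)
  finally have zq: "z \<ominus> q \<in> I"
    using p_eq_iff z q by blast
  have nz: "nrm A z \<le> nrm W (p q) + e / 2"
    using norm_triangle[of y "star A y"] y by (simp add: z_def norm_smult star_closed norm_star)
  define d where "d = z \<ominus> q"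
  have d: "d \<in> carrier A" "star A d = d"
    using z sz q by (simp_all add: d_def star_diff)
  obtain w r where w: "w \<in> carrier A" "r \<in> carrier A" "nrm A w \<le> 1" "nrm A (d \<otimes> w) \<le> e / 2"
    "\<one> \<ominus> w = d \<otimes> r"
    using almost_annihilator[OF d, of "e / 2"] e by auto
  have sw: "star A w \<in> carrier A" "nrm A (star A w) \<le> 1"
    using w by (simp_all add: star_closed norm_star)
  have contr: "nrm A (star A w \<otimes> v) \<le> nrm A v" "nrm A (v \<otimes> w) \<le> nrm A v" if "v \<in> carrier A" for v
  proof -
    have "nrm A (star A w) * nrm A v \<le> 1 * nrm A v" "nrm A v * nrm A w \<le> nrm A v * 1"
      using w sw norm_nonneg[OF that] by (intro mult_right_mono mult_left_mono; simp)+
    then show "nrm A (star A w \<otimes> v) \<le> nrm A v" "nrm A (v \<otimes> w) \<le> nrm A v"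
      using norm_mult_le[OF sw(1) that] norm_mult_le[OF that w(1)] by simp_all
  qed
  \<comment> \<open>Since \<open>1 - w = d r\<close> lies in the ideal, \<open>x w\<close> is
    another representative of the class of \<open>x\<close>, and its norm bounds the quotient
    norm.\<close>
  have "x \<ominus> x \<otimes> w = x \<otimes> (\<one> \<ominus> w)"
    using x w(1) by (simp add: diff_distr_right)
  also have "\<dots> \<in> I"
    unfolding w(5) using x w(2) zq I_mult by (simp add: d_def)
  finally have "p x = p (x \<otimes> w)"
    using p_eq_iff x w(1) by simp
  then have "(nrm W (p x))\<^sup>2 \<le> (nrm A (x \<otimes> w))\<^sup>2"
    using norm_p_le[of "x \<otimes> w"] norm_p_nonneg x w by (intro power_mono) auto
  also have "\<dots> = nrm A (star A (x \<otimes> w) \<otimes> (x \<otimes> w))"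
    using x w by (simp add: cstar_identity)
  also have "star A (x \<otimes> w) \<otimes> (x \<otimes> w) = star A w \<otimes> (q \<otimes> w)"
    using x w by (simp add: q_def star_mult star_closed mult_assoc)
  \<comment> \<open>Trading \<open>q\<close> for \<open>z - d\<close> leaves
    \<open>|z w| \<le> |z|\<close>, which is close to the quotient norm of \<open>q\<close>, and the
    term \<open>|d w| \<le> e / 2\<close>.\<close>
  also have "q \<otimes> w = (z \<ominus> d) \<otimes> w"
  proof -
    have "q = z \<ominus> d"
      unfolding d_def using z q(1) by algebra
    then show ?thesis
      by simp
  qed
  also have "nrm A (star A w \<otimes> ((z \<ominus> d) \<otimes> w)) \<le> nrm A ((z \<ominus> d) \<otimes> w)"
    using z d w by (intro contr) simp
  also have "\<dots> \<le> nrm A (z \<otimes> w) + nrm A (d \<otimes> w)"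
    using z d w norm_triangle_diff by (simp add: diff_distr_left)
  also have "\<dots> \<le> nrm W (p q) + e"
    using contr(2)[OF z] nz w by simp
  finally show "(nrm W (p x))\<^sup>2 \<le> nrm W (p (star A x \<otimes> x)) + e"
    by (simp add: q_def)
qed

lemma unital_cstar_algebra_W: "unital_cstar_algebra W"
proof (intro unital_cstar_algebra.intro unital_cstar_algebra_axioms.intro)
  show "banach_space W"
    by (rule banach_space_W)
  show "ring W"
  proof (rule ringI[OF abelian_group_W])
    show "monoid W"
    proof (rule monoidI)
      fix X Y Z assume "X \<in> carrier W" "Y \<in> carrier W" "Z \<in> carrier W"
      then obtain x y z where "x \<in> carrier A" "X = p x" "y \<in> carrier A" "Y = p y"
        "z \<in> carrier A" "Z = p z"
        by (meson W_cases)
      then show "X \<otimes>\<^bsub>W\<^esub> Y \<otimes>\<^bsub>W\<^esub> Z = X \<otimes>\<^bsub>W\<^esub> (Y \<otimes>\<^bsub>W\<^esub> Z)" "X \<otimes>\<^bsub>W\<^esub> Y \<in> carrier W"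
        "\<one>\<^bsub>W\<^esub> \<otimes>\<^bsub>W\<^esub> X = X" "X \<otimes>\<^bsub>W\<^esub> \<one>\<^bsub>W\<^esub> = X"
        by (simp_all add: mult_assoc p_closed flip: p_mult p_one)
    qed (simp_all add: p_closed flip: p_one)
  next
    fix X Y Z assume "X \<in> carrier W" "Y \<in> carrier W" "Z \<in> carrier W"
    then obtain x y z where "x \<in> carrier A" "X = p x" "y \<in> carrier A" "Y = p y"
      "z \<in> carrier A" "Z = p z"
      by (meson W_cases)
    then show "(X \<oplus>\<^bsub>W\<^esub> Y) \<otimes>\<^bsub>W\<^esub> Z = X \<otimes>\<^bsub>W\<^esub> Z \<oplus>\<^bsub>W\<^esub> Y \<otimes>\<^bsub>W\<^esub> Z"
      "Z \<otimes>\<^bsub>W\<^esub> (X \<oplus>\<^bsub>W\<^esub> Y) = Z \<otimes>\<^bsub>W\<^esub> X \<oplus>\<^bsub>W\<^esub> Z \<otimes>\<^bsub>W\<^esub> Y"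
      by (simp_all add: distrib_left distrib_right flip: p_mult p_add)
  qed
next
  fix X assume "X \<in> carrier W"
  then obtain x where x: "x \<in> carrier A" "X = p x"
    by (rule W_cases)
  show "star W X \<in> carrier W" "star W (star W X) = X"
    "star W (c \<odot>\<^bsub>W\<^esub> X) = cnj c \<odot>\<^bsub>W\<^esub> star W X" for c
    using x by (simp_all add: p_closed star_closed star_star star_smult flip: p_star p_smult)
  have "nrm W (p (star A x \<otimes> x)) \<le> nrm W (p (star A x)) * nrm W (p x)"
    using x by (intro norm_p_mult_le) (simp_all add: star_closed)
  also have "\<dots> \<le> nrm W (p x) * nrm W (p x)"
    using x by (intro mult_right_mono norm_p_star_le norm_p_nonneg)
  finally have "nrm W (p (star A x \<otimes> x)) = (nrm W (p x))\<^sup>2"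
    using norm_p_square_le[OF x(1)] by (simp add: power2_eq_square)
  then show "nrm W (star W X \<otimes>\<^bsub>W\<^esub> X) = (nrm W X)\<^sup>2"
    using x by (simp add: star_closed flip: p_star p_mult)
  fix Y assume "Y \<in> carrier W"
  then obtain y where y: "y \<in> carrier A" "Y = p y"
    by (rule W_cases)
  show "(c \<odot>\<^bsub>W\<^esub> X) \<otimes>\<^bsub>W\<^esub> Y = c \<odot>\<^bsub>W\<^esub> (X \<otimes>\<^bsub>W\<^esub> Y)" "X \<otimes>\<^bsub>W\<^esub> (c \<odot>\<^bsub>W\<^esub> Y) = c \<odot>\<^bsub>W\<^esub> (X \<otimes>\<^bsub>W\<^esub> Y)" for c
    using x y by (simp_all add: smult_mult_left smult_mult_right flip: p_smult p_mult)
  show "star W (X \<oplus>\<^bsub>W\<^esub> Y) = star W X \<oplus>\<^bsub>W\<^esub> star W Y"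
    "star W (X \<otimes>\<^bsub>W\<^esub> Y) = star W Y \<otimes>\<^bsub>W\<^esub> star W X"
    using x y by (simp_all add: star_closed star_add star_mult flip: p_star p_add p_mult)
  show "nrm W (X \<otimes>\<^bsub>W\<^esub> Y) \<le> nrm W X * nrm W Y"
    using x y norm_p_mult_le by (simp flip: p_mult)
qed

end

section \<open>Lie--Jordan algebras with an associated C*-algebra\<close>

context normed_space
begin

lemma coset_eq_iff:
  assumes I: "submodule I (scalars :: 'k ring) V" and x: "x \<in> carrier V" and y: "y \<in> carrier V"
  shows "I +> x = I +> y \<longleftrightarrow> x \<ominus> y \<in> I"
proof -
  interpret abelian_subgroup I V
    using submodule.axioms(1)[OF I] M.abelian_group_axioms
    by (intro abelian_subgroupI3 additive_subgroup.intro)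
  have "I +> x = I +> y \<longleftrightarrow> x \<in> I +> y"
    using a_rcos_self[OF x] a_repr_independence'[of x y] x y by auto
  then show ?thesis
    using a_rcos_module[OF y x] by (simp add: a_minus_def)
qed

lemma coset_self:
  assumes I: "submodule I (scalars :: 'k ring) V" and x: "x \<in> carrier V"
  shows "x \<in> I +> x"
proof -
  interpret abelian_subgroup I V
    using submodule.axioms(1)[OF I] M.abelian_group_axioms
    by (intro abelian_subgroupI3 additive_subgroup.intro)
  show ?thesis
    using a_rcos_self x by blast
qed

lemma coset_memD:
  assumes I: "submodule I (scalars :: 'k ring) V" and x: "x \<in> carrier V" and y: "y \<in> I +> x"
  shows "y \<in> carrier V" "I +> y = I +> x"
proof -
  interpret abelian_subgroup I V
    using submodule.axioms(1)[OF I] M.abelian_group_axioms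
    by (intro abelian_subgroupI3 additive_subgroup.intro)
  show "y \<in> carrier V"
    using a_elemrcos_carrier x y by blast
  show "I +> y = I +> x"
    using a_repr_independence[OF y x submodule.axioms(1)[OF I]] by simp
qed

lemma coset_add:
  assumes I: "submodule I (scalars :: 'k ring) V" and x: "x \<in> carrier V" and y: "y \<in> carrier V"
  shows "(I +> x) <+> (I +> y) = I +> (x \<oplus> y)"
proof -
  interpret abelian_subgroup I V
    using submodule.axioms(1)[OF I] M.abelian_group_axioms
    by (intro abelian_subgroupI3 additive_subgroup.intro)
  show ?thesis
    using a_rcos_sum x y by blast
qed

lemma coset_zero:
  assumes I: "submodule I (scalars :: 'k ring) V"
  shows "I +> \<zero> = I"
  using M.a_coset_join2[OF M.zero_closed submodule.axioms(1)[OF I]]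
    subgroup.one_closed[OF submodule.axioms(1)[OF I]] by simp

text \<open>Operations on cosets are unions over representatives. If the value does not depend on
  the representative, all members of the union coincide, and there is at least one because
  \<open>x\<close> lies in its own coset.\<close>

lemma coset_UN:
  assumes I: "submodule I (scalars :: 'k ring) V" and x: "x \<in> carrier V"
    and g: "\<And>y. y \<in> carrier V \<Longrightarrow> I +> y = I +> x \<Longrightarrow> g y = g x"
  shows "(\<Union>y\<in>I +> x. g y) = g x"
proof -
  have "g y = g x" if "y \<in> I +> x" for y
    by (rule g) (use coset_memD[OF I x that] in simp_all)
  then have "(\<Union>y\<in>I +> x. g y) = (\<Union>y\<in>I +> x. g x)"
    by (rule SUP_cong[OF refl])
  then show ?thesis
    using coset_self[OF I x] by (simp add: UN_constant ex_in_conv[symmetric]) blast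
qed

lemma coset_UN2:
  assumes I: "submodule I (scalars :: 'k ring) V" and x: "x \<in> carrier V" and y: "y \<in> carrier V"
    and g: "\<And>x' y'. x' \<in> carrier V \<Longrightarrow> I +> x' = I +> x \<Longrightarrow> y' \<in> carrier V \<Longrightarrow> I +> y' = I +> y \<Longrightarrow>
      g x' y' = g x y"
  shows "(\<Union>x'\<in>I +> x. \<Union>y'\<in>I +> y. g x' y') = g x y"
proof -
  have inner: "(\<Union>y'\<in>I +> y. g x' y') = g x y" if x': "x' \<in> carrier V" "I +> x' = I +> x" for x'
  proof -
    have "g x' y' = g x' y" if "y' \<in> carrier V" "I +> y' = I +> y" for y'
      using g[OF x' that] g[OF x' y refl] by (rule trans[OF _ sym])
    then have "(\<Union>y'\<in>I +> y. g x' y') = g x' y"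
      by (rule coset_UN[OF I y])
    then show ?thesis
      using g[OF x' y refl] by (rule trans)
  qed
  have "(\<Union>x'\<in>I +> x. \<Union>y'\<in>I +> y. g x' y') = (\<Union>y'\<in>I +> y. g x y')"
    by (rule coset_UN[OF I x]) (use inner x in simp)
  then show ?thesis
    using inner[OF x refl] by (rule trans)
qed

lemma coset_smult:
  assumes I: "submodule I (scalars :: 'k ring) V" and x: "x \<in> carrier V"
  shows "coset_smult V I c (I +> x) = I +> (c \<odot> x)"
  unfolding coset_smult_def
proof (rule coset_UN[OF I x])
  fix y assume y: "y \<in> carrier V" "I +> y = I +> x"
  then have "c \<odot> (y \<ominus> x) \<in> I"
    using coset_eq_iff[OF I y(1) x] submodule.smult_closed[OF I] by simp
  then show "I +> (c \<odot> y) = I +> (c \<odot> x)"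
    using coset_eq_iff[OF I] x y by (simp add: smult_diff_right)
qed

lemma coset_norm_eq:
  assumes I: "submodule I (scalars :: 'k ring) V" and x: "x \<in> carrier V"
  shows "coset_norm V (I +> x) = (INF i\<in>I. nrm V (x \<oplus> i))"
proof -
  have "i \<oplus> x = x \<oplus> i" if "i \<in> I" for i
    using submoduleE(1)[OF I] x that by (intro M.a_comm) auto
  then have "I +> x = (\<lambda>i. x \<oplus> i) ` I"
    unfolding a_r_coset_def r_coset_def by (simp add: UNION_singleton_eq_range)
  then show ?thesis
    by (simp add: coset_norm_def image_image)
qed

lemma a_rcosets_eq: "a_rcosets I = (\<lambda>x. I +> x) ` carrier V"
  by (auto simp: A_RCOSETS_def RCOSETS_def a_r_coset_def)

end

lemma complexification_simps [simp]:
  fixes L (structure)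
  shows "carrier (complexification k L n) = carrier L \<times> carrier L"
    "(a, b) \<otimes>\<^bsub>complexification k L n\<^esub> (c, d) =
       ((a \<otimes> c \<ominus> b \<otimes> d) \<oplus> sqrt k \<odot> (bracket L a d \<oplus> bracket L b c),
        (a \<otimes> d \<oplus> b \<otimes> c) \<ominus> sqrt k \<odot> (bracket L a c \<ominus> bracket L b d))"
    "\<one>\<^bsub>complexification k L n\<^esub> = (\<one>, \<zero>)"
    "\<zero>\<^bsub>complexification k L n\<^esub> = (\<zero>, \<zero>)"
    "(a, b) \<oplus>\<^bsub>complexification k L n\<^esub> (c, d) = (a \<oplus> c, b \<oplus> d)"
    "z \<odot>\<^bsub>complexification k L n\<^esub> (a, b) =
       (Re z \<odot> a \<ominus> Im z \<odot> b, Re z \<odot> b \<oplus> Im z \<odot> a)"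
    "nrm (complexification k L n) = n"
    "star (complexification k L n) (a, b) = (a, \<ominus> b)"
  by (simp_all add: complexification_def plus_i_def)

text \<open>The estimate rests on
  \<open>B a b - B a' b' = B a (b - b') + B (a - a') b'\<close>.\<close>

lemma bounded_bilinear_continuous_map:
  fixes L (structure)
  assumes "banach_space L"
    and closed: "\<And>a b. a \<in> carrier L \<Longrightarrow> b \<in> carrier L \<Longrightarrow> B a b \<in> carrier L"
    and diff_left: "\<And>a b c. a \<in> carrier L \<Longrightarrow> b \<in> carrier L \<Longrightarrow> c \<in> carrier L \<Longrightarrow>
      B (a \<ominus> b) c = B a c \<ominus> B b c"
    and diff_right: "\<And>a b c. a \<in> carrier L \<Longrightarrow> b \<in> carrier L \<Longrightarrow> c \<in> carrier L \<Longrightarrow>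
      B a (b \<ominus> c) = B a b \<ominus> B a c"
    and C: "0 \<le> C" and bound: "\<And>a b. a \<in> carrier L \<Longrightarrow> b \<in> carrier L \<Longrightarrow>
      nrm L (B a b) \<le> C * nrm L a * nrm L b"
  shows "continuous_map (prod_topology (norm_topology L) (norm_topology L)) (norm_topology L)
    (\<lambda>(a, b). B a b)"
proof -
  interpret banach_space L by fact
  show ?thesis
    unfolding metric.continuous_map_to_metric
  proof (intro ballI allI impI)
    fix x and e :: real
    assume x: "x \<in> topspace (prod_topology (norm_topology L) (norm_topology L))" and e: "0 < e"
    obtain a b where ab: "x = (a, b)" "a \<in> carrier L" "b \<in> carrier L"
      using x by auto
    note na = norm_nonneg[OF ab(2)] and nb = norm_nonneg[OF ab(3)]
    \<comment> \<open>For \<open>d \<le> 1\<close> one has \<open>|b'| \<le> |b| + 1\<close>, so the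
      difference is at most \<open>C (|a| + |b| + 1) d\<close>. The last \<open>1\<close> makes the
      comparison with \<open>K d\<close> strict, also for \<open>C = 0\<close>.\<close>
    define K where "K = C * (nrm L a + nrm L b + 1) + 1"
    have K: "0 < K" "C * (nrm L a + nrm L b + 1) < K"
      using C na nb by (simp_all add: K_def add_nonneg_pos)
    define d where "d = min 1 (e / K)"
    have d: "0 < d" "d \<le> 1" "d * K \<le> e"
      using e K by (auto simp: d_def min_def field_simps)
    have "nrm L (B a b \<ominus> B a' b') < e"
      if a': "a' \<in> carrier L" "nrm L (a \<ominus> a') < d" and b': "b' \<in> carrier L" "nrm L (b \<ominus> b') < d"
      for a' b'
    proof -
      have nb': "nrm L b' \<le> nrm L b + 1"
        using norm_le_diff[of b' b] norm_diff_commute[of b b'] ab b' d by simp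
      have "nrm L (B a b \<ominus> B a' b') \<le> nrm L (B a b \<ominus> B a b') + nrm L (B a b' \<ominus> B a' b')"
        using ab a' b' closed by (intro norm_diff_triangle)
      also have "\<dots> = nrm L (B a (b \<ominus> b')) + nrm L (B (a \<ominus> a') b')"
        using ab a' b' by (simp add: diff_left diff_right)
      also have "\<dots> \<le> C * nrm L a * nrm L (b \<ominus> b') + C * nrm L (a \<ominus> a') * nrm L b'"
        using ab a' b' by (intro add_mono bound) auto
      also have "\<dots> \<le> C * nrm L a * d + C * d * (nrm L b + 1)"
        using a' b' ab C na nb nb' d norm_nonneg[of b'] norm_nonneg[of "a \<ominus> a'"] norm_nonneg[of "b \<ominus> b'"]
        by (intro add_mono mult_mono mult_nonneg_nonneg) auto
      also have "\<dots> = C * (nrm L a + nrm L b + 1) * d"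
        by (simp add: algebra_simps)
      also have "\<dots> < K * d"
        using K d by (intro mult_strict_right_mono)
      finally show ?thesis
        using d by (simp add: mult.commute)
    qed
    then have "\<forall>y\<in>metric.mball a d \<times> metric.mball b d. (\<lambda>(a, b). B a b) y \<in>
        metric.mball ((\<lambda>(a, b). B a b) x) e"
      using ab closed by auto
    moreover have "openin (prod_topology (norm_topology L) (norm_topology L))
        (metric.mball a d \<times> metric.mball b d)"
      by (simp add: openin_prod_Times_iff metric.openin_mball)
    ultimately show "\<exists>U. openin (prod_topology (norm_topology L) (norm_topology L)) U \<and> x \<in> U \<and>
        (\<forall>y\<in>U. (\<lambda>(a, b). B a b) y \<in> metric.mball ((\<lambda>(a, b). B a b) x) e)"
      using ab d by (intro exI[of _ "metric.mball a d \<times> metric.mball b d"]) auto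
  qed
qed

section \<open>Arithmetic in Lie--Jordan algebras\<close>

context lie_jordan_algebra
begin

text \<open>The primed rules are counterparts of \<open>normed_space\<close> facts in a locale
  without norm axioms; the primes keep them apart where both locales are joined.\<close>

lemma smult_mem' [simp]: "x \<in> carrier L \<Longrightarrow> c \<odot> x \<in> carrier L"
  using smult_closed[of c x] by simp

lemma minus_eq_smult': "x \<in> carrier L \<Longrightarrow> \<ominus> x = (- 1) \<odot> x"
  using smult_l_minus[of 1 x] smult_one[of x] by simp

lemma diff_eq_smult': "x \<in> carrier L \<Longrightarrow> y \<in> carrier L \<Longrightarrow> x \<ominus> y = x \<oplus> (- 1) \<odot> y"
  by (simp add: a_minus_def minus_eq_smult')

lemma smult_add_right':
  "x \<in> carrier L \<Longrightarrow> y \<in> carrier L \<Longrightarrow> c \<odot> (x \<oplus> y) = c \<odot> x \<oplus> c \<odot> y"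
  using smult_r_distr[of c x y] by simp

lemma smult_smult': "x \<in> carrier L \<Longrightarrow> a \<odot> (b \<odot> x) = (a * b) \<odot> x"
  using smult_assoc1[of a b x] by simp

declare jordan_closed [simp] bracket_closed [simp]

lemma jordan_add_right:
  "a \<in> carrier L \<Longrightarrow> b \<in> carrier L \<Longrightarrow> c \<in> carrier L \<Longrightarrow> c \<otimes> (a \<oplus> b) = c \<otimes> a \<oplus> c \<otimes> b"
  by (simp add: jordan_comm[of c] jordan_add)

lemma jordan_smult_right:
  "a \<in> carrier L \<Longrightarrow> b \<in> carrier L \<Longrightarrow> a \<otimes> (t \<odot> b) = t \<odot> (a \<otimes> b)"
  by (simp add: jordan_comm[of a] jordan_smult)

lemma jordan_diff_left:
  "a \<in> carrier L \<Longrightarrow> b \<in> carrier L \<Longrightarrow> c \<in> carrier L \<Longrightarrow> (a \<ominus> b) \<otimes> c = a \<otimes> c \<ominus> b \<otimes> c"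
  by (simp add: diff_eq_smult' jordan_add jordan_smult)

lemma jordan_diff_right:
  "a \<in> carrier L \<Longrightarrow> b \<in> carrier L \<Longrightarrow> c \<in> carrier L \<Longrightarrow> c \<otimes> (a \<ominus> b) = c \<otimes> a \<ominus> c \<otimes> b"
  by (simp add: diff_eq_smult' jordan_add_right jordan_smult_right)

lemma jordan_zero [simp]:
  "a \<in> carrier L \<Longrightarrow> \<zero> \<otimes> a = \<zero>" "a \<in> carrier L \<Longrightarrow> a \<otimes> \<zero> = \<zero>"
  using jordan_smult[of a a 0] jordan_smult_right[of a a 0] smult_l_null[of a] smult_l_null[of "a \<otimes> a"]
  by simp_all

lemma bracket_skew': "a \<in> carrier L \<Longrightarrow> b \<in> carrier L \<Longrightarrow> bracket L a b = (- 1) \<odot> bracket L b a"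
  using bracket_skew[of a b] by (simp add: minus_eq_smult')

lemma bracket_add_right: "a \<in> carrier L \<Longrightarrow> b \<in> carrier L \<Longrightarrow> c \<in> carrier L \<Longrightarrow>
    bracket L c (a \<oplus> b) = bracket L c a \<oplus> bracket L c b"
  by (simp add: bracket_skew'[of c] bracket_add smult_add_right')

lemma bracket_smult_right: "a \<in> carrier L \<Longrightarrow> b \<in> carrier L \<Longrightarrow>
    bracket L a (t \<odot> b) = t \<odot> bracket L a b"
  by (simp add: bracket_skew'[of a] bracket_smult smult_smult' mult.commute)

lemma bracket_diff_left: "a \<in> carrier L \<Longrightarrow> b \<in> carrier L \<Longrightarrow> c \<in> carrier L \<Longrightarrow>
    bracket L (a \<ominus> b) c = bracket L a c \<ominus> bracket L b c"
  by (simp add: diff_eq_smult' bracket_add bracket_smult)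

lemma bracket_diff_right: "a \<in> carrier L \<Longrightarrow> b \<in> carrier L \<Longrightarrow> c \<in> carrier L \<Longrightarrow>
    bracket L c (a \<ominus> b) = bracket L c a \<ominus> bracket L c b"
  by (simp add: diff_eq_smult' bracket_add_right bracket_smult_right)

lemma bracket_zero [simp]:
  "a \<in> carrier L \<Longrightarrow> bracket L \<zero> a = \<zero>" "a \<in> carrier L \<Longrightarrow> bracket L a \<zero> = \<zero>"
  using bracket_smult[of a a 0] bracket_smult_right[of a a 0] smult_l_null[of a]
    smult_l_null[of "bracket L a a"]
  by simp_all

lemma bracket_self [simp]:
  assumes a: "a \<in> carrier L"
  shows "bracket L a a = \<zero>"
proof -
  define x where "x = bracket L a a"
  have x: "x \<in> carrier L"
    using a by (simp add: x_def)
  have "x \<oplus> x = x \<oplus> \<ominus> x"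
    using bracket_skew[OF a a] by (simp add: x_def)
  then have "x \<oplus> x = \<zero>"
    using x by (simp add: M.r_neg)
  moreover have "(1/2) \<odot> (x \<oplus> x) = x"
    using x smult_l_distr[of "1/2" "1/2" x] smult_one[of x] by (simp add: smult_add_right')
  ultimately show ?thesis
    using smult_r_null[of "1/2 :: real"] by (simp add: x_def)
qed

text \<open>The map \<open>[a, _]\<close> is a derivation of the Jordan product, and a derivation
  kills the unit: \<open>[a, 1] = [a, 1 \<otimes> 1] = 2 [a, 1]\<close>.\<close>

lemma bracket_unit:
  assumes one: "\<one> \<in> carrier L" and unit: "\<And>x. x \<in> carrier L \<Longrightarrow> \<one> \<otimes> x = x" and a: "a \<in> carrier L"
  shows "bracket L a \<one> = \<zero>"
proof -
  define x where "x = bracket L a \<one>"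
  have x: "x \<in> carrier L"
    using a one by (simp add: x_def)
  have "x = x \<otimes> \<one> \<oplus> \<one> \<otimes> x"
    using leibniz[OF a one one] one by (simp add: x_def unit)
  then have "x = x \<oplus> x"
    using x one by (simp add: jordan_comm[of x] unit)
  then show ?thesis
    using x by (simp add: x_def)
qed

end

text \<open>The norm conditions are those of the C*-norm on the complexification. The locale is
  entered twice: by the given algebra, and by the reduced algebra, whose LJB axioms are then derived
  by the theorem \<open>unital_LJB_algebra\<close> below.\<close>

locale lie_jordan_cstar =
  lie_jordan_algebra k L + banach_space L
  for k :: real and L :: "('a, 'm) lie_jordan_scheme" (structure) +
  fixes n :: "'a \<times> 'a \<Rightarrow> real"
  assumes one_closed: "\<one> \<in> carrier L"
    and unit: "a \<in> carrier L \<Longrightarrow> \<one> \<otimes> a = a"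
    and cstar_norm: "associated_cstar_norm k L n"
begin

sublocale C: unital_cstar_algebra "complexification k L n"
  using cstar_norm by (simp add: associated_cstar_norm_def)

lemma n_real: "a \<in> carrier L \<Longrightarrow> n (a, \<zero>) = nrm L a"
  using cstar_norm by (simp add: associated_cstar_norm_def)

text \<open>Twice the real part is \<open>x + star x\<close>, and the involution is
  isometric.\<close>

lemma norm_Re_le:
  assumes "a \<in> carrier L" "b \<in> carrier L"
  shows "nrm L a \<le> n (a, b)"
proof -
  have "(a, b) \<oplus>\<^bsub>complexification k L n\<^esub> star (complexification k L n) (a, b) = (a \<oplus> a, \<zero>)"
    using assms by (simp add: M.r_neg)
  then have "n (a \<oplus> a, \<zero>) \<le> n (a, b) + n (a, b)"
    using C.norm_triangle[of "(a, b)" "star (complexification k L n) (a, b)"] C.norm_star[of "(a, b)"]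
      assms by simp
  moreover have "nrm L (a \<oplus> a) = 2 * nrm L a"
    using norm_smult[of a 2] smult_add_left[of a 1 1] assms by simp
  ultimately show ?thesis
    using assms by (simp add: n_real)
qed

text \<open>Multiplication by \<open>-i\<close> is isometric and turns the imaginary part into the
  real part.\<close>

lemma norm_Im_le:
  assumes "a \<in> carrier L" "b \<in> carrier L"
  shows "nrm L b \<le> n (a, b)"
proof -
  have "(- \<i>) \<odot>\<^bsub>complexification k L n\<^esub> (a, b) = (b, (- 1) \<odot> a)"
    using assms by (simp add: diff_eq_smult)
  then have "n (b, (- 1) \<odot> a) = n (a, b)"
    using C.norm_smult[of "(a, b)" "- \<i>"] assms by simp
  then show ?thesis
    using norm_Re_le[of b "(- 1) \<odot> a"] assms by simp
qed

lemma mult_real: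
  assumes "a \<in> carrier L" "b \<in> carrier L"
  shows "(a, \<zero>) \<otimes>\<^bsub>complexification k L n\<^esub> (b, \<zero>) = (a \<otimes> b, (- sqrt k) \<odot> bracket L a b)"
  using assms by (simp add: diff_eq_smult)

lemma norm_mult_real_le:
  assumes "a \<in> carrier L" "b \<in> carrier L"
  shows "n (a \<otimes> b, (- sqrt k) \<odot> bracket L a b) \<le> nrm L a * nrm L b"
  using C.norm_mult_le[of "(a, \<zero>)" "(b, \<zero>)"] assms by (simp add: mult_real n_real del: complexification_simps(2))

text \<open>Up to sign, \<open>sqrt k [a, b]\<close> is the imaginary part of the associative
  product of \<open>a\<close> and \<open>b\<close>. This quantitative form of continuity is what
  makes the normalizer closed and the reduced bracket continuous.\<close>

lemma norm_bracket_le: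
  assumes "a \<in> carrier L" "b \<in> carrier L"
  shows "nrm L (bracket L a b) \<le> (1 / sqrt k) * nrm L a * nrm L b"
proof -
  have "nrm L ((- sqrt k) \<odot> bracket L a b) \<le> nrm L a * nrm L b"
    using norm_Im_le[of "a \<otimes> b" "(- sqrt k) \<odot> bracket L a b"] norm_mult_real_le[OF assms] assms
    by simp
  then show ?thesis
    using k_pos assms by (simp add: norm_smult field_simps)
qed

text \<open>The Jordan product is the real part of the associative product, which bounds its norm.
  Because \<open>[a, a] = 0\<close>, Jordan squares are associative squares of self-adjoint
  elements, so the remaining norm axioms are statements about squares in the C*-algebra.\<close>

theorem unital_LJB_algebra: "unital_LJB_algebra k L"
proof (intro unital_LJB_algebra.intro unital_LJB_algebra_axioms.intro)
  show "lie_jordan_algebra k L" "banach_space L"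
    by unfold_locales
  show "\<one> \<in> carrier L"
    by (rule one_closed)
  show "\<one> \<otimes> a = a" if "a \<in> carrier L" for a
    using that by (rule unit)
  fix a b assume a: "a \<in> carrier L" and b: "b \<in> carrier L"
  show "nrm L (a \<otimes> b) \<le> nrm L a * nrm L b"
    using norm_Re_le[of "a \<otimes> b" "(- sqrt k) \<odot> bracket L a b"] norm_mult_real_le[OF a b] a b by simp
  have square: "(x, \<zero>) \<otimes>\<^bsub>complexification k L n\<^esub> (x, \<zero>) = (x \<otimes> x, \<zero>)" if "x \<in> carrier L" for x
    using that mult_real[of x x] by simp
  have real: "star (complexification k L n) (x, \<zero>) = (x, \<zero>)" for x
    by (simp add: minus_eq_smult)
  have "n ((a, \<zero>) \<otimes>\<^bsub>complexification k L n\<^esub> (a, \<zero>)) \<le>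
      n ((a, \<zero>) \<otimes>\<^bsub>complexification k L n\<^esub> (a, \<zero>) \<oplus>\<^bsub>complexification k L n\<^esub>
        (b, \<zero>) \<otimes>\<^bsub>complexification k L n\<^esub> (b, \<zero>))"
    using C.norm_square_le_sum_squares[of "(a, \<zero>)" "(b, \<zero>)"] real a b by simp
  then show "nrm L (a \<otimes> a) \<le> nrm L (a \<otimes> a \<oplus> b \<otimes> b)"
    using a b by (simp add: square n_real del: complexification_simps(2))
  have "n ((a, \<zero>) \<otimes>\<^bsub>complexification k L n\<^esub> (a, \<zero>)) = (n (a, \<zero>))\<^sup>2"
    using C.cstar_identity[of "(a, \<zero>)"] a unfolding real by simp
  then show "nrm L (a \<otimes> a) = (nrm L a)\<^sup>2"
    using a by (simp add: square n_real del: complexification_simps(2))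
next
  show "continuous_map (prod_topology (norm_topology L) (norm_topology L)) (norm_topology L)
      (\<lambda>(a, b). bracket L a b)"
    using k_pos
    by (intro bounded_bilinear_continuous_map[where C = "1 / sqrt k"])
      (simp_all add: banach_space_axioms bracket_diff_left bracket_diff_right norm_bracket_le[simplified])
qed

end

lemma (in banach_quotient) p_minus: "x \<in> carrier V \<Longrightarrow> p (\<ominus> x) = \<ominus>\<^bsub>W\<^esub> p x"
  by (simp add: minus_eq_smult normed_space.minus_eq_smult[OF normed_space_W] p_closed p_smult)

lemma (in normed_space) closedin_submodule:
  assumes B: "submodule B (scalars :: 'k ring) V" and S: "closedin (norm_topology V) S" "S \<subseteq> B"
  shows "closedin (norm_topology (V\<lparr>carrier := B\<rparr>)) S"
proof -
  have "\<exists>s\<in>S. nrm V (x \<ominus> s) < e"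
    if "x \<in> B" "\<exists>s\<in>S. nrm V (x \<ominus>\<^bsub>V\<lparr>carrier := B\<rparr>\<^esub> s) < e" for x and e :: real
    using that S(2) diff_submodule[OF B] by (metis subsetD)
  moreover have "x \<in> carrier V" if "x \<in> B" for x
    using submoduleE(1)[OF B] that by blast
  ultimately show ?thesis
    using S unfolding closedin_norm_iff normed_space.closedin_norm_iff[OF normed_space_submodule[OF B]]
    by simp
qed

text \<open>Apart from the sign of \<open>k\<close>, the axioms are closure properties and
  identities, and these survive under a surjection compatible with the operations. The rules in
  \<open>p\<close> are used from right to left, to collect each side into a single image.\<close>

lemma lie_jordan_algebra_quotient:
  fixes V :: "('a, 'm) lie_jordan_scheme" (structure) and W :: "('b, 'n) lie_jordan_scheme"
  assumes V: "lie_jordan_algebra k V" and Q: "banach_quotient V I W p"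
    and p_mult: "\<And>x y. x \<in> carrier V \<Longrightarrow> y \<in> carrier V \<Longrightarrow> p (x \<otimes> y) = p x \<otimes>\<^bsub>W\<^esub> p y"
    and p_bracket: "\<And>x y. x \<in> carrier V \<Longrightarrow> y \<in> carrier V \<Longrightarrow>
      p (bracket V x y) = bracket W (p x) (p y)"
  shows "lie_jordan_algebra k W"
proof -
  interpret V: lie_jordan_algebra k V by fact
  interpret Q: banach_quotient V I W p by fact
  interpret W: normed_space W
    by (rule Q.normed_space_W)
  note p = Q.p_add Q.p_smult Q.p_zero Q.p_diff Q.p_minus p_mult p_bracket
  show ?thesis
  proof (intro lie_jordan_algebra.intro lie_jordan_algebra_axioms.intro)
    show "Module.module scalars W"
      by (rule W.module_axioms)
    show "0 < k"
      by (rule V.k_pos)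
    fix A assume "A \<in> carrier W"
    then obtain a where a: "a \<in> carrier V" "A = p a"
      by (rule Q.W_cases)
    fix B assume "B \<in> carrier W"
    then obtain b where b: "b \<in> carrier V" "B = p b"
      by (rule Q.W_cases)
    show "A \<otimes>\<^bsub>W\<^esub> B \<in> carrier W" "bracket W A B \<in> carrier W"
      using a b by (simp_all add: Q.p_closed flip: p)
    show "A \<otimes>\<^bsub>W\<^esub> B = B \<otimes>\<^bsub>W\<^esub> A"
      using a b V.jordan_comm[of a b] by (simp flip: p)
    show "(t \<odot>\<^bsub>W\<^esub> A) \<otimes>\<^bsub>W\<^esub> B = t \<odot>\<^bsub>W\<^esub> (A \<otimes>\<^bsub>W\<^esub> B)"
      "bracket W (t \<odot>\<^bsub>W\<^esub> A) B = t \<odot>\<^bsub>W\<^esub> bracket W A B" for t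
      using a b by (simp_all add: V.jordan_smult V.bracket_smult flip: p)
    show "((A \<otimes>\<^bsub>W\<^esub> A) \<otimes>\<^bsub>W\<^esub> B) \<otimes>\<^bsub>W\<^esub> A = (A \<otimes>\<^bsub>W\<^esub> A) \<otimes>\<^bsub>W\<^esub> (B \<otimes>\<^bsub>W\<^esub> A)"
      using a b V.jordan_identity[of a b] by (simp flip: p)
    show "bracket W A B = \<ominus>\<^bsub>W\<^esub> bracket W B A"
      using a b V.bracket_skew[of a b] by (simp flip: p)
    fix C assume "C \<in> carrier W"
    then obtain c where c: "c \<in> carrier V" "C = p c"
      by (rule Q.W_cases)
    show "(A \<oplus>\<^bsub>W\<^esub> B) \<otimes>\<^bsub>W\<^esub> C = A \<otimes>\<^bsub>W\<^esub> C \<oplus>\<^bsub>W\<^esub> B \<otimes>\<^bsub>W\<^esub> C"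
      "bracket W (A \<oplus>\<^bsub>W\<^esub> B) C = bracket W A C \<oplus>\<^bsub>W\<^esub> bracket W B C"
      using a b c by (simp_all add: V.jordan_add V.bracket_add flip: p)
    show "bracket W A (bracket W B C) \<oplus>\<^bsub>W\<^esub> bracket W B (bracket W C A) \<oplus>\<^bsub>W\<^esub>
        bracket W C (bracket W A B) = \<zero>\<^bsub>W\<^esub>"
      using a b c V.jacobi[of a b c] by (simp flip: p)
    show "bracket W A (B \<otimes>\<^bsub>W\<^esub> C) = bracket W A B \<otimes>\<^bsub>W\<^esub> C \<oplus>\<^bsub>W\<^esub> B \<otimes>\<^bsub>W\<^esub> bracket W A C"
      using a b c V.leibniz[of a b c] by (simp flip: p)
    show "(A \<otimes>\<^bsub>W\<^esub> B) \<otimes>\<^bsub>W\<^esub> C \<ominus>\<^bsub>W\<^esub> A \<otimes>\<^bsub>W\<^esub> (B \<otimes>\<^bsub>W\<^esub> C) =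
        k \<odot>\<^bsub>W\<^esub> bracket W B (bracket W C A)"
      using a b c V.associator[of a b c] by (simp flip: p)
  qed
qed

section \<open>Real subspaces and their complexifications\<close>

context lie_jordan_cstar
begin

abbreviation "F \<equiv> complexification k L n"

lemma lie_jordan_subalgebra:
  assumes B: "submodule B (scalars :: real ring) L"
    and "\<And>x y. x \<in> B \<Longrightarrow> y \<in> B \<Longrightarrow> x \<otimes> y \<in> B"
    and "\<And>x y. x \<in> B \<Longrightarrow> y \<in> B \<Longrightarrow> bracket L x y \<in> B"
  shows "lie_jordan_algebra k (L\<lparr>carrier := B\<rparr>)"
proof -
  have sub: "x \<in> carrier L" if "x \<in> B" for x
    using submoduleE(1)[OF B] that by blast
  interpret S: Module.module "scalars :: real ring" "L\<lparr>carrier := B\<rparr>"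
    using submodule.submodule_is_module[OF B] module_axioms by blast
  show ?thesis
  proof (intro lie_jordan_algebra.intro lie_jordan_algebra_axioms.intro)
    fix a b assume ab: "a \<in> carrier (L\<lparr>carrier := B\<rparr>)" "b \<in> carrier (L\<lparr>carrier := B\<rparr>)"
    then show "bracket (L\<lparr>carrier := B\<rparr>) a b = \<ominus>\<^bsub>L\<lparr>carrier := B\<rparr>\<^esub> bracket (L\<lparr>carrier := B\<rparr>) b a"
      using assms bracket_skew[of a b] by (simp add: minus_submodule[OF B] sub)
    show "a \<otimes>\<^bsub>L\<lparr>carrier := B\<rparr>\<^esub> b = b \<otimes>\<^bsub>L\<lparr>carrier := B\<rparr>\<^esub> a"
      using ab jordan_comm[of a b] sub by simp
    fix c assume "c \<in> carrier (L\<lparr>carrier := B\<rparr>)"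
    then show "(a \<otimes>\<^bsub>L\<lparr>carrier := B\<rparr>\<^esub> b) \<otimes>\<^bsub>L\<lparr>carrier := B\<rparr>\<^esub> c \<ominus>\<^bsub>L\<lparr>carrier := B\<rparr>\<^esub>
        a \<otimes>\<^bsub>L\<lparr>carrier := B\<rparr>\<^esub> (b \<otimes>\<^bsub>L\<lparr>carrier := B\<rparr>\<^esub> c) =
        k \<odot>\<^bsub>L\<lparr>carrier := B\<rparr>\<^esub> bracket (L\<lparr>carrier := B\<rparr>) b (bracket (L\<lparr>carrier := B\<rparr>) c a)"
      using ab assms associator[of a b c] by (simp add: diff_submodule[OF B] sub)
  qed (use assms sub S.module_axioms in \<open>simp_all add: k_pos jordan_add jordan_smult
      jordan_identity bracket_add bracket_smult jacobi leibniz\<close>)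
qed

lemma complexification_diff:
  "a \<in> carrier L \<Longrightarrow> b \<in> carrier L \<Longrightarrow> c \<in> carrier L \<Longrightarrow> d \<in> carrier L \<Longrightarrow>
    (a, b) \<ominus>\<^bsub>F\<^esub> (c, d) = (a \<ominus> c, b \<ominus> d)"
  by (simp add: C.diff_eq_smult diff_eq_smult)

lemma submodule_plus_i:
  assumes S: "submodule S (scalars :: real ring) L"
  shows "submodule (plus_i S) (scalars :: complex ring) F"
proof (rule C.submoduleI_smult)
  note S' = submoduleE[OF S]
  have sub: "x \<in> carrier L" if "x \<in> S" for x
    using S'(1) that by blast
  show "plus_i S \<subseteq> carrier F"
    using S'(1) by (auto simp: plus_i_def)
  show "\<zero>\<^bsub>F\<^esub> \<in> plus_i S"
    using subgroup.one_closed[OF submodule.axioms(1)[OF S]] by (simp add: plus_i_def)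
  show "x \<oplus>\<^bsub>F\<^esub> y \<in> plus_i S" if "x \<in> plus_i S" "y \<in> plus_i S" for x y
    using that S'(5) by (auto simp: plus_i_def)
  show "c \<odot>\<^bsub>F\<^esub> x \<in> plus_i S" if "x \<in> plus_i S" for c x
    using that S'(4,5) by (auto simp: plus_i_def diff_eq_smult sub)
qed

text \<open>Real and imaginary part do not increase the norm, so an approximation in the
  complexification approximates each component.\<close>

lemma closedin_plus_i:
  assumes S: "closedin (norm_topology L) S"
  shows "closedin (norm_topology F) (plus_i S)"
  unfolding C.closedin_norm_iff
proof (intro conjI ballI impI)
  have sub: "x \<in> carrier L" if "x \<in> S" for x
    using S that by (auto simp: closedin_norm_iff)
  then show "plus_i S \<subseteq> carrier F"
    by (auto simp: plus_i_def)
  fix x assume "x \<in> carrier F" and lim: "\<forall>e>0. \<exists>s\<in>plus_i S. nrm F (x \<ominus>\<^bsub>F\<^esub> s) < e"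
  then obtain a b where x: "x = (a, b)" "a \<in> carrier L" "b \<in> carrier L"
    by auto
  have "\<exists>s\<in>S. nrm L (a \<ominus> s) < e" "\<exists>s\<in>S. nrm L (b \<ominus> s) < e" if e: "0 < e" for e
  proof -
    obtain c d where cd: "c \<in> S" "d \<in> S" "n (x \<ominus>\<^bsub>F\<^esub> (c, d)) < e"
      using lim e by (auto simp: plus_i_def)
    then have "n (a \<ominus> c, b \<ominus> d) < e"
      using x sub by (simp add: complexification_diff)
    then have "nrm L (a \<ominus> c) < e" "nrm L (b \<ominus> d) < e"
      using norm_Re_le[of "a \<ominus> c" "b \<ominus> d"] norm_Im_le[of "a \<ominus> c" "b \<ominus> d"] x cd sub by auto
    then show "\<exists>s\<in>S. nrm L (a \<ominus> s) < e" "\<exists>s\<in>S. nrm L (b \<ominus> s) < e"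
      using cd by auto
  qed
  then have "a \<in> S" "b \<in> S"
    using S x unfolding closedin_norm_iff by blast+
  then show "x \<in> plus_i S"
    by (simp add: x plus_i_def)
qed

text \<open>Cosets of \<open>S + iS\<close> are rectangles whose sides are cosets of
  \<open>S\<close>. This is the natural identification of the theorem in its concrete form.\<close>

lemma coset_plus_i:
  "plus_i S +>\<^bsub>F\<^esub> (a, b) = (S +> a) \<times> (S +> b)"
  by (auto simp: a_r_coset_def r_coset_def plus_i_def)

end

section \<open>The reduced algebra\<close>

locale jordan_reduction = lie_jordan_cstar k L n
  for k :: real and L :: "('a, 'm) lie_jordan_scheme" (structure) and n +
  fixes J :: "'a set"
  assumes jordan_ideal: "jordan_ideal L J" and closed_J: "closedin (norm_topology L) J"
begin

abbreviation "N \<equiv> normalizer_of L J"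
abbreviation "K \<equiv> N \<inter> J"
abbreviation "LN \<equiv> L\<lparr>carrier := N\<rparr>"
abbreviation "FN \<equiv> F\<lparr>carrier := plus_i N\<rparr>"
abbreviation "Lred \<equiv> reduced_algebra L J"

text \<open>The quotient C*-norm written on pairs of cosets: the rectangle spanned by
  \<open>K + a\<close> and \<open>K + b\<close> is the coset of \<open>(a, b)\<close> modulo
  \<open>plus_i K\<close>.\<close>

definition nred :: "'a set \<times> 'a set \<Rightarrow> real" where
  "nred X = (INF x\<in>fst X \<times> snd X. n x)"

abbreviation "Fred \<equiv> complexification k Lred nred"

lemma submodule_J: "submodule J (scalars :: real ring) L"
  using jordan_ideal by (simp add: jordan_ideal_def)

lemma J_mem [simp]: "j \<in> J \<Longrightarrow> j \<in> carrier L"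
  using submoduleE(1)[OF submodule_J] by blast

lemma J_closed [simp]:
  "i \<in> J \<Longrightarrow> j \<in> J \<Longrightarrow> i \<oplus> j \<in> J" "j \<in> J \<Longrightarrow> c \<odot> j \<in> J" "\<zero> \<in> J"
  using submoduleE(4,5)[OF submodule_J] subgroup.one_closed[OF submodule.axioms(1)[OF submodule_J]]
  by simp_all

lemma J_jordan [simp]:
  "a \<in> carrier L \<Longrightarrow> j \<in> J \<Longrightarrow> a \<otimes> j \<in> J" "a \<in> carrier L \<Longrightarrow> j \<in> J \<Longrightarrow> j \<otimes> a \<in> J"
  using jordan_ideal jordan_comm[of j a] by (simp_all add: jordan_ideal_def)

lemma N_mem [simp]: "a \<in> N \<Longrightarrow> a \<in> carrier L"
  by (simp add: normalizer_of_def)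

lemma bracket_N_J [simp]: "a \<in> N \<Longrightarrow> j \<in> J \<Longrightarrow> bracket L a j \<in> J"
  unfolding normalizer_of_def by blast

lemma bracket_J_N [simp]: "a \<in> N \<Longrightarrow> j \<in> J \<Longrightarrow> bracket L j a \<in> J"
  using bracket_skew'[of j a] by simp

lemma NI: "a \<in> carrier L \<Longrightarrow> (\<And>j. j \<in> J \<Longrightarrow> bracket L a j \<in> J) \<Longrightarrow> a \<in> N"
  unfolding normalizer_of_def by blast

lemma N_add [simp]: "a \<in> N \<Longrightarrow> b \<in> N \<Longrightarrow> a \<oplus> b \<in> N"
  by (rule NI) (simp_all add: bracket_add)

lemma N_smult [simp]: "a \<in> N \<Longrightarrow> c \<odot> a \<in> N"
  by (rule NI) (simp_all add: bracket_smult)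

lemma N_zero [simp]: "\<zero> \<in> N"
  by (rule NI) simp_all

lemma N_one [simp]: "\<one> \<in> N"
proof (rule NI)
  show "bracket L \<one> j \<in> J" if "j \<in> J" for j
    using that bracket_skew'[of \<one> j] bracket_unit[OF one_closed unit, of j] one_closed by simp
qed (rule one_closed)

text \<open>By Leibniz, \<open>[j, a \<otimes> b]\<close> is a sum of Jordan products, each with one
  factor in \<open>J\<close>.\<close>

lemma N_jordan [simp]:
  assumes "a \<in> N" "b \<in> N"
  shows "a \<otimes> b \<in> N"
proof (rule NI)
  fix j assume j: "j \<in> J"
  have "bracket L j (a \<otimes> b) = bracket L j a \<otimes> b \<oplus> a \<otimes> bracket L j b"
    using j assms by (intro leibniz) simp_all
  also have "\<dots> \<in> J"
    using j assms by simp
  finally show "bracket L (a \<otimes> b) j \<in> J"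
    using bracket_skew'[of "a \<otimes> b" j] assms j by simp
qed (use assms in simp)

text \<open>The usual argument that a normalizer is a Lie subalgebra: the Jacobi identity writes
  \<open>[[a, b], j]\<close> through \<open>[a, [b, j]]\<close> and
  \<open>[b, [j, a]]\<close>.\<close>

lemma N_bracket [simp]:
  assumes "a \<in> N" "b \<in> N"
  shows "bracket L a b \<in> N"
proof (rule NI)
  fix j assume j: "j \<in> J"
  have "(bracket L a (bracket L b j) \<oplus> bracket L b (bracket L j a)) \<oplus> bracket L j (bracket L a b) = \<zero>"
    using j assms by (intro jacobi) simp_all
  then have "\<ominus> bracket L j (bracket L a b) = bracket L a (bracket L b j) \<oplus> bracket L b (bracket L j a)"
    using j assms by (intro M.minus_equality) simp_all
  also have "\<dots> \<in> J"
    using j assms by simp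
  finally show "bracket L (bracket L a b) j \<in> J"
    using bracket_skew[of "bracket L a b" j] assms j by simp
qed (use assms in simp)

lemma submodule_N: "submodule N (scalars :: real ring) L"
  by (rule submoduleI_smult) auto

text \<open>For fixed \<open>j\<close> the map \<open>a \<mapsto> [a, j]\<close> is Lipschitz with
  constant \<open>|j| / sqrt k\<close>, and \<open>N\<close> is the intersection of the preimages of
  the closed set \<open>J\<close> under these maps.\<close>

lemma closed_N: "closedin (norm_topology L) N"
  unfolding closedin_norm_iff
proof (intro conjI ballI impI)
  show "N \<subseteq> carrier L"
    by auto
  fix a assume a: "a \<in> carrier L" and lim: "\<forall>e>0. \<exists>s\<in>N. nrm L (a \<ominus> s) < e"
  show "a \<in> N"
  proof (rule NI[OF a])
    fix j assume j: "j \<in> J"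
    define c where "c = (1 / sqrt k) * nrm L j"
    have c: "0 \<le> c"
      using k_pos norm_nonneg[of j] j by (simp add: c_def)
    have "\<exists>i\<in>J. nrm L (bracket L a j \<ominus> i) < e" if e: "0 < e" for e
    proof -
      have "0 < e / (c + 1)"
        using c e by simp
      then obtain s where s: "s \<in> N" "nrm L (a \<ominus> s) < e / (c + 1)"
        using lim by blast
      have "nrm L (bracket L a j \<ominus> bracket L s j) = nrm L (bracket L (a \<ominus> s) j)"
        using a j s by (simp add: bracket_diff_left)
      also have "\<dots> \<le> c * nrm L (a \<ominus> s)"
        using norm_bracket_le[of "a \<ominus> s" j] a j s by (simp add: c_def mult.commute)
      also have "\<dots> \<le> c * (e / (c + 1))"
        using s c by (intro mult_left_mono) auto
      also have "\<dots> < e"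
        using c e by (simp add: field_simps)
      finally show ?thesis
        using s j by (intro bexI[of _ "bracket L s j"]) simp_all
    qed
    then show "bracket L a j \<in> J"
      using closed_J a j unfolding closedin_norm_iff by (metis J_mem bracket_closed)
  qed
qed

lemma submodule_K: "submodule K (scalars :: real ring) L"
  by (rule submoduleI_smult) auto

lemma closed_K: "closedin (norm_topology L) K"
  using closed_N closed_J by (rule closedin_Int)

sublocale LN: banach_space LN
  by (rule banach_space_closed_submodule[OF submodule_N closed_N])

sublocale FN: unital_cstar_algebra FN
proof (rule C.unital_cstar_algebra_closed_subalgebra[OF submodule_plus_i[OF submodule_N]
      closedin_plus_i[OF closed_N]])
  show "\<one>\<^bsub>F\<^esub> \<in> plus_i N"
    by (simp add: plus_i_def)
  show "x \<otimes>\<^bsub>F\<^esub> y \<in> plus_i N" if "x \<in> plus_i N" "y \<in> plus_i N" for x y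
    using that by (auto simp: plus_i_def diff_eq_smult)
  show "star F x \<in> plus_i N" if "x \<in> plus_i N" for x
    using that by (auto simp: plus_i_def minus_eq_smult)
qed

lemma LN_diff: "a \<in> N \<Longrightarrow> b \<in> N \<Longrightarrow> a \<ominus>\<^bsub>LN\<^esub> b = a \<ominus> b"
  by (rule diff_submodule[OF submodule_N])

lemma FN_diff:
  "a \<in> N \<Longrightarrow> b \<in> N \<Longrightarrow> c \<in> N \<Longrightarrow> d \<in> N \<Longrightarrow> (a, b) \<ominus>\<^bsub>FN\<^esub> (c, d) = (a \<ominus> c, b \<ominus> d)"
  using C.diff_submodule[OF submodule_plus_i[OF submodule_N], of "(a, b)" "(c, d)"]
  by (simp add: complexification_diff plus_i_def)

lemma submodule_K_LN: "submodule K (scalars :: real ring) LN"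
  by (rule LN.submoduleI_smult) auto

lemma submodule_K_FN: "submodule (plus_i K) (scalars :: complex ring) FN"
  by (rule FN.submoduleI_smult) (auto simp: plus_i_def diff_eq_smult)

lemma coset_LN [simp]: "S +>\<^bsub>LN\<^esub> a = S +> a"
  by (simp add: a_r_coset_def r_coset_def)

lemma coset_FN [simp]: "S +>\<^bsub>FN\<^esub> x = S +>\<^bsub>F\<^esub> x"
  by (simp add: a_r_coset_def r_coset_def)

lemma coset_eq_iff_LN: "a \<in> N \<Longrightarrow> b \<in> N \<Longrightarrow> K +> a = K +> b \<longleftrightarrow> a \<ominus> b \<in> K"
  using coset_eq_iff[OF submodule_K, of a b] by simp

text \<open>The Jordan product need not be associative, so ring ideals do not apply here.
  Independence of representatives comes from \<open>c \<otimes> d - a \<otimes> b = (c - a)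
  \<otimes> d + a \<otimes> (d - b)\<close>, which lies in the Jordan ideal
  \<open>J\<close>.\<close>

lemma coset_jordan:
  assumes a: "a \<in> N" and b: "b \<in> N"
  shows "rcoset_mult LN K (K +> a) (K +> b) = K +> a \<otimes> b"
proof -
  have eq: "K +> c \<otimes> d = K +> a \<otimes> b" if c: "c \<in> N" "K +> c = K +> a" and d: "d \<in> N" "K +> d = K +> b" for c d
  proof -
    have "c \<ominus> a \<in> J" "d \<ominus> b \<in> J"
      using coset_eq_iff_LN[of c a] coset_eq_iff_LN[of d b] a b c d by auto
    then have "(c \<ominus> a) \<otimes> d \<oplus> a \<otimes> (d \<ominus> b) \<in> J"
      using a d by simp
    also have "(c \<ominus> a) \<otimes> d \<oplus> a \<otimes> (d \<ominus> b) = c \<otimes> d \<ominus> a \<otimes> b"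
      using a b c d by (simp add: jordan_diff_left jordan_diff_right diff_add_diff)
    finally show ?thesis
      using a b c d by (simp add: coset_eq_iff_LN diff_eq_smult)
  qed
  have "(\<Union>c\<in>K +>\<^bsub>LN\<^esub> a. \<Union>d\<in>K +>\<^bsub>LN\<^esub> b. K +> c \<otimes> d) = K +> a \<otimes> b"
    by (rule LN.coset_UN2[OF submodule_K_LN]) (simp add: a, simp add: b, rule eq, simp_all)
  then show ?thesis
    by (simp add: rcoset_mult_def)
qed

text \<open>The splitting of \<open>coset_jordan\<close> again, with another reason for membership
  in \<open>J\<close>: \<open>[c - a, d]\<close> and \<open>[a, d - b]\<close> belong to it because
  \<open>d\<close> and \<open>a\<close> normalize \<open>J\<close>.\<close>

lemma coset_bracket:
  assumes a: "a \<in> N" and b: "b \<in> N"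
  shows "(\<Union>c\<in>K +> a. \<Union>d\<in>K +> b. K +> bracket L c d) = K +> bracket L a b"
proof -
  have eq: "K +> bracket L c d = K +> bracket L a b"
    if c: "c \<in> N" "K +> c = K +> a" and d: "d \<in> N" "K +> d = K +> b" for c d
  proof -
    have "c \<ominus> a \<in> J" "d \<ominus> b \<in> J"
      using coset_eq_iff_LN[of c a] coset_eq_iff_LN[of d b] a b c d by auto
    then have "bracket L (c \<ominus> a) d \<oplus> bracket L a (d \<ominus> b) \<in> J"
      using a d by simp
    also have "bracket L (c \<ominus> a) d \<oplus> bracket L a (d \<ominus> b) = bracket L c d \<ominus> bracket L a b"
      using a b c d by (simp add: bracket_diff_left bracket_diff_right diff_add_diff)
    finally show ?thesis
      using a b c d by (simp add: coset_eq_iff_LN diff_eq_smult)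
  qed
  have "(\<Union>c\<in>K +>\<^bsub>LN\<^esub> a. \<Union>d\<in>K +>\<^bsub>LN\<^esub> b. K +> bracket L c d) = K +> bracket L a b"
    by (rule LN.coset_UN2[OF submodule_K_LN]) (simp add: a, simp add: b, rule eq, simp_all)
  then show ?thesis
    by simp
qed

lemma Lred_simps:
  "carrier Lred = (\<lambda>a. K +> a) ` N"
  "a \<in> N \<Longrightarrow> b \<in> N \<Longrightarrow> (K +> a) \<otimes>\<^bsub>Lred\<^esub> (K +> b) = K +> a \<otimes> b"
  "a \<in> N \<Longrightarrow> b \<in> N \<Longrightarrow> (K +> a) \<oplus>\<^bsub>Lred\<^esub> (K +> b) = K +> a \<oplus> b"
  "a \<in> N \<Longrightarrow> b \<in> N \<Longrightarrow> bracket Lred (K +> a) (K +> b) = K +> bracket L a b"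
  "a \<in> N \<Longrightarrow> c \<odot>\<^bsub>Lred\<^esub> (K +> a) = K +> c \<odot> a"
  "\<one>\<^bsub>Lred\<^esub> = K +> \<one>"
  "\<zero>\<^bsub>Lred\<^esub> = K +> \<zero>"
  "a \<in> N \<Longrightarrow> nrm Lred (K +> a) = (INF i\<in>K. nrm L (a \<oplus> i))"
  using LN.a_rcosets_eq[of K] coset_jordan[of a b] LN.coset_add[OF submodule_K_LN, of a b]
    coset_bracket[of a b] LN.coset_smult[OF submodule_K_LN, of a c] LN.coset_zero[OF submodule_K_LN]
    LN.coset_norm_eq[OF submodule_K_LN, of a]
  by (simp_all add: reduced_algebra_def lie_jordan_quotient_def FactRing_def)

sublocale Q: banach_quotient LN K Lred "\<lambda>a. K +> a"
proof unfold_locales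
  show "closedin (norm_topology LN) K"
    by (rule closedin_submodule[OF submodule_N closed_K]) simp
qed (simp_all add: Lred_simps coset_eq_iff_LN LN_diff)

sublocale Lred: banach_space Lred
  by (rule Q.banach_space_W)

lemma lie_jordan_algebra_LN: "lie_jordan_algebra k LN"
  by (rule lie_jordan_subalgebra[OF submodule_N]) simp_all

lemma lie_jordan_algebra_Lred: "lie_jordan_algebra k Lred"
  by (rule lie_jordan_algebra_quotient[OF lie_jordan_algebra_LN Q.banach_quotient_axioms])
    (simp_all add: Lred_simps)

lemma N_diff [simp]: "a \<in> N \<Longrightarrow> b \<in> N \<Longrightarrow> a \<ominus> b \<in> N"
  by (simp add: diff_eq_smult)

lemma N_minus [simp]: "a \<in> N \<Longrightarrow> \<ominus> a \<in> N"
  by (simp add: minus_eq_smult)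

lemma Lred_diff: "a \<in> N \<Longrightarrow> b \<in> N \<Longrightarrow> (K +> a) \<ominus>\<^bsub>Lred\<^esub> (K +> b) = K +> (a \<ominus> b)"
  using Q.p_diff[of a b] by (simp add: LN_diff)

lemma Lred_minus: "a \<in> N \<Longrightarrow> \<ominus>\<^bsub>Lred\<^esub> (K +> a) = K +> \<ominus> a"
  using Q.p_minus[of a] minus_submodule[OF submodule_N, of a] by simp

text \<open>The associative product combines Jordan products and brackets. The former are absorbed
  because \<open>J\<close> is a Jordan ideal, the latter because the factors come from
  \<open>N\<close>.\<close>

lemma K_absorb:
  assumes "a \<in> N" "b \<in> N" "i \<in> K" "j \<in> K"
  shows "(a, b) \<otimes>\<^bsub>F\<^esub> (i, j) \<in> plus_i K" "(i, j) \<otimes>\<^bsub>F\<^esub> (a, b) \<in> plus_i K"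
  using assms by (simp_all add: plus_i_def diff_eq_smult)

lemma nred_coset: "nred (K +> a, K +> b) = coset_norm FN (plus_i K +>\<^bsub>F\<^esub> (a, b))"
  by (simp add: nred_def coset_plus_i coset_norm_def)

text \<open>The target is the complexification of the reduced algebra, not the set of cosets of
  pairs. In this way \<open>Fred\<close> becomes a C*-algebra directly, with nothing to transport
  along an isomorphism.\<close>

sublocale CQ: cstar_quotient FN "plus_i K" Fred "\<lambda>(a, b). (K +> a, K +> b)"
proof (intro cstar_quotient.intro banach_quotient.intro banach_quotient_axioms.intro
    cstar_quotient_axioms.intro)
  show "unital_cstar_algebra FN" "banach_space FN"
    by unfold_locales
  show "closedin (norm_topology FN) (plus_i K)"
    by (rule C.closedin_submodule[OF submodule_plus_i[OF submodule_N] closedin_plus_i[OF closed_K]])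
      (auto simp: plus_i_def)
  show "(\<lambda>(a, b). (K +> a, K +> b)) ` carrier FN = carrier Fred"
    by (auto simp: Lred_simps plus_i_def)
  show "(case \<zero>\<^bsub>FN\<^esub> of (a, b) \<Rightarrow> (K +> a, K +> b)) = \<zero>\<^bsub>Fred\<^esub>"
    "(case \<one>\<^bsub>FN\<^esub> of (a, b) \<Rightarrow> (K +> a, K +> b)) = \<one>\<^bsub>Fred\<^esub>"
    by (simp_all add: Lred_simps)
  fix x assume x: "x \<in> carrier FN"
  then obtain a b where ab: "x = (a, b)" "a \<in> N" "b \<in> N"
    by (auto simp: plus_i_def)
  show "(case c \<odot>\<^bsub>FN\<^esub> x of (a, b) \<Rightarrow> (K +> a, K +> b)) =
      c \<odot>\<^bsub>Fred\<^esub> (case x of (a, b) \<Rightarrow> (K +> a, K +> b))" for c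
    using ab by (simp add: Lred_simps Lred_diff)
  show "(case star FN x of (a, b) \<Rightarrow> (K +> a, K +> b)) =
      star Fred (case x of (a, b) \<Rightarrow> (K +> a, K +> b))"
    using ab by (simp add: Lred_minus)
  show "nrm Fred (case x of (a, b) \<Rightarrow> (K +> a, K +> b)) = (INF i\<in>plus_i K. nrm FN (x \<oplus>\<^bsub>FN\<^esub> i))"
    using FN.coset_norm_eq[OF submodule_K_FN x] ab by (simp add: nred_coset)
  show "x \<otimes>\<^bsub>FN\<^esub> i \<in> plus_i K" "i \<otimes>\<^bsub>FN\<^esub> x \<in> plus_i K" if "i \<in> plus_i K" for i
    using that ab K_absorb[of a b "fst i" "snd i"] by (auto simp: plus_i_def)
  fix y assume "y \<in> carrier FN"
  then obtain c d where cd: "y = (c, d)" "c \<in> N" "d \<in> N"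
    by (auto simp: plus_i_def)
  show "(case x \<oplus>\<^bsub>FN\<^esub> y of (a, b) \<Rightarrow> (K +> a, K +> b)) =
      (case x of (a, b) \<Rightarrow> (K +> a, K +> b)) \<oplus>\<^bsub>Fred\<^esub> (case y of (a, b) \<Rightarrow> (K +> a, K +> b))"
    using ab cd by (simp add: Lred_simps)
  show "(case x \<otimes>\<^bsub>FN\<^esub> y of (a, b) \<Rightarrow> (K +> a, K +> b)) =
      (case x of (a, b) \<Rightarrow> (K +> a, K +> b)) \<otimes>\<^bsub>Fred\<^esub> (case y of (a, b) \<Rightarrow> (K +> a, K +> b))"
    using ab cd by (simp add: Lred_simps Lred_diff)
  show "(case x of (a, b) \<Rightarrow> (K +> a, K +> b)) = (case y of (a, b) \<Rightarrow> (K +> a, K +> b)) \<longleftrightarrow>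
      x \<ominus>\<^bsub>FN\<^esub> y \<in> plus_i K"
    using ab cd by (simp add: FN_diff coset_eq_iff_LN) (simp add: plus_i_def)
qed

text \<open>A representative \<open>a'\<close> of the class of \<open>a\<close> gives the
  representative \<open>(a', 0)\<close> of the same norm. Conversely, a representative
  \<open>(c, d)\<close> of the class of \<open>(a, 0)\<close> has \<open>c\<close> in the class of
  \<open>a\<close>, and \<open>|c| \<le> n (c, d)\<close>.\<close>

lemma nred_real:
  assumes "X \<in> carrier Lred"
  shows "nred (X, \<zero>\<^bsub>Lred\<^esub>) = nrm Lred X"
proof -
  obtain a where a: "a \<in> N" "X = K +> a"
    using assms by (auto simp: Lred_simps)
  have X: "nred (X, \<zero>\<^bsub>Lred\<^esub>) = nrm Fred (case (a, \<zero>) of (a, b) \<Rightarrow> (K +> a, K +> b))"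
    using a by (simp add: Lred_simps)
  have aFN: "(a, \<zero>) \<in> carrier FN"
    using a by (simp add: plus_i_def)
  show ?thesis
  proof (rule antisym)
    show "nred (X, \<zero>\<^bsub>Lred\<^esub>) \<le> nrm Lred X"
    proof (rule field_le_epsilon)
      fix e :: real assume "0 < e"
      then have "nrm Lred (K +> a) < nrm Lred X + e"
        using a by simp
      then obtain a' where a': "a' \<in> N" "K +> a' = K +> a" "nrm L a' < nrm Lred X + e"
        using Q.norm_p_approx[of a "nrm Lred X + e"] a by auto
      have "nred (X, \<zero>\<^bsub>Lred\<^esub>) = nrm Fred (case (a', \<zero>) of (a, b) \<Rightarrow> (K +> a, K +> b))"
        unfolding X using a' by simp
      also have "\<dots> \<le> nrm FN (a', \<zero>)"
        using a' by (intro CQ.norm_p_le) (simp add: plus_i_def)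
      finally show "nred (X, \<zero>\<^bsub>Lred\<^esub>) \<le> nrm Lred X + e"
        using a' by (simp add: n_real)
    qed
    show "nrm Lred X \<le> nred (X, \<zero>\<^bsub>Lred\<^esub>)"
    proof (rule field_le_epsilon)
      fix e :: real assume "0 < e"
      then have "nrm Fred (case (a, \<zero>) of (a, b) \<Rightarrow> (K +> a, K +> b)) < nred (X, \<zero>\<^bsub>Lred\<^esub>) + e"
        unfolding X by simp
      then obtain y where y: "y \<in> carrier FN"
          "(case y of (a, b) \<Rightarrow> (K +> a, K +> b)) = (case (a, \<zero>) of (a, b) \<Rightarrow> (K +> a, K +> b))"
          "nrm FN y < nred (X, \<zero>\<^bsub>Lred\<^esub>) + e"
        using CQ.norm_p_approx[OF aFN] by metis
      then obtain c d where cd: "y = (c, d)" "c \<in> N" "d \<in> N"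
        by (auto simp: plus_i_def)
      have "nrm Lred X \<le> nrm L c"
        using Q.norm_p_le[of c] y cd a by simp
      also have "\<dots> \<le> n (c, d)"
        using cd by (intro norm_Re_le) simp_all
      finally show "nrm Lred X \<le> nred (X, \<zero>\<^bsub>Lred\<^esub>) + e"
        using y cd by simp
    qed
  qed
qed

lemma associated_cstar_norm_nred: "associated_cstar_norm k Lred nred"
  using CQ.unital_cstar_algebra_W nred_real by (simp add: associated_cstar_norm_def)

text \<open>The reduced algebra enters the locale of the given one, so
  \<open>unital_LJB_algebra\<close> becomes available for it.\<close>

sublocale Lred: lie_jordan_cstar k Lred nred
proof (intro lie_jordan_cstar.intro lie_jordan_cstar_axioms.intro)
  show "\<one>\<^bsub>Lred\<^esub> \<in> carrier Lred"
    by (simp add: Lred_simps)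
  show "\<one>\<^bsub>Lred\<^esub> \<otimes>\<^bsub>Lred\<^esub> X = X" if "X \<in> carrier Lred" for X
    using that by (auto simp: Lred_simps unit)
qed (fact lie_jordan_algebra_Lred Lred.banach_space_axioms associated_cstar_norm_nred)+

section \<open>Identification of the C*-quotient with the complexified reduced algebra\<close>

lemma ideal_K: "ideal (plus_i K) FN"
proof (rule idealI)
  show "ring FN"
    by unfold_locales
  show "subgroup (plus_i K) (add_monoid FN)"
    by (rule submodule.axioms(1)[OF submodule_K_FN])
qed (blast intro: CQ.I_mult)+

text \<open>\<open>FN\<close> maps onto both algebras, by \<open>?P\<close> and by
  \<open>?\<pi>\<close>, and the two maps have the same fibres; the isomorphism is the induced
  comparison \<open>?P x \<mapsto> ?\<pi> x\<close>. As cosets are rectangles, it can be written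
  without representatives, by projecting to the two sides.\<close>

lemma isometric_star_iso_quotient:
  "isometric_star_iso (star_quotient FN (plus_i K)) Fred (\<lambda>X. (fst ` X, snd ` X))"
proof -
  let ?S = "star_quotient FN (plus_i K)" and ?h = "\<lambda>X. (fst ` X, snd ` X)"
  let ?P = "\<lambda>x. plus_i K +>\<^bsub>F\<^esub> x" and ?\<pi> = "\<lambda>(a, b). (K +> a, K +> b)"
  have hP: "?h (?P x) = ?\<pi> x" if x: "x \<in> carrier FN" for x
  proof -
    obtain a b where ab: "x = (a, b)" "a \<in> N" "b \<in> N"
      using x by (auto simp: plus_i_def)
    \<comment> \<open>Projecting a product returns a factor only if the other factor is
      nonempty.\<close>
    have "a \<in> K +> a" "b \<in> K +> b"
      using coset_self[OF submodule_K] ab by simp_all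
    then have "K +> a \<noteq> {}" "K +> b \<noteq> {}"
      by blast+
    then show ?thesis
      by (simp add: ab coset_plus_i)
  qed
  have carrier: "carrier ?S = ?P ` carrier FN"
    using FN.a_rcosets_eq[of "plus_i K"] by (simp add: star_quotient_def FactRing_def)
  have mult: "?P x \<otimes>\<^bsub>?S\<^esub> ?P y = ?P (x \<otimes>\<^bsub>FN\<^esub> y)" if "x \<in> carrier FN" "y \<in> carrier FN" for x y
    using ideal.rcoset_mult_add[OF ideal_K that] by (simp add: star_quotient_def FactRing_def)
  have add: "?P x \<oplus>\<^bsub>?S\<^esub> ?P y = ?P (x \<oplus>\<^bsub>FN\<^esub> y)" if "x \<in> carrier FN" "y \<in> carrier FN" for x y
    using FN.coset_add[OF submodule_K_FN that] by (simp add: star_quotient_def FactRing_def)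
  have one: "\<one>\<^bsub>?S\<^esub> = ?P \<one>\<^bsub>FN\<^esub>"
    by (simp add: star_quotient_def FactRing_def)
  have smult: "c \<odot>\<^bsub>?S\<^esub> ?P x = ?P (c \<odot>\<^bsub>FN\<^esub> x)" if "x \<in> carrier FN" for c x
    using FN.coset_smult[OF submodule_K_FN that] by (simp add: star_quotient_def)
  \<comment> \<open>Equality of fibres. It gives injectivity of the comparison, and it lets the
    involution on cosets inherit its independence of representatives from
    \<open>Fred\<close>.\<close>
  have eq_iff: "?P x = ?P y \<longleftrightarrow> ?\<pi> x = ?\<pi> y" if "x \<in> carrier FN" "y \<in> carrier FN" for x y
    using FN.coset_eq_iff[OF submodule_K_FN that] CQ.p_eq_iff[OF that] by simp
  have star: "star ?S (?P x) = ?P (star FN x)" if x: "x \<in> carrier FN" for x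
  proof -
    have "(\<Union>y\<in>plus_i K +>\<^bsub>FN\<^esub> x. ?P (star FN y)) = ?P (star FN x)"
    proof (rule FN.coset_UN[OF submodule_K_FN x])
      fix y assume y: "y \<in> carrier FN" "plus_i K +>\<^bsub>FN\<^esub> y = plus_i K +>\<^bsub>FN\<^esub> x"
      then have "?\<pi> y = ?\<pi> x"
        using eq_iff[OF y(1) x] by (simp only: coset_FN)
      then have "?\<pi> (star FN y) = ?\<pi> (star FN x)"
        using CQ.p_star[OF y(1)] CQ.p_star[OF x] by (simp only:)
      then show "?P (star FN y) = ?P (star FN x)"
        using eq_iff[OF FN.star_closed[OF y(1)] FN.star_closed[OF x]] by (simp only:)
    qed
    then show ?thesis
      by (simp add: star_quotient_def)
  qed
  have nrm: "nrm ?S (?P x) = nrm Fred (?\<pi> x)" for x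
    by (cases x) (simp add: star_quotient_def nred_coset)
  have "?h \<in> ring_hom ?S Fred"
  proof (rule ring_hom_memI)
    fix X assume "X \<in> carrier ?S"
    then obtain x where x: "x \<in> carrier FN" "X = ?P x"
      unfolding carrier by blast
    show "?h X \<in> carrier Fred"
      unfolding x(2) hP[OF x(1)] using CQ.p_closed[OF x(1)] .
    fix Y assume "Y \<in> carrier ?S"
    then obtain y where y: "y \<in> carrier FN" "Y = ?P y"
      unfolding carrier by blast
    show "?h (X \<otimes>\<^bsub>?S\<^esub> Y) = ?h X \<otimes>\<^bsub>Fred\<^esub> ?h Y"
      unfolding x(2) y(2) mult[OF x(1) y(1)] hP[OF x(1)] hP[OF y(1)]
      by (subst hP, simp only: FN.m_closed x y) (rule CQ.p_mult[OF x(1) y(1)])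
    show "?h (X \<oplus>\<^bsub>?S\<^esub> Y) = ?h X \<oplus>\<^bsub>Fred\<^esub> ?h Y"
      unfolding x(2) y(2) add[OF x(1) y(1)] hP[OF x(1)] hP[OF y(1)]
      by (subst hP, simp only: FN.add.m_closed x y) (rule CQ.p_add[OF x(1) y(1)])
  next
    show "?h \<one>\<^bsub>?S\<^esub> = \<one>\<^bsub>Fred\<^esub>"
      unfolding one by (subst hP, simp only: FN.one_closed) (rule CQ.p_one)
  qed
  moreover have "bij_betw ?h (carrier ?S) (carrier Fred)"
  proof (rule bij_betw_imageI)
    show "inj_on ?h (carrier ?S)"
    proof (rule inj_onI)
      fix X Y assume "X \<in> carrier ?S" "Y \<in> carrier ?S" and eq: "?h X = ?h Y"
      then obtain x y where x: "x \<in> carrier FN" "X = ?P x" and y: "y \<in> carrier FN" "Y = ?P y"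
        unfolding carrier by blast
      show "X = Y"
        using eq unfolding x(2) y(2) hP[OF x(1)] hP[OF y(1)] eq_iff[OF x(1) y(1)] .
    qed
    have "?h ` carrier ?S = (\<lambda>x. ?h (?P x)) ` carrier FN"
      unfolding carrier by (rule image_image)
    also have "\<dots> = ?\<pi> ` carrier FN"
      by (rule image_cong[OF refl hP])
    also have "\<dots> = carrier Fred"
      by (rule CQ.p_surj)
    finally show "?h ` carrier ?S = carrier Fred" .
  qed
  moreover have "?h (c \<odot>\<^bsub>?S\<^esub> X) = c \<odot>\<^bsub>Fred\<^esub> ?h X" "?h (star ?S X) = star Fred (?h X)"
    "nrm Fred (?h X) = nrm ?S X" if "X \<in> carrier ?S" for c X
  proof -
    obtain x where x: "x \<in> carrier FN" "X = ?P x"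
      using \<open>X \<in> carrier ?S\<close> unfolding carrier by blast
    show "?h (c \<odot>\<^bsub>?S\<^esub> X) = c \<odot>\<^bsub>Fred\<^esub> ?h X"
      unfolding x(2) smult[OF x(1)] hP[OF x(1)] hP[OF FN.smult_mem[OF x(1)]]
      by (rule CQ.p_smult[OF x(1)])
    show "?h (star ?S X) = star Fred (?h X)"
      unfolding x(2) star[OF x(1)] hP[OF x(1)] hP[OF FN.star_closed[OF x(1)]]
      by (rule CQ.p_star[OF x(1)])
    show "nrm Fred (?h X) = nrm ?S X"
      unfolding x(2) hP[OF x(1)] nrm ..
  qed
  ultimately show ?thesis
    unfolding isometric_star_iso_def ring_iso_def by blast
qed

end

theorem theorem7:
  fixes k :: real and L :: "'a lie_jordan" and n :: "'a \<times> 'a \<Rightarrow> real" and J :: "'a set"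
  assumes "unital_LJB_algebra k L"
    and "associated_cstar_norm k L n"
    and "jordan_ideal L J" and "closedin (norm_topology L) J"
  defines "F \<equiv> complexification k L n"
    and "N \<equiv> normalizer_of L J"
    and "Lt \<equiv> reduced_algebra L J"
    and "Obs \<equiv> plus_i (normalizer_of L J)"
    and "D \<equiv> plus_i J"
  shows "unital_LJB_algebra k Lt \<and>
    ideal (D \<inter> Obs) (F\<lparr>carrier := Obs\<rparr>) \<and>
    star_quotient (F\<lparr>carrier := plus_i N\<rparr>) (plus_i (N \<inter> J)) =
      star_quotient (F\<lparr>carrier := Obs\<rparr>) (D \<inter> Obs) \<and>
    (\<exists>nt. associated_cstar_norm k Lt nt \<and>
      (\<exists>h. isometric_star_iso (star_quotient (F\<lparr>carrier := Obs\<rparr>) (D \<inter> Obs))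
             (complexification k Lt nt) h \<and>
           (\<forall>a\<in>N. \<forall>b\<in>N. h ((D \<inter> Obs) +>\<^bsub>F\<^esub> (a, b)) =
              ((N \<inter> J) +>\<^bsub>L\<^esub> a, (N \<inter> J) +>\<^bsub>L\<^esub> b))))"
proof -
  interpret L: unital_LJB_algebra k L by fact
  interpret R: jordan_reduction k L n J
    using assms(2-4) L.one_closed L.unit by unfold_locales
  \<comment> \<open>Two squares \<open>J \<times> J\<close> and \<open>N \<times> N\<close>
    intersect in the square over \<open>N \<inter> J\<close>, so the two quotients of the displayed
    chain are literally the same object.\<close>
  have DO: "D \<inter> Obs = plus_i (N \<inter> J)"
    by (auto simp: D_def Obs_def N_def plus_i_def)
  have "(fst ` (plus_i (N \<inter> J) +>\<^bsub>F\<^esub> (a, b)), snd ` (plus_i (N \<inter> J) +>\<^bsub>F\<^esub> (a, b))) =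
      ((N \<inter> J) +>\<^bsub>L\<^esub> a, (N \<inter> J) +>\<^bsub>L\<^esub> b)" if "a \<in> N" "b \<in> N" for a b
  proof -
    have "a \<in> (N \<inter> J) +>\<^bsub>L\<^esub> a" "b \<in> (N \<inter> J) +>\<^bsub>L\<^esub> b"
      using L.coset_self[OF R.submodule_K] that by (simp_all add: N_def)
    then have "(N \<inter> J) +>\<^bsub>L\<^esub> a \<noteq> {}" "(N \<inter> J) +>\<^bsub>L\<^esub> b \<noteq> {}"
      by blast+
    then show ?thesis
      by (simp add: F_def R.coset_plus_i)
  qed
  then show ?thesis
    unfolding DO
    using R.Lred.unital_LJB_algebra R.ideal_K R.associated_cstar_norm_nred R.isometric_star_iso_quotient
    unfolding F_def N_def Lt_def Obs_def by blast
qed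

end
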